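(* For every finite-rank median algebra $X$, the intrinsic median uniformity $\mathcal U_{\mathrm m}$ is Hausdorff. Moreover, its minimal median compactification (MMC) $\widehat X$ satisfies $\operatorname{rank}(\widehat X)=\operatorname{rank}(X)$ and $\dim\widehat X\le\operatorname{rank}(X)$.
   Context: A median algebra is a set $X$ with a ternary operation $m\colon X^3\to X$ that is symmetric in all variables and satisfies $m(a,b,b)=b$ and $m(m(a,x,b),x,c)=m(a,x,m(b,x,c))$. Intervals: $[x,y]=\{z: m(x,y,z)=z\}$. A subalgebra is a chain if it carries a linear order $\le$ for which $m(a,b,c)=b$ whenever $a\le b\le c$. The rank of a nontrivial median algebra is the supremum of the $n\in\mathbb N$ for which the Boolean hypercube $\{0,1\}^n$ (coordinatewise median) embeds as a median subalgebra; the one-point algebra has rank $0$. Branches: $B^u_v=\{x: m(u,x,v)\neq v\}$. The median uniformity $\mathcal U_{\mathrm m}$ is the covering uniformity with uniform subbase all two-member covers $\{B^u_v,B^v_u\}$, where $[u,v]$ runs over all chain intervals with $u\neq v$: a cover belongs to $\mathcal U_{\mathrm m}$ iff it is refined by a finite common refinement of such covers. It is precompact and the median operation is uniformly continuous for it. When $\mathcal U_{\mathrm m}$ is Hausdorff, the MMC $\widehat X$ is the Hausdorff completion of $(X,\mathcal U_{\mathrm m})$, a compact Hausdorff topological median algebra with the unique continuous extension of $m$. Here $\dim$ is the topological (covering) dimension. *)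

theory Defs
  imports "HOL-Analysis.Analysis" "HOL-Library.Extended_Nat"
begin

section \<open>Median algebras\<close>

locale median_algebra =
  fixes X :: "'a set" and m :: "'a \<Rightarrow> 'a \<Rightarrow> 'a \<Rightarrow> 'a"
  assumes closed: "\<lbrakk>a \<in> X; b \<in> X; c \<in> X\<rbrakk> \<Longrightarrow> m a b c \<in> X"
    and swap_left: "\<lbrakk>a \<in> X; b \<in> X; c \<in> X\<rbrakk> \<Longrightarrow> m a b c = m b a c"
    and swap_right: "\<lbrakk>a \<in> X; b \<in> X; c \<in> X\<rbrakk> \<Longrightarrow> m a b c = m a c b"
    and absorb: "\<lbrakk>a \<in> X; b \<in> X\<rbrakk> \<Longrightarrow> m a b b = b"
    and assoc: "\<lbrakk>a \<in> X; b \<in> X; c \<in> X; x \<in> X\<rbrakk> \<Longrightarrow>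
      m (m a x b) x c = m a x (m b x c)"

definition median_interval ::
    "'a set \<Rightarrow> ('a \<Rightarrow> 'a \<Rightarrow> 'a \<Rightarrow> 'a) \<Rightarrow> 'a \<Rightarrow> 'a \<Rightarrow> 'a set" where
  "median_interval X m x y = {z \<in> X. m x y z = z}"

definition median_subalgebra ::
    "'a set \<Rightarrow> ('a \<Rightarrow> 'a \<Rightarrow> 'a \<Rightarrow> 'a) \<Rightarrow> 'a set \<Rightarrow> bool" where
  "median_subalgebra X m S \<longleftrightarrow> S \<subseteq> X \<and> (\<forall>a\<in>S. \<forall>b\<in>S. \<forall>c\<in>S. m a b c \<in> S)"

definition median_chain ::
    "'a set \<Rightarrow> ('a \<Rightarrow> 'a \<Rightarrow> 'a \<Rightarrow> 'a) \<Rightarrow> 'a set \<Rightarrow> bool" where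
  "median_chain X m S \<longleftrightarrow> median_subalgebra X m S \<and>
    (\<exists>r. linear_order_on S r \<and>
      (\<forall>a\<in>S. \<forall>b\<in>S. \<forall>c\<in>S. (a, b) \<in> r \<and> (b, c) \<in> r \<longrightarrow> m a b c = b))"

text \<open>The Boolean hypercube of dimension \<open>n\<close>, with its vertices encoded as extensional functions
  on \<open>{..<n}\<close> so that there are exactly \<open>2 ^ n\<close> of them.\<close>

definition cube :: "nat \<Rightarrow> (nat \<Rightarrow> bool) set" where
  "cube n = {..<n} \<rightarrow>\<^sub>E UNIV"

definition cube_median ::
    "nat \<Rightarrow> (nat \<Rightarrow> bool) \<Rightarrow> (nat \<Rightarrow> bool) \<Rightarrow> (nat \<Rightarrow> bool) \<Rightarrow> (nat \<Rightarrow> bool)" where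
  "cube_median n a b c =
    (\<lambda>i\<in>{..<n}. (a i \<and> b i) \<or> (b i \<and> c i) \<or> (c i \<and> a i))"

definition median_embedding ::
    "'a set \<Rightarrow> ('a \<Rightarrow> 'a \<Rightarrow> 'a \<Rightarrow> 'a) \<Rightarrow> 'b set \<Rightarrow> ('b \<Rightarrow> 'b \<Rightarrow> 'b \<Rightarrow> 'b) \<Rightarrow> ('a \<Rightarrow> 'b) \<Rightarrow> bool"
  where
  "median_embedding X m Y m' f \<longleftrightarrow> f \<in> X \<rightarrow> Y \<and> inj_on f X \<and>
    (\<forall>a\<in>X. \<forall>b\<in>X. \<forall>c\<in>X. f (m a b c) = m' (f a) (f b) (f c))"

text \<open>The one-point algebra needs no separate clause: only the cube of dimension \<open>0\<close>, a single
  point, embeds in it, so its rank is \<open>0\<close>.\<close>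

definition median_rank :: "'a set \<Rightarrow> ('a \<Rightarrow> 'a \<Rightarrow> 'a \<Rightarrow> 'a) \<Rightarrow> enat" where
  "median_rank X m =
    Sup {enat n | n. \<exists>f. median_embedding (cube n) (cube_median n) X m f}"

text \<open>\<open>branch X m u v\<close> is $B^u_v$.\<close>

definition branch :: "'a set \<Rightarrow> ('a \<Rightarrow> 'a \<Rightarrow> 'a \<Rightarrow> 'a) \<Rightarrow> 'a \<Rightarrow> 'a \<Rightarrow> 'a set" where
  "branch X m u v = {x \<in> X. m u x v \<noteq> v}"


section \<open>Covering uniformities\<close>

definition is_cover :: "'a set \<Rightarrow> 'a set set \<Rightarrow> bool" where
  "is_cover X C \<longleftrightarrow> C \<subseteq> Pow X \<and> \<Union>C = X"

definition cover_refines :: "'a set set \<Rightarrow> 'a set set \<Rightarrow> bool" where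
  "cover_refines C D \<longleftrightarrow> (\<forall>A\<in>C. \<exists>B\<in>D. A \<subseteq> B)"

definition cover_star :: "'a set set \<Rightarrow> 'a set \<Rightarrow> 'a set" where
  "cover_star C S = \<Union>{A \<in> C. A \<inter> S \<noteq> {}}"

locale covering_uniformity =
  fixes X :: "'a set" and U :: "'a set set set"
  assumes nonempty: "U \<noteq> {}"
    and covers: "C \<in> U \<Longrightarrow> is_cover X C"
    and coarser: "\<lbrakk>C \<in> U; is_cover X D; cover_refines C D\<rbrakk> \<Longrightarrow> D \<in> U"
    and common: "\<lbrakk>C \<in> U; D \<in> U\<rbrakk> \<Longrightarrow> \<exists>E\<in>U. cover_refines E C \<and> cover_refines E D"
    and star_refinement: "C \<in> U \<Longrightarrow> \<exists>E\<in>U. \<forall>A\<in>E. \<exists>B\<in>C. cover_star E A \<subseteq> B"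

definition uniform_topology :: "'a set \<Rightarrow> 'a set set set \<Rightarrow> 'a topology" where
  "uniform_topology X U =
    topology (\<lambda>G. G \<subseteq> X \<and> (\<forall>x\<in>G. \<exists>C\<in>U. cover_star C {x} \<subseteq> G))"

lemma (in covering_uniformity) openin_uniform_topology:
  "openin (uniform_topology X U) G \<longleftrightarrow> G \<subseteq> X \<and> (\<forall>x\<in>G. \<exists>C\<in>U. cover_star C {x} \<subseteq> G)"
proof -
  let ?P = "\<lambda>G. G \<subseteq> X \<and> (\<forall>x\<in>G. \<exists>C\<in>U. cover_star C {x} \<subseteq> G)"
  have "?P (G \<inter> H)" if G: "?P G" and H: "?P H" for G H
  proof (intro conjI ballI)
    show "G \<inter> H \<subseteq> X" using conjunct1[OF G] by (rule le_infI1)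
    fix x assume "x \<in> G \<inter> H"
    then have "x \<in> G" and "x \<in> H" by simp_all
    obtain C where C: "C \<in> U" "cover_star C {x} \<subseteq> G"
      using bspec[OF conjunct2[OF G] \<open>x \<in> G\<close>] by (rule bexE)
    obtain D where D: "D \<in> U" "cover_star D {x} \<subseteq> H"
      using bspec[OF conjunct2[OF H] \<open>x \<in> H\<close>] by (rule bexE)
    obtain E where E: "E \<in> U" "cover_refines E C" "cover_refines E D"
      using common[OF C(1) D(1)] by (elim bexE conjE)
    have star: "cover_star E {x} \<subseteq> cover_star B {x}" if B: "cover_refines E B" for B
    proof
      fix y assume "y \<in> cover_star E {x}"
      then obtain A where A: "A \<in> E" "x \<in> A" "y \<in> A" by (auto simp: cover_star_def)
      then obtain A' where "A' \<in> B" "A \<subseteq> A'" using B by (auto simp: cover_refines_def)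
      then show "y \<in> cover_star B {x}" using A by (auto simp: cover_star_def)
    qed
    have "cover_star E {x} \<subseteq> G \<inter> H"
      by (rule Int_greatest[OF subset_trans[OF star[OF E(2)] C(2)] subset_trans[OF star[OF E(3)] D(2)]])
    then show "\<exists>C\<in>U. cover_star C {x} \<subseteq> G \<inter> H" using E(1) by (rule bexI)
  qed
  moreover have "?P (\<Union>K)" if K: "\<forall>G\<in>K. ?P G" for K
  proof (intro conjI ballI)
    show "\<Union>K \<subseteq> X" using K by (intro Union_least) simp
    fix x assume "x \<in> \<Union>K"
    then obtain G where G: "G \<in> K" "x \<in> G" by (rule UnionE)
    obtain C where C: "C \<in> U" "cover_star C {x} \<subseteq> G"
      using bspec[OF conjunct2[OF bspec[OF K G(1)]] G(2)] by (rule bexE)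
    have "cover_star C {x} \<subseteq> \<Union>K" using C(2) Union_upper[OF G(1)] by (rule subset_trans)
    then show "\<exists>C\<in>U. cover_star C {x} \<subseteq> \<Union>K" using C(1) by (rule bexI)
  qed
  ultimately have "istopology ?P" unfolding istopology_def by simp
  then show ?thesis
    unfolding uniform_topology_def by (simp only: topology_inverse')
qed

lemma (in covering_uniformity) topspace_uniform_topology:
  "topspace (uniform_topology X U) = X"
proof -
  obtain C where C: "C \<in> U" using nonempty by (meson ex_in_conv)
  have "cover_star C {x} \<subseteq> X" for x
    using covers[OF C] unfolding is_cover_def cover_star_def by auto
  then have "openin (uniform_topology X U) X"
    using C by (subst openin_uniform_topology) auto
  then have "X \<subseteq> topspace (uniform_topology X U)" by (rule openin_subset)
  moreover have "topspace (uniform_topology X U) \<subseteq> X"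
    using openin_topspace[of "uniform_topology X U"] by (subst (asm) openin_uniform_topology) simp
  ultimately show ?thesis by simp
qed

definition uniformly_complete :: "'a set \<Rightarrow> 'a set set set \<Rightarrow> bool" where
  "uniformly_complete X U \<longleftrightarrow>
    (\<forall>F. F \<noteq> bot \<and> eventually (\<lambda>x. x \<in> X) F \<and> (\<forall>C\<in>U. \<exists>A\<in>C. eventually (\<lambda>x. x \<in> A) F)
      \<longrightarrow> (\<exists>y. limitin (uniform_topology X U) (\<lambda>x. x) y F))"

text \<open>\<open>(Y, V)\<close> together with \<open>j\<close> is the Hausdorff completion of \<open>(X, U)\<close>: it is Hausdorff and
  complete, \<open>j\<close> has dense image, and \<open>U\<close> is the initial uniformity along \<open>j\<close>. If \<open>U\<close> is Hausdorff,
  the last condition makes \<open>j\<close> injective.\<close>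

definition hausdorff_completion ::
    "'a set \<Rightarrow> 'a set set set \<Rightarrow> 'b set \<Rightarrow> 'b set set set \<Rightarrow> ('a \<Rightarrow> 'b) \<Rightarrow> bool" where
  "hausdorff_completion X U Y V j \<longleftrightarrow>
    covering_uniformity Y V \<and> Hausdorff_space (uniform_topology Y V) \<and> uniformly_complete Y V \<and>
    j \<in> X \<rightarrow> Y \<and> uniform_topology Y V closure_of (j ` X) = Y \<and>
    (\<forall>C. C \<in> U \<longleftrightarrow> is_cover X C \<and> (\<exists>D\<in>V. cover_refines {X \<inter> j -` B | B. B \<in> D} C))"


section \<open>The median uniformity and the minimal median compactification\<close>

text \<open>The intersection with \<open>X\<close> only matters for the empty family of covers.\<close>

definition common_refinement :: "'a set \<Rightarrow> 'a set set set \<Rightarrow> 'a set set" where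
  "common_refinement X S = {X \<inter> (\<Inter>C\<in>S. f C) | f. \<forall>C\<in>S. f C \<in> C}"

definition generated_uniformity :: "'a set \<Rightarrow> 'a set set set \<Rightarrow> 'a set set set" where
  "generated_uniformity X \<S> =
    {C. is_cover X C \<and> (\<exists>S\<subseteq>\<S>. finite S \<and> cover_refines (common_refinement X S) C)}"

definition median_uniformity ::
    "'a set \<Rightarrow> ('a \<Rightarrow> 'a \<Rightarrow> 'a \<Rightarrow> 'a) \<Rightarrow> 'a set set set" where
  "median_uniformity X m = generated_uniformity X
    {{branch X m u v, branch X m v u} | u v.
      u \<in> X \<and> v \<in> X \<and> u \<noteq> v \<and> median_chain X m (median_interval X m u v)}"

definition topological_median_algebra ::
    "'a topology \<Rightarrow> ('a \<Rightarrow> 'a \<Rightarrow> 'a \<Rightarrow> 'a) \<Rightarrow> bool" where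
  "topological_median_algebra T m \<longleftrightarrow> median_algebra (topspace T) m \<and>
    continuous_map (prod_topology T (prod_topology T T)) T (\<lambda>(a, b, c). m a b c)"

text \<open>The completion carries the continuous extension of the median. That extension is unique since
  \<open>j\<close> has dense image in a Hausdorff space; compactness follows from precompactness of the
  median uniformity.\<close>

definition is_mmc ::
    "'a set \<Rightarrow> ('a \<Rightarrow> 'a \<Rightarrow> 'a \<Rightarrow> 'a) \<Rightarrow>
     'b set \<Rightarrow> 'b set set set \<Rightarrow> ('b \<Rightarrow> 'b \<Rightarrow> 'b \<Rightarrow> 'b) \<Rightarrow> ('a \<Rightarrow> 'b) \<Rightarrow> bool" where
  "is_mmc X m Y V m' j \<longleftrightarrow>
    hausdorff_completion X (median_uniformity X m) Y V j \<and>
    topological_median_algebra (uniform_topology Y V) m' \<and>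
    (\<forall>a\<in>X. \<forall>b\<in>X. \<forall>c\<in>X. m' (j a) (j b) (j c) = j (m a b c))"


section \<open>Covering dimension\<close>

definition covering_dim_le :: "'a topology \<Rightarrow> nat \<Rightarrow> bool" where
  "covering_dim_le T n \<longleftrightarrow>
    (\<forall>C. finite C \<and> (\<forall>A\<in>C. openin T A) \<and> \<Union>C = topspace T \<longrightarrow>
      (\<exists>D. finite D \<and> (\<forall>A\<in>D. openin T A) \<and> \<Union>D = topspace T \<and> cover_refines D C \<and>
        (\<forall>x\<in>topspace T. card {A \<in> D. x \<in> A} \<le> n + 1)))"

text \<open>The value is \<open>\<infinity>\<close> if no \<open>n\<close> qualifies. The empty space gets dimension \<open>0\<close> instead of the
  usual \<open>-1\<close>.\<close>

definition covering_dim :: "'a topology \<Rightarrow> enat" where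
  "covering_dim T = Inf {enat n | n. covering_dim_le T n}"

end

theory Submission
  imports Defs
begin

text \<open>
  Everything rests on one family of maps. If \<open>[u, v]\<close> is a chain interval, then
  \<open>x \<mapsto> m u x v\<close> is a homomorphism onto a chain, hence membership in a branch \<open>B\<^sup>u\<^sub>v\<close> is a
  homomorphism to the two-point median algebra (\<open>retraction_hom\<close>, \<open>branch_hom\<close>).

  \<^emph>\<open>Hausdorff property.\<close> An interval that is not a chain contains a square, and an interval without
  chain subintervals therefore contains cubes of every dimension (\<open>cube_without_chain\<close>). In finite rank any
  two points are thus separated by a pair of branches over a chain interval (\<open>separating_chain\<close>).

  \<^emph>\<open>Existence.\<close> The completion consists of the round Cauchy filters. The median carries every triple
  of members of a finite meet of branch covers into a member of that meet, because among three
  members of a two-element cover two coincide and branches are closed under medians with two arguments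
  inside. So it is uniformly continuous and extends.

  \<^emph>\<open>Rank.\<close> There are median terms that turn an arbitrary tuple of \<open>n + 2\<close> points into a homomorphic
  image of the \<open>n\<close>-cube, and that reproduce the cube from its bottom, top and atoms (\<open>cube_term\<close>).
  A cube of the compactification is reproduced by the terms; its parameters can be moved one by one into the
  dense subalgebra without making two vertices collide, since this is an open condition on each parameter.

  \<^emph>\<open>Dimension.\<close> Let finitely many chain intervals be given. If, however one shrinks \<open>n + 1\<close> of them,
  some point still projects into the interior of all of them, then these intervals cross, and
  the terms above produce an \<open>(n + 1)\<close>-cube. In rank \<open>n\<close> one can therefore shrink the given intervals so
  that every point is interior to at most \<open>n\<close> of them (\<open>narrow_family\<close>). Now choose \<open>n + 1\<close> levels
  in each interval. Cutting along the \<open>i\<close>-th level of all intervals gives a disjoint family of open cells, and a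
  point missed by all \<open>n + 1\<close> of these families would lie on levels of \<open>n + 1\<close> distinct intervals. So the cells form
  a uniform cover of order \<open>n + 1\<close> (\<open>low_order_refinement\<close>). It extends to the compactification without increase
  of order, and finite open covers of the compactification are uniform by the Lebesgue covering lemma.
\<close>

section \<open>Betweenness and retractions in a median algebra\<close>

context median_algebra begin

lemmas sym3 = swap_left swap_right

lemma absorb':
  assumes "a \<in> X" "b \<in> X"
  shows "m a a b = a" "m a b a = a" "m b a a = a"
  using assms absorb swap_left swap_right by metis+

lemma assoc':
  assumes "a \<in> X" "b \<in> X" "c \<in> X" "x \<in> X"
  shows "m x a (m x b c) = m x (m x a b) c"
  using assoc[of a b c x] assms sym3 closed by metis

text \<open>The equation \<open>m x y z = y\<close> says that \<open>y\<close> lies between \<open>x\<close> and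
  \<open>z\<close>. For a fixed base point \<open>x\<close>, associativity makes \<open>m x\<close> a meet operation
  with least element \<open>x\<close>, and betweenness is its order.\<close>

lemma between_trans:
  assumes "x \<in> X" "y \<in> X" "z \<in> X" "w \<in> X"
    and "m x y z = y" "m x z w = z"
  shows "m x y w = y" "m y z w = z"
proof -
  show "m x y w = y"
    using assoc'[of y z w x] assms by simp
  have "m y z w = m z y w" using sym3 assms by metis
  also have "\<dots> = m z (m z y x) w" using assms sym3 by metis
  also have "\<dots> = m z y (m z x w)" using assoc'[of y x w z] assms by simp
  also have "\<dots> = m z y z" using assms sym3 by metis
  finally show "m y z w = z" using absorb' assms by simp
qed

lemma median_between:
  assumes "a \<in> X" "b \<in> X" "c \<in> X"
  shows "m a (m a b c) b = m a b c" "m a (m a b c) c = m a b c" "m b (m a b c) c = m a b c"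
proof -
  have *: "m x (m x y z) y = m x y z" if "x \<in> X" "y \<in> X" "z \<in> X" for x y z
  proof -
    have "m x (m x y z) y = m x y (m x y z)" using that sym3 closed by metis
    also have "\<dots> = m x (m x y y) z" using assoc' that by simp
    also have "\<dots> = m x y z" using that absorb by simp
    finally show ?thesis .
  qed
  show "m a (m a b c) b = m a b c" using *[of a b c] assms by simp
  show "m a (m a b c) c = m a b c" using *[of a c b] assms sym3 by metis
  show "m b (m a b c) c = m a b c" using *[of b c a] assms sym3 by metis
qed

text \<open>The median is the only point in all three intervals, so that a map preserving betweenness preserves
  medians.\<close>

lemma median_unique:
  assumes X: "a \<in> X" "b \<in> X" "c \<in> X" "q \<in> X"
    and q: "m a q b = q" "m b q c = q" "m a q c = q"
  shows "m a b c = q"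
proof -
  define p where "p = m a b c"
  have p: "p \<in> X" "m a p b = p" "m b p c = p" "m a p c = p"
    unfolding p_def using X median_between closed by auto
  have *: "m x q (m x y z) = q"
    if "x \<in> X" "y \<in> X" "z \<in> X" "m x q y = q" "m x q z = q" for x y z
    using assoc'[of q y z x] that X by simp
  have aq: "m a q p = q" unfolding p_def using * X q by simp
  have bq: "m b q p = q" unfolding p_def using *[of b c a] X q sym3 by metis
  have "m q p b = p" using between_trans(2)[of a q p b] aq p X by simp
  then show ?thesis using bq p X sym3 p_def by metis
qed

text \<open>Relative to the base point \<open>z\<close>, the meet of \<open>x\<close> and \<open>y\<close> lies below
  each point \<open>m x y w\<close> of their interval. This is where distributivity comes from: with \<open>t = m x y
  z\<close> and \<open>p = m x y w\<close>, one computes the meet of \<open>t\<close> and \<open>p\<close> at base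
  point \<open>z\<close> by first changing to base point \<open>y\<close> and then to base point \<open>t\<close>,
  where it becomes a meet with \<open>t\<close> itself.\<close>

lemma meet_below_interval:
  assumes X: "x \<in> X" "y \<in> X" "z \<in> X" "w \<in> X"
  shows "m z (m x y z) (m x y w) = m x y z"
proof -
  define t where "t = m x y z"
  define p where "p = m x y w"
  have c: "t \<in> X" "p \<in> X" "m w y t \<in> X" "m y t z \<in> X" "m y z p \<in> X" using X closed by (auto simp: t_def p_def)
  have ytz: "m y t z = t" using X median_between by (simp add: t_def)
  \<comment> \<open>The meet of \<open>z\<close> and \<open>p\<close> at base point \<open>y\<close>, where \<open>p\<close> is itself the meet of \<open>x\<close> and \<open>w\<close>.\<close>
  have yzp: "m y z p = m w y t"
  proof -
    have "m y z p = m y z (m y x w)" using X by (simp add: p_def swap_left[of x])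
    also have "\<dots> = m y (m y z x) w" using X assoc' by simp
    also have "m y z x = t" using X sym3 t_def by metis
    finally show ?thesis using X c sym3 by metis
  qed
  have "m z t p = m z (m z t y) p" using ytz c X sym3 by metis
  also have "\<dots> = m z t (m z y p)" using assoc' c X by simp
  also have "\<dots> = m z t (m w y t)" using yzp c X sym3 by metis
  also have "\<dots> = m t (m t w y) z" using c X sym3 closed by metis
  also have "\<dots> = m t w (m t y z)" using assoc' c X by simp
  also have "m t y z = t" using ytz c X sym3 by metis
  also have "m t w t = t" using absorb' c X by simp
  finally show ?thesis by (simp add: t_def p_def)
qed

text \<open>Convexity of the set of points behind \<open>q\<close> as seen from \<open>u\<close>: if \<open>q\<close>
  lies below \<open>a\<close> and \<open>c\<close>, it lies below their meet, and by the preceding lemma the meet lies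
  below \<open>b\<close>.\<close>

lemma shadow_convex:
  assumes X: "u \<in> X" "q \<in> X" "a \<in> X" "b \<in> X" "c \<in> X"
    and "m u q a = q" "m u q c = q" "m a b c = b"
  shows "m u q b = q"
proof -
  have "m u q (m u a c) = q" using assoc'[of q a c u] assms by simp
  moreover have "m u (m u a c) b = m u a c"
    using meet_below_interval[of a c u b] assms sym3 closed by metis
  ultimately show ?thesis using between_trans(1)[of u q "m u a c" b] assms closed by simp
qed

text \<open>The points behind \<open>q = m a b p\<close> as seen from \<open>p\<close> form a convex set that contains
  \<open>a\<close> and \<open>b\<close>, hence \<open>s\<close> and \<open>t\<close>, hence \<open>p\<close> itself;
  therefore \<open>q = p\<close>.\<close>

lemma interval_convex:
  assumes X: "a \<in> X" "b \<in> X" "s \<in> X" "t \<in> X" "p \<in> X"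
    and "m a s b = s" "m a t b = t" "m s p t = p"
  shows "m a p b = p"
proof -
  define q where "q = m a b p"
  have q: "q \<in> X" "m p q a = q" "m p q b = q"
    using X closed median_between[of p a b] sym3 unfolding q_def by metis+
  have "m p q s = q" "m p q t = q"
    using shadow_convex[of p q a s b] shadow_convex[of p q a t b] q assms by simp_all
  then have "m p q p = q" using shadow_convex[of p q s p t] q assms by simp
  then have "q = p" using absorb' X q by simp
  then show ?thesis using X sym3 q_def by metis
qed

text \<open>In the lattice \<open>[u, v]\<close> the image of \<open>p\<close> lies between the meet and the join of
  the images of \<open>a\<close> and \<open>b\<close>, and these two points belong to the convex interval spanned by
  the images.\<close>

lemma retraction_between:
  assumes X: "u \<in> X" "v \<in> X" "a \<in> X" "b \<in> X" "p \<in> X" and p: "m a p b = p"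
  shows "m (m u a v) (m u p v) (m u b v) = m u p v"
proof -
  define A B P where "A = m u a v" and "B = m u b v" and "P = m u p v"
  have c: "A \<in> X" "B \<in> X" "P \<in> X" using X closed by (auto simp: A_def B_def P_def)
  \<comment> \<open>Used with \<open>(x, y)\<close> equal to \<open>(u, v)\<close> for the meet and to \<open>(v, u)\<close> for the join.\<close>
  have below: "m x (m x (m x a y) (m x b y)) (m x p y) = m x (m x a y) (m x b y)"
    if xy: "x \<in> X" "y \<in> X" for x y
  proof -
    let ?t = "m x (m x a y) (m x b y)"
    have t: "?t \<in> X" "m x ?t (m x a y) = ?t" "m x ?t (m x b y) = ?t"
      using X xy closed median_between by auto
    have "m x (m x a y) a = m x a y" "m x (m x b y) b = m x b y" "m x (m x a y) y = m x a y"
      using X xy median_between by auto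
    then have 1: "m x ?t a = ?t" "m x ?t b = ?t" "m x ?t y = ?t"
      using between_trans(1)[of x ?t "m x a y"] between_trans(1)[of x ?t "m x b y"] t X xy closed
      by simp_all
    have "m x ?t p = ?t" using shadow_convex[of x ?t a p b] 1 t X xy p by simp
    then show ?thesis using assoc'[of ?t p y x] 1 t X xy by simp
  qed
  define s t where "s = m u A B" and "t = m v A B"
  have st: "s \<in> X" "t \<in> X" "m A s B = s" "m A t B = t"
    using c X closed median_between by (auto simp: s_def t_def)
  have us: "m u s P = s" using below[of u v] X by (simp add: s_def A_def B_def P_def)
  have "m v (m v A B) P = m v A B"
  proof -
    have "A = m v a u" "B = m v b u" "P = m v p u"
      using X sym3 unfolding A_def B_def P_def by metis+
    then show ?thesis using below[of v u] X by simp
  qed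
  then have vt: "m v t P = t" by (simp add: t_def)
  have uv: "m u P v = P" using X median_between unfolding P_def by auto
  have "m s P v = P" using between_trans(2)[of u s P v] us uv c X st by simp
  then have "m v P s = P" using c X st sym3 by metis
  then have "m t P s = P" using between_trans(2)[of v t P s] vt c X st by simp
  then show ?thesis
    using interval_convex[of A B t s P] c st by (simp add: A_def B_def P_def)
qed

text \<open>A retraction preserves betweenness, and hence medians, because these are characterized by betweenness. As
  an identity, this is the long distributive law.\<close>

theorem retraction_hom:
  assumes X: "u \<in> X" "v \<in> X" "a \<in> X" "b \<in> X" "c \<in> X"
  shows "m u (m a b c) v = m (m u a v) (m u b v) (m u c v)"
  using median_unique[of "m u a v" "m u b v" "m u c v" "m u (m a b c) v"]
    retraction_between[of u v a b "m a b c"] retraction_between[of u v b c "m a b c"]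
    retraction_between[of u v a c "m a b c"] X closed median_between[of a b c] by simp

end

section \<open>Chain intervals and branches\<close>

definition majority :: "bool \<Rightarrow> bool \<Rightarrow> bool \<Rightarrow> bool" where
  "majority a b c \<longleftrightarrow> (a \<and> b) \<or> (b \<and> c) \<or> (c \<and> a)"

definition bool_hom :: "'a set \<Rightarrow> ('a \<Rightarrow> 'a \<Rightarrow> 'a \<Rightarrow> 'a) \<Rightarrow> ('a \<Rightarrow> bool) \<Rightarrow> bool" where
  "bool_hom X m h \<longleftrightarrow> (\<forall>a\<in>X. \<forall>b\<in>X. \<forall>c\<in>X. h (m a b c) = majority (h a) (h b) (h c))"

definition chain_interval :: "'a set \<Rightarrow> ('a \<Rightarrow> 'a \<Rightarrow> 'a \<Rightarrow> 'a) \<Rightarrow> 'a \<Rightarrow> 'a \<Rightarrow> bool" where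
  "chain_interval X m u v \<longleftrightarrow>
    u \<in> X \<and> v \<in> X \<and> u \<noteq> v \<and> median_chain X m (median_interval X m u v)"

context median_algebra begin

abbreviation "chain \<equiv> chain_interval X m"
abbreviation "Br \<equiv> branch X m"

lemma chainD: "chain u v \<Longrightarrow> u \<in> X" "chain u v \<Longrightarrow> v \<in> X" "chain u v \<Longrightarrow> u \<noteq> v"
  by (auto simp: chain_interval_def)

lemma mem_median_interval: "u \<in> X \<Longrightarrow> v \<in> X \<Longrightarrow> z \<in> median_interval X m u v \<longleftrightarrow> z \<in> X \<and> m u z v = z"
  unfolding median_interval_def using sym3 by auto

text \<open>The linear order that makes an interval a chain is not tied to its end points. But \<open>u\<close> cannot
  lie strictly between two points of \<open>[u, v]\<close>, so the order can be replaced by the one that \<open>m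
  u\<close> defines, with least element \<open>u\<close>.\<close>

lemma chain_comparable:
  assumes ch: "chain u v" and a: "a \<in> X" "m u a v = a" and b: "b \<in> X" "m u b v = b"
  shows "m u a b = a \<and> m a b v = b \<or> m u b a = b \<and> m b a v = a"
proof -
  have uv: "u \<in> X" "v \<in> X" using chainD ch by auto
  let ?S = "median_interval X m u v"
  have "\<exists>r. linear_order_on ?S r \<and>
      (\<forall>x\<in>?S. \<forall>y\<in>?S. \<forall>z\<in>?S. (x, y) \<in> r \<and> (y, z) \<in> r \<longrightarrow> m x y z = y)"
    using ch unfolding chain_interval_def median_chain_def by (elim conjE)
  then obtain r where lin: "linear_order_on ?S r"
    and r: "\<forall>x\<in>?S. \<forall>y\<in>?S. \<forall>z\<in>?S. (x, y) \<in> r \<and> (y, z) \<in> r \<longrightarrow> m x y z = y"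
    by (elim exE conjE)
  have S: "u \<in> ?S" "v \<in> ?S" "a \<in> ?S" "b \<in> ?S"
    using mem_median_interval[OF uv] uv a b absorb absorb' by auto
  have tot: "x \<in> ?S \<Longrightarrow> y \<in> ?S \<Longrightarrow> (x, y) \<in> r \<or> (y, x) \<in> r" for x y
    using lin unfolding linear_order_on_def partial_order_on_def preorder_on_def
      total_on_def refl_on_def by metis
  have one: "m u a b = a \<or> m u a b = b"
  proof -
    \<comment> \<open>If \<open>u\<close> precedes \<open>v\<close> in the linear order and \<open>x\<close> precedes \<open>u\<close>, then \<open>u\<close> lies between \<open>x\<close>
    and \<open>v\<close>, while \<open>x\<close> lies between \<open>u\<close> and \<open>v\<close>; so \<open>x = u\<close>. The other case is symmetric.\<close>
    have inner: "u = x \<or> u = y" if "x \<in> {a, b}" "y \<in> {a, b}" "(x, u) \<in> r" "(u, y) \<in> r" for x y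
    proof -
      have xy: "x \<in> X" "y \<in> X" "x \<in> ?S" "y \<in> ?S" "m u x v = x" "m u y v = y" using that a b S by auto
      from tot[OF S(1,2)] show ?thesis
      proof
        assume "(u, v) \<in> r"
        then have "m x u v = u" using r xy(3) S(1,2) that(3) by blast
        then show ?thesis using xy uv sym3 by metis
      next
        assume "(v, u) \<in> r"
        then have "m v u y = u" using r xy(4) S(1,2) that(4) by blast
        then show ?thesis using xy uv sym3 by metis
      qed
    qed
    consider "(u, a) \<in> r" "(u, b) \<in> r" | "(u, a) \<in> r" "(b, u) \<in> r"
      | "(a, u) \<in> r" "(u, b) \<in> r" | "(a, u) \<in> r" "(b, u) \<in> r"
      using tot S by blast
    then show ?thesis
    proof cases
      case 1
      then show ?thesis using tot[OF S(3,4)] r[rule_format, OF S(1,3,4)] r[rule_format, OF S(1,4,3)]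
          swap_right[OF uv(1) a(1) b(1)] by auto
    next
      case 2
      then show ?thesis using inner[of b a] a b uv absorb' by auto
    next
      case 3
      then show ?thesis using inner[of a b] a b uv absorb' by auto
    next
      case 4
      then show ?thesis using tot[OF S(3,4)] r[rule_format, OF S(3,4,1)] r[rule_format, OF S(4,3,1)]
          sym3 a(1) b(1) uv(1) by metis
    qed
  qed
  then show ?thesis
    using between_trans(2)[of u a b v] between_trans(2)[of u b a v] uv a b sym3 by metis
qed

lemma median_interval_subalgebra:
  assumes "u \<in> X" "v \<in> X"
  shows "median_subalgebra X m (median_interval X m u v)"
  unfolding median_subalgebra_def
proof (intro conjI ballI)
  show "median_interval X m u v \<subseteq> X" by (auto simp: median_interval_def)
  fix a b c assume "a \<in> median_interval X m u v" "b \<in> median_interval X m u v"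
    "c \<in> median_interval X m u v"
  then show "m a b c \<in> median_interval X m u v"
    using mem_median_interval[OF assms] retraction_hom[OF assms] closed by simp
qed

lemma chainI:
  assumes uv: "u \<in> X" "v \<in> X" "u \<noteq> v"
    and comp: "\<And>a b. \<lbrakk>a \<in> X; m u a v = a; b \<in> X; m u b v = b\<rbrakk> \<Longrightarrow> m u a b = a \<or> m u a b = b"
  shows "chain u v"
proof -
  let ?S = "median_interval X m u v"
  let ?r = "{(a, b). a \<in> ?S \<and> b \<in> ?S \<and> m u a b = a}"
  note mem = mem_median_interval[OF uv(1,2)]
  have "linear_order_on ?S ?r"
    unfolding linear_order_on_def partial_order_on_def preorder_on_def
  proof (intro conjI)
    show "?r \<subseteq> ?S \<times> ?S" by auto
    show "refl_on ?S ?r" unfolding refl_on_def using mem absorb' absorb uv by auto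
    show "trans ?r" unfolding trans_def using mem between_trans(1) uv by blast
    show "antisym ?r" unfolding antisym_def using mem uv swap_right[OF uv(1)] by auto
    show "total_on ?S ?r" unfolding total_on_def using mem comp swap_right[OF uv(1)] by auto
  qed
  moreover have "m a b c = b" if "(a, b) \<in> ?r" "(b, c) \<in> ?r" for a b c
    using between_trans(2)[of u a b c] that mem uv by auto
  ultimately show ?thesis
    unfolding chain_interval_def median_chain_def using uv median_interval_subalgebra by blast
qed

text \<open>The order given by \<open>m p\<close> on \<open>[p, q]\<close> is the one inherited from \<open>[u,
  v]\<close> or its reverse, according to which of \<open>p\<close> and \<open>q\<close> is closer to
  \<open>u\<close>.\<close>

lemma chain_sub:
  assumes ch: "chain u v" and p: "p \<in> X" "m u p v = p" and q: "q \<in> X" "m u q v = q" and "p \<noteq> q"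
  shows "chain p q"
proof (rule chainI)
  have uv: "u \<in> X" "v \<in> X" using chainD ch by auto
  fix a b assume a: "a \<in> X" "m p a q = a" and b: "b \<in> X" "m p b q = b"
  have ab: "m u a v = a" "m u b v = b" using interval_convex[of u v p q] p q a b uv by auto
  have up: "m p x y = x" if "x \<in> X" "y \<in> X" "m u x y = x" "m p x q = x" "m u p q = p" for x y
  proof -
    have "m u p x = p"
      using shadow_convex[of u p p x q] that p q uv absorb by simp
    then show ?thesis using between_trans(2)[of u p x y] that p uv by simp
  qed
  have down: "m p y x = y" if "x \<in> X" "y \<in> X" "m x y v = y" "m p y q = y" "m v p q = p" for x y
  proof -
    have "m v p y = p"
      using shadow_convex[of v p p y q] that p q uv absorb by simp
    moreover have "m v y x = y" using that sym3 uv by metis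
    ultimately show ?thesis using between_trans(2)[of v p y x] that p uv by simp
  qed
  have pq: "m u p q = p \<or> m v p q = p"
    using chain_comparable[OF ch p q] p q uv sym3 by metis
  have flip: "m p b a = m p a b" using swap_right a b p by simp
  from chain_comparable[OF ch a(1) ab(1) b(1) ab(2)] pq show "m p a b = a \<or> m p a b = b"
    using up[of a b] up[of b a] down[of a b] down[of b a] a b flip by auto
qed (use p q \<open>p \<noteq> q\<close> in auto)

lemma chain_sym: "chain u v \<Longrightarrow> chain v u"
  using chain_sub[of u v v u] chainD absorb absorb' by metis

lemma branch_subset: "Br u v \<subseteq> X"
  by (auto simp: branch_def)

lemma median_flip: "\<lbrakk>u \<in> X; v \<in> X; x \<in> X\<rbrakk> \<Longrightarrow> m v x u = m u x v"
  using sym3 by metis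

lemma branch_cover: "\<lbrakk>u \<in> X; v \<in> X; u \<noteq> v\<rbrakk> \<Longrightarrow> Br u v \<union> Br v u = X"
  unfolding branch_def by (auto simp: median_flip[of u v])

lemma branch_mono_left: "\<lbrakk>u \<in> X; v \<in> X; w \<in> X; m u w v = w\<rbrakk> \<Longrightarrow> Br w v \<subseteq> Br u v"
  unfolding branch_def using between_trans(2)[of u w v] swap_right by auto

lemma branch_mono_right: "\<lbrakk>u \<in> X; v \<in> X; w \<in> X; m u w v = w\<rbrakk> \<Longrightarrow> Br u w \<subseteq> Br u v"
  unfolding branch_def using between_trans(1)[of u w v] swap_right by auto

text \<open>Under the retraction to \<open>[u, v]\<close>, the branch \<open>B\<^sup>u\<^sub>v\<close> is the set of
  points strictly below the top. Passing to a subinterval \<open>[p, q]\<close> with \<open>p\<close> closer to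
  \<open>u\<close> shrinks both branches.\<close>

lemma branch_mono:
  assumes "u \<in> X" "v \<in> X" "p \<in> X" "q \<in> X" "m u p q = p" "m u q v = q"
  shows "Br p q \<subseteq> Br u v" "Br q p \<subseteq> Br v u"
proof -
  have "m v q p = q" "m q p u = p" "m v p u = p"
    using between_trans[of u p q v] assms sym3 by metis+
  then show "Br p q \<subseteq> Br u v" "Br q p \<subseteq> Br v u"
    using branch_mono_left[of u q p] branch_mono_right[of u v q] 
      branch_mono_left[of v p q] branch_mono_right[of v u p] assms by blast+
qed

text \<open>In a chain, being strictly below \<open>v\<close> does not depend on where the chain starts.\<close>

lemma branch_left_eq:
  assumes ch: "chain u v" and w: "w \<in> X" "m u w v = w" "w \<noteq> v"
  shows "Br w v = Br u v"
proof
  have uv: "u \<in> X" "v \<in> X" using chainD ch by auto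
  show "Br w v \<subseteq> Br u v" using branch_mono_left w uv by blast
  have "m u y v = v" if y: "y \<in> X" and wy: "m w y v = v" for y
  proof -
    define r where "r = m u y v"
    have r: "r \<in> X" "m u r v = r" using uv y closed median_between by (auto simp: r_def)
    have "m w r v = v"
      using retraction_hom[of w v u y v] retraction_hom[of u v w y v] w uv y wy absorb absorb' closed r_def
      by simp
    moreover have "m u w r = w \<and> m w r v = r \<or> m u r w = r \<and> m r w v = w"
      using chain_comparable[OF ch w(1,2) r] .
    ultimately show ?thesis using w uv r sym3 r_def by metis
  qed
  then show "Br u v \<subseteq> Br w v" by (auto simp: branch_def)
qed

text \<open>The two branches consist of the points that project strictly below \<open>w\<close>, respectively strictly
  above \<open>w\<close>.\<close>

lemma branch_disjoint_at:
  assumes ch: "chain u v" and w: "w \<in> X" "m u w v = w"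
  shows "Br u w \<inter> Br v w = {}"
proof -
  have uv: "u \<in> X" "v \<in> X" using chainD ch by auto
  have "m u x w = w \<or> m v x w = w" if x: "x \<in> X" for x
  proof -
    define r where "r = m u x v"
    have r: "r \<in> X" "m u r v = r" using uv x closed median_between by (auto simp: r_def)
    have "m u r w = m u x w" "m v r w = m v x w"
      using assoc'[of x v w u] assoc'[of x u w v] w uv x sym3 unfolding r_def by metis+
    moreover have "m u w r = w \<and> m w r v = r \<or> m u r w = r \<and> m r w v = w"
      using chain_comparable[OF ch w r] .
    ultimately show ?thesis using w uv r sym3 by metis
  qed
  then show ?thesis by (auto simp: branch_def)
qed

lemma branch_disjoint_jump:
  assumes uv: "u \<in> X" "v \<in> X" and jump: "\<And>z. \<lbrakk>z \<in> X; m u z v = z\<rbrakk> \<Longrightarrow> z = u \<or> z = v"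
  shows "Br u v \<inter> Br v u = {}"
proof -
  have "m u x v = u \<or> m u x v = v" if x: "x \<in> X" for x
    using jump[of "m u x v"] uv x closed median_between by auto
  then show ?thesis using uv sym3 by (auto simp: branch_def) metis
qed

text \<open>In a chain with top \<open>v\<close>, a median is \<open>v\<close> if and only if two of its arguments
  are.\<close>

lemma branch_hom:
  assumes ch: "chain u v"
  shows "bool_hom X m (\<lambda>x. x \<in> Br u v)"
proof -
  have uv: "u \<in> X" "v \<in> X" using chainD ch by auto
  have out: "m u (m a b c) v = v" if "a \<in> X" "b \<in> X" "c \<in> X" "m u a v = v" "m u b v = v" for a b c
    using retraction_hom[of u v a b c] that uv absorb' closed by simp
  have inn: "m u (m a b c) v \<noteq> v" if abc: "a \<in> X" "b \<in> X" "c \<in> X" "m u a v \<noteq> v" "m u b v \<noteq> v" for a b c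
  proof
    assume *: "m u (m a b c) v = v"
    define A C where "A = m u a v" and "C = m u b v"
    have c: "A \<in> X" "C \<in> X" "m u c v \<in> X" "m u A v = A" "m u C v = C"
      using uv abc closed median_between by (auto simp: A_def C_def)
    have "v = m A C (m u c v)" using * retraction_hom[of u v a b c] uv abc by (simp add: A_def C_def)
    then have "m A v C = v" using median_between(1)[of A C "m u c v"] c by simp
    moreover have "m u A C = A \<and> m A C v = C \<or> m u C A = C \<and> m C A v = A"
      using chain_comparable[OF ch] c by blast
    ultimately show False using c uv abc sym3 A_def C_def by metis
  qed
  have main: "m u (m a b c) v \<noteq> v \<longleftrightarrow> majority (m u a v \<noteq> v) (m u b v \<noteq> v) (m u c v \<noteq> v)"
    if abc: "a \<in> X" "b \<in> X" "c \<in> X" for a b c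
  proof -
    have "m a b c = m b c a" "m a b c = m c a b" using sym3 abc by metis+
    then show ?thesis
      using out[of a b c] out[of b c a] out[of c a b] inn[of a b c] inn[of b c a] inn[of c a b] abc
      unfolding majority_def by metis
  qed
  show ?thesis unfolding bool_hom_def
  proof (intro ballI)
    fix a b c assume abc: "a \<in> X" "b \<in> X" "c \<in> X"
    then show "(m a b c \<in> Br u v) = majority (a \<in> Br u v) (b \<in> Br u v) (c \<in> Br u v)"
      using main[OF abc] closed[OF abc] by (simp add: branch_def)
  qed
qed

end

section \<open>Chain intervals and cubes in finite rank\<close>

definition embeds_cube :: "'a set \<Rightarrow> ('a \<Rightarrow> 'a \<Rightarrow> 'a \<Rightarrow> 'a) \<Rightarrow> nat \<Rightarrow> bool" where
  "embeds_cube X m n \<longleftrightarrow> (\<exists>f. median_embedding (cube n) (cube_median n) X m f)"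

lemma cube_median_in_cube: "cube_median n a b c \<in> cube n"
  by (auto simp: cube_median_def cube_def)

lemma cube_median_apply: "i < n \<Longrightarrow> cube_median n a b c i = majority (a i) (b i) (c i)"
  by (auto simp: cube_median_def majority_def)

lemma cube_eqI:
  assumes "a \<in> cube n" "b \<in> cube n" "\<And>i. i < n \<Longrightarrow> a i = b i"
  shows "a = b"
  using assms unfolding cube_def by (auto intro: PiE_ext)

lemma restrict_in_cube: "restrict a {..<n} \<in> cube n"
  by (auto simp: cube_def)

lemma restrict_cube_median:
  "restrict (cube_median (Suc n) a b c) {..<n}
    = cube_median n (restrict a {..<n}) (restrict b {..<n}) (restrict c {..<n})"
  by (auto simp: cube_median_def restrict_def)

context median_algebra begin

text \<open>The points \<open>s\<close>, \<open>p\<close>, \<open>q\<close>, \<open>t\<close> form a square with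
  opposite corners \<open>s\<close> and \<open>t\<close>, and \<open>[s, t]\<close> is a product of \<open>[s,
  p]\<close> and \<open>[s, q]\<close>. A cube in the factor \<open>[s, p]\<close> and its translate to the parallel
  interval \<open>[q, t]\<close> form a cube of the next dimension.\<close>

lemma cube_prism:
  assumes X: "s \<in> X" "p \<in> X" "q \<in> X" "t \<in> X"
    and sq: "m s q p = s" "m s t p = p" "m s t q = q" and "s \<noteq> q"
    and f: "median_embedding (cube k) (cube_median k) X m f"
    and fop: "\<And>e. e \<in> cube k \<Longrightarrow> m s (f e) p = f e"
  shows "\<exists>g. median_embedding (cube (Suc k)) (cube_median (Suc k)) X m g \<and>
    (\<forall>e\<in>cube (Suc k). m s (g e) p = g e \<or> m q (g e) t = g e)"
proof -
  define \<tau> where "\<tau> z = m q z t" for z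
  define r where "r z = m s z p" for z
  have fX: "f e \<in> X" if "e \<in> cube k" for e
    using f that by (auto simp: median_embedding_def)
  have \<tau>X: "\<tau> z \<in> X" and rX: "r z \<in> X" if "z \<in> X" for z
    using that X closed by (auto simp: \<tau>_def r_def)
  have \<tau>hom: "\<tau> (m a b c) = m (\<tau> a) (\<tau> b) (\<tau> c)"
    and rhom: "r (m a b c) = m (r a) (r b) (r c)" if "a \<in> X" "b \<in> X" "c \<in> X" for a b c
    unfolding \<tau>_def r_def using retraction_hom that X by auto
  have \<tau>\<tau>: "\<tau> (\<tau> z) = \<tau> z" if "z \<in> X" for z
    using that X median_between by (auto simp: \<tau>_def)
  have r\<tau>: "r (\<tau> z) = z" if "z \<in> X" "r z = z" for z
    using retraction_hom[of s p q z t] that sq X closed unfolding \<tau>_def r_def by simp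
  have moved: "\<tau> z \<noteq> z" if z: "z \<in> X" "r z = z" for z
  proof
    assume "\<tau> z = z"
    then have "m s z q = m (m s q q) (m s z q) (m s t q)"
      using retraction_hom[of s q q z t] z X unfolding \<tau>_def by simp
    also have "\<dots> = q" using sq X z absorb absorb' closed by simp
    finally have "m s z q = q" .
    moreover have "m s z p = z" using z(2) by (simp add: r_def)
    moreover have "m s z q = m s z (m s p q)"
      using assoc'[of z p q s] X z calculation by simp
    moreover have "m s p q = s" using sq X sym3 by metis
    ultimately show False using absorb' X z \<open>s \<noteq> q\<close> by simp
  qed
  define R where "R e = restrict e {..<k}" for e :: "nat \<Rightarrow> bool"
  have R: "R e \<in> cube k" for e unfolding R_def by (rule restrict_in_cube)
  define g where "g e = (if e k then \<tau> (f (R e)) else f (R e))" for e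
  have fR: "f (R e) \<in> X" "r (f (R e)) = f (R e)" for e
    using fX R fop by (auto simp: r_def)
  have rg: "r (g e) = f (R e)" for e using fR r\<tau> by (simp add: g_def)
  have gX: "g e \<in> X" for e using fR \<tau>X by (simp add: g_def)
  have hom: "g (cube_median (Suc k) a b c) = m (g a) (g b) (g c)" for a b c
  proof -
    define u v w where "u = f (R a)" and "v = f (R b)" and "w = f (R c)"
    have uvw: "u \<in> X" "v \<in> X" "w \<in> X" "r u = u" "r v = v" "r w = w"
      using fR by (auto simp: u_def v_def w_def)
    have fm: "f (R (cube_median (Suc k) a b c)) = m u v w"
      using f R unfolding median_embedding_def u_def v_def w_def R_def restrict_cube_median by simp
    have two0: "m x y (\<tau> z) = m x y z"
      if xyz: "x \<in> X" "y \<in> X" "z \<in> X" "r x = x" "r y = y" "r z = z" for x y z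
    proof -
      have "m s (m x y (\<tau> z)) p = m x y (\<tau> z)"
        using interval_convex[of s p x y "m x y (\<tau> z)"] xyz \<tau>X X closed
          median_between(1)[of x y "\<tau> z"] by (auto simp: r_def)
      then show ?thesis using rhom[of x y "\<tau> z"] xyz \<tau>X r\<tau>[of z] by (simp add: r_def)
    qed
    have two1: "m (\<tau> x) (\<tau> y) z = \<tau> (m x y z)" if xyz: "x \<in> X" "y \<in> X" "z \<in> X" for x y z
    proof -
      have "m q (m (\<tau> x) (\<tau> y) z) t = m (\<tau> x) (\<tau> y) z"
        using interval_convex[of q t "\<tau> x" "\<tau> y" "m (\<tau> x) (\<tau> y) z"] xyz \<tau>X \<tau>\<tau> X closed
          median_between(1)[of "\<tau> x" "\<tau> y" z] by (auto simp: \<tau>_def)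
      then show ?thesis using \<tau>hom[of "\<tau> x" "\<tau> y" z] \<tau>hom[of x y z] xyz \<tau>X \<tau>\<tau> by (simp add: \<tau>_def)
    qed
    have ck: "cube_median (Suc k) a b c k = majority (a k) (b k) (c k)"
      by (simp add: cube_median_apply)
    have perm: "m (\<tau> x) y z = m y z (\<tau> x)" "m x (\<tau> y) z = m x z (\<tau> y)"
      "m x (\<tau> y) (\<tau> z) = m (\<tau> y) (\<tau> z) x" "m (\<tau> x) y (\<tau> z) = m (\<tau> x) (\<tau> z) y"
      "m v w u = m u v w" "m u w v = m u v w"
      if "x \<in> X" "y \<in> X" "z \<in> X" for x y z
      using that \<tau>X uvw(1-3) sym3 by metis+
    show ?thesis
      unfolding g_def ck fm u_def[symmetric] v_def[symmetric] w_def[symmetric]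
      using two0[of u v w] two0[of u w v] two0[of v w u] two1[of u v w] two1[of u w v] two1[of v w u]
        perm[of u v w] \<tau>hom[of u v w] uvw
      by (auto simp: majority_def)
  qed
  have "inj_on g (cube (Suc k))"
  proof (rule inj_onI)
    fix a b assume ab: "a \<in> cube (Suc k)" "b \<in> cube (Suc k)" and eq: "g a = g b"
    have "f (R a) = f (R b)" using rg eq by metis
    then have Req: "R a = R b"
      using f R unfolding median_embedding_def inj_on_def by blast
    have last: "a k = b k"
    proof (rule ccontr)
      assume "a k \<noteq> b k"
      then have "\<tau> (f (R a)) = f (R a)" using eq Req unfolding g_def by (cases "a k") auto
      then show False using moved[OF fR] by blast
    qed
    have "a i = b i" if "i < Suc k" for i
    proof (cases "i = k")
      case False
      then show ?thesis using fun_cong[OF Req, of i] that unfolding R_def by simp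
    qed (simp add: last)
    then show "a = b" using cube_eqI ab by blast
  qed
  then have "median_embedding (cube (Suc k)) (cube_median (Suc k)) X m g"
    unfolding median_embedding_def using gX hom by auto
  moreover have "m s (g e) p = g e \<or> m q (g e) t = g e" for e
    using fR[of e] \<tau>\<tau>[of "f (R e)"] by (auto simp: g_def r_def \<tau>_def)
  ultimately show ?thesis by blast
qed

text \<open>An interval that is not a chain contains two incomparable points, which span a square. Its side \<open>[d,
  a]\<close> again lies in the given interval, so that it has no chain subinterval either and contains a cube by
  induction; the other side of the square adds one dimension.\<close>

lemma cube_without_chain:
  assumes "x \<in> X" "y \<in> X" "x \<noteq> y"
    and "\<And>u v. \<lbrakk>m x u y = u; m x v y = v\<rbrakk> \<Longrightarrow> \<not> chain u v"
  shows "\<exists>f. median_embedding (cube n) (cube_median n) X m f \<and> (\<forall>e\<in>cube n. m x (f e) y = f e)"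
  using assms
proof (induction n arbitrary: x y)
  case 0
  have "cube 0 = {\<lambda>_. undefined}" by (auto simp: cube_def)
  then have "median_embedding (cube 0) (cube_median 0) X m (\<lambda>_. x)"
    using 0 absorb by (auto simp: median_embedding_def)
  then show ?case using 0 absorb' by auto
next
  case (Suc n)
  note xy = Suc.prems(1-3)
  have "\<not> chain x y" using Suc.prems(4)[of x y] xy absorb absorb' by simp
  then obtain a b where a: "a \<in> X" "m x a y = a" and b: "b \<in> X" "m x b y = b"
    and ab: "m x a b \<noteq> a" "m x a b \<noteq> b"
    using chainI[of x y] xy by blast
  define d t where "d = m x a b" and "t = m y a b"
  have ot: "d \<in> X" "t \<in> X" using xy a b closed by (auto simp: d_def t_def)
  have top: "m d t c = c" if c: "c \<in> X" "m x c y = c" "m x d c = d" "m y t c = t" for c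
  proof -
    have "m d c y = c" using between_trans(2)[of x d c y] c xy ot by simp
    then have "m y c d = c" using median_flip[of d y c] c xy ot by simp
    then have "m t c d = c" using between_trans(2)[of y t c d] c xy ot by simp
    then show ?thesis using sym3 c ot by metis
  qed
  have below: "m x d a = d" "m x d b = d" "m y t a = t" "m y t b = t"
    using xy a b median_between unfolding d_def t_def by auto
  have sq: "m d b a = d" "m d t a = a" "m d t b = b"
    using median_between(3)[of x a b] top[of a] top[of b] a b ot below xy sym3 d_def by metis+
  have ox: "m x d y = d" using between_trans(1)[of x d a y] below a ot xy by simp
  have "m y t x = t" using between_trans(1)[of y t a x] below a ot xy median_flip[of x y a] by simp
  then have tx: "m x t y = t" using median_flip ot xy by metis
  have "\<exists>f. median_embedding (cube n) (cube_median n) X m f \<and> (\<forall>e\<in>cube n. m d (f e) a = f e)"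
  proof (rule Suc.IH)
    show "d \<noteq> a" using ab by (simp add: d_def)
    fix u v assume uv: "m d u a = u" "m d v a = v"
    have "m x w y = w" if "w \<in> X" "m d w a = w" for w
      using interval_convex[of x y d a w] that ox a xy ot by simp
    then show "\<not> chain u v" using Suc.prems(4)[of u v] uv chainD(1,2)[of u v] by blast
  qed (use ot a in auto)
  then obtain f where f: "median_embedding (cube n) (cube_median n) X m f"
    and fo: "\<And>e. e \<in> cube n \<Longrightarrow> m d (f e) a = f e" by blast
  have "d \<noteq> b" using ab by (simp add: d_def)
  from cube_prism[OF ot(1) a(1) b(1) ot(2) sq this f fo]
  obtain g where g: "median_embedding (cube (Suc n)) (cube_median (Suc n)) X m g"
    and gi: "\<forall>e\<in>cube (Suc n). m d (g e) a = g e \<or> m b (g e) t = g e" by blast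
  have "m x (g e) y = g e" if "e \<in> cube (Suc n)" for e
  proof -
    have "g e \<in> X" using g that by (auto simp: median_embedding_def)
    then show ?thesis
      using bspec[OF gi that] interval_convex[OF xy(1,2) ot(1) a(1) _ ox a(2)]
        interval_convex[OF xy(1,2) b(1) ot(2) _ b(2) tx] by blast
  qed
  then show ?case using g by blast
qed

text \<open>A chain interval \<open>[u, v]\<close> inside \<open>[x, y]\<close> may point from \<open>y\<close> to
  \<open>x\<close>. In that case the meet of \<open>u\<close> and \<open>v\<close> as seen from \<open>x\<close> is a
  point of the chain different from \<open>u\<close>, and the interval from this meet to \<open>u\<close> has the
  right direction.\<close>

lemma separating_chain:
  assumes nc: "\<not> embeds_cube X m n" and xy: "x \<in> X" "y \<in> X" "x \<noteq> y"
  obtains u v where "chain u v" "x \<in> Br u v" "x \<notin> Br v u" "y \<notin> Br u v" "y \<in> Br v u"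
proof -
  have "\<not> (\<forall>u v. m x u y = u \<longrightarrow> m x v y = v \<longrightarrow> \<not> chain u v)"
  proof
    assume "\<forall>u v. m x u y = u \<longrightarrow> m x v y = v \<longrightarrow> \<not> chain u v"
    then have "\<exists>f. median_embedding (cube n) (cube_median n) X m f \<and> (\<forall>e\<in>cube n. m x (f e) y = f e)"
      using cube_without_chain[OF xy, of n] by presburger
    then show False using nc unfolding embeds_cube_def by blast
  qed
  then obtain u v where uv: "m x u y = u" "m x v y = v" "chain u v" by blast
  have uvX: "u \<in> X" "v \<in> X" "u \<noteq> v" using chainD uv by auto
  have "\<exists>p q. chain p q \<and> m x q y = q \<and> m x p q = p"
  proof (cases "m x u v = u")
    case True
    then show ?thesis using uv by blast
  next
    case False
    let ?o = "m x u v"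
    have o: "?o \<in> X" "m u ?o v = ?o" "m x ?o u = ?o"
      using xy uvX closed median_between by auto
    then have "chain ?o u" using chain_sub[OF uv(3), of ?o u] uvX False absorb' by auto
    then show ?thesis using o uv by blast
  qed
  then obtain p q where pq: "chain p q" "m x q y = q" "m x p q = p" by blast
  have X: "p \<in> X" "q \<in> X" "p \<noteq> q" using chainD pq by auto
  have 1: "m q x p = p" using pq X xy sym3 by metis
  have 2: "m p y q = q" using between_trans(2)[of x p q y] pq X xy swap_right by simp
  have "x \<notin> Br q p" "y \<notin> Br p q" using 1 2 by (auto simp: branch_def)
  moreover have "x \<in> Br p q" "y \<in> Br q p" using 1 2 X xy median_flip[of p q] by (auto simp: branch_def)
  ultimately show ?thesis using that pq by blast
qed

lemma separating_hom:
  assumes "\<not> embeds_cube X m n" "x \<in> X" "y \<in> X" "x \<noteq> y"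
  obtains h where "bool_hom X m h" "h x \<noteq> h y"
  by (rule separating_chain[OF assms]) (use branch_hom that in blast)

end

datatype mterm = Var nat | Med mterm mterm mterm

primrec meval :: "('a \<Rightarrow> 'a \<Rightarrow> 'a \<Rightarrow> 'a) \<Rightarrow> (nat \<Rightarrow> 'a) \<Rightarrow> mterm \<Rightarrow> 'a" where
  "meval m \<rho> (Var i) = \<rho> i"
| "meval m \<rho> (Med r s t) = m (meval m \<rho> r) (meval m \<rho> s) (meval m \<rho> t)"

lemma meval_closed:
  "\<lbrakk>\<And>a b c. \<lbrakk>a \<in> X; b \<in> X; c \<in> X\<rbrakk> \<Longrightarrow> m a b c \<in> X; \<And>i. \<rho> i \<in> X\<rbrakk> \<Longrightarrow> meval m \<rho> t \<in> X"
  by (induction t) auto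

text \<open>Terms are used both in a median algebra and in its compactification. What matters is that term functions
  commute with homomorphisms and are continuous.\<close>

lemma meval_hom:
  assumes "\<And>a b c. \<lbrakk>a \<in> X; b \<in> X; c \<in> X\<rbrakk> \<Longrightarrow> m a b c \<in> X"
    and "\<And>a b c. \<lbrakk>a \<in> X; b \<in> X; c \<in> X\<rbrakk> \<Longrightarrow> h (m a b c) = m' (h a) (h b) (h c)"
    and "\<And>i. \<rho> i \<in> X"
  shows "h (meval m \<rho> t) = meval m' (\<lambda>i. h (\<rho> i)) t"
  using assms by (induction t) (auto simp: meval_closed[of X])

definition meet_var :: "nat \<Rightarrow> mterm" where
  "meet_var i = Med (Var 0) (Var (i + 2)) (Var 1)"

definition join_terms :: "mterm list \<Rightarrow> mterm" where
  "join_terms ts = foldr (\<lambda>s t. Med (Var 1) s t) ts (Var 0)"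

text \<open>For points \<open>a\<close> and \<open>c\<close>, the interval \<open>[a, c]\<close> is a distributive
  lattice with bottom \<open>a\<close>, top \<open>c\<close>, meet \<open>m a\<close> and join \<open>m c\<close>. The
  variables 0 and 1 stand for \<open>a\<close> and \<open>c\<close>, the variable \<open>i + 2\<close> for the
  \<open>i\<close>-th atom of a cube. Each atom is first moved into \<open>[a, c]\<close>; then the pairwise meets of
  the atoms are joined to everything. Above this new bottom the atoms are disjoint, so their joins form an image of a
  Boolean lattice.\<close>

definition cube_term :: "nat \<Rightarrow> (nat \<Rightarrow> bool) \<Rightarrow> mterm" where
  "cube_term n e = join_terms (map meet_var (filter e [0..<n]) @
     [Med (Var 0) (meet_var i) (meet_var j). j \<leftarrow> [0..<n], i \<leftarrow> [0..<j]])"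

lemma meval_join_terms:
  "\<rho> 0 = \<rho> 1 \<Longrightarrow> meval majority \<rho> (join_terms ts) = \<rho> 0"
  "\<lbrakk>\<not> \<rho> 0; \<rho> 1\<rbrakk> \<Longrightarrow> meval majority \<rho> (join_terms ts) \<longleftrightarrow> (\<exists>t\<in>set ts. meval majority \<rho> t)"
  "\<lbrakk>\<rho> 0; \<not> \<rho> 1\<rbrakk> \<Longrightarrow> meval majority \<rho> (join_terms ts) \<longleftrightarrow> (\<forall>t\<in>set ts. meval majority \<rho> t)"
  by (induction ts) (auto simp: join_terms_def majority_def)

lemma meval_meet_var: "\<rho> 0 \<noteq> \<rho> 1 \<Longrightarrow> meval majority \<rho> (meet_var i) = \<rho> (i + 2)"
  by (auto simp: meet_var_def majority_def)

text \<open>In the two-point algebra the bottom and the top either agree, and the term is constant, or they are the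
  two values in one of the two orders, and the term is the displayed lattice polynomial or its dual.\<close>

lemma meval_cube_term:
  "\<rho> 0 = \<rho> 1 \<Longrightarrow> meval majority \<rho> (cube_term n e) = \<rho> 0"
  "\<lbrakk>\<not> \<rho> 0; \<rho> 1\<rbrakk> \<Longrightarrow> meval majority \<rho> (cube_term n e) \<longleftrightarrow>
     (\<exists>i<n. e i \<and> \<rho> (i + 2)) \<or> (\<exists>j<n. \<exists>i<j. \<rho> (i + 2) \<and> \<rho> (j + 2))"
  "\<lbrakk>\<rho> 0; \<not> \<rho> 1\<rbrakk> \<Longrightarrow> meval majority \<rho> (cube_term n e) \<longleftrightarrow>
     (\<forall>i<n. e i \<longrightarrow> \<rho> (i + 2)) \<and> (\<forall>j<n. \<forall>i<j. \<rho> (i + 2) \<or> \<rho> (j + 2))"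
proof -
  let ?ts = "map meet_var (filter e [0..<n]) @
     [Med (Var 0) (meet_var i) (meet_var j). j \<leftarrow> [0..<n], i \<leftarrow> [0..<j]]"
  have ex: "(\<exists>t\<in>set ?ts. P t) \<longleftrightarrow> (\<exists>i<n. e i \<and> P (meet_var i)) \<or>
      (\<exists>j<n. \<exists>i<j. P (Med (Var 0) (meet_var i) (meet_var j)))" for P
    by (simp add: bex_Un) (fastforce simp: Bex_def)
  then have all: "(\<forall>t\<in>set ?ts. P t) \<longleftrightarrow> (\<forall>i<n. e i \<longrightarrow> P (meet_var i)) \<and>
      (\<forall>j<n. \<forall>i<j. P (Med (Var 0) (meet_var i) (meet_var j)))" for P
    using ex[of "\<lambda>t. \<not> P t"] by blast
  show "\<rho> 0 = \<rho> 1 \<Longrightarrow> meval majority \<rho> (cube_term n e) = \<rho> 0"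
    unfolding cube_term_def by (rule meval_join_terms(1))
  show "meval majority \<rho> (cube_term n e) \<longleftrightarrow>
     (\<exists>i<n. e i \<and> \<rho> (i + 2)) \<or> (\<exists>j<n. \<exists>i<j. \<rho> (i + 2) \<and> \<rho> (j + 2))"
    if \<rho>: "\<not> \<rho> 0" "\<rho> 1"
  proof -
    have "\<rho> 0 \<noteq> \<rho> 1" using \<rho> by simp
    then show ?thesis
      unfolding cube_term_def meval_join_terms(2)[of \<rho>, OF \<rho>] ex meval.simps
      using \<rho> by (simp add: meval_meet_var majority_def del: One_nat_def add_2_eq_Suc')
  qed
  show "meval majority \<rho> (cube_term n e) \<longleftrightarrow>
     (\<forall>i<n. e i \<longrightarrow> \<rho> (i + 2)) \<and> (\<forall>j<n. \<forall>i<j. \<rho> (i + 2) \<or> \<rho> (j + 2))"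
    if \<rho>: "\<rho> 0" "\<not> \<rho> 1"
  proof -
    have "\<rho> 0 \<noteq> \<rho> 1" using \<rho> by simp
    then show ?thesis
      unfolding cube_term_def meval_join_terms(3)[of \<rho>, OF \<rho>] all meval.simps
      using \<rho> by (auto simp add: meval_meet_var majority_def simp del: One_nat_def add_2_eq_Suc')
  qed
qed

text \<open>As a function of the vertex \<open>e\<close>, the value of the term is constant or depends on one
  coordinate only: the latter happens if exactly one atom differs from the bottom, since two such atoms have a meet
  that is absorbed into the new bottom.\<close>

lemma cube_term_bool_hom:
  "meval majority \<rho> (cube_term n (cube_median n a b c)) =
    majority (meval majority \<rho> (cube_term n a)) (meval majority \<rho> (cube_term n b))
      (meval majority \<rho> (cube_term n c))"
proof -
  have alone: "(\<forall>i<n. \<not> \<sigma> i) \<or> (\<exists>k<n. \<sigma> k \<and> (\<forall>i<n. \<sigma> i \<longrightarrow> i = k)) \<or> (\<exists>j<n. \<exists>i<j. \<sigma> i \<and> \<sigma> j)"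
    for \<sigma> :: "nat \<Rightarrow> bool"
    by (metis linorder_neqE_nat)
  consider "\<rho> 0 = \<rho> 1" | "\<not> \<rho> 0" "\<rho> 1" | "\<rho> 0" "\<not> \<rho> 1" by blast
  then show ?thesis
  proof cases
    case 1
    then show ?thesis by (auto simp: meval_cube_term majority_def)
  next
    case 2
    from alone[of "\<lambda>i. \<rho> (i + 2)"] show ?thesis
    proof (elim disjE)
      assume "\<exists>k<n. \<rho> (k + 2) \<and> (\<forall>i<n. \<rho> (i + 2) \<longrightarrow> i = k)"
      then obtain k where k: "k < n" "\<rho> (k + 2)" "\<And>i. i < n \<Longrightarrow> \<rho> (i + 2) \<Longrightarrow> i = k" by blast
      have "meval majority \<rho> (cube_term n e) = e k" for e
        unfolding meval_cube_term(2)[of \<rho>, OF 2]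
        using k by (metis less_trans nat_neq_iff)
      then show ?thesis using k(1) by (simp add: cube_median_apply)
    qed (auto simp: meval_cube_term(2)[of \<rho>, OF 2] majority_def)
  next
    case 3
    from alone[of "\<lambda>i. \<not> \<rho> (i + 2)"] show ?thesis
    proof (elim disjE)
      assume "\<exists>k<n. \<not> \<rho> (k + 2) \<and> (\<forall>i<n. \<not> \<rho> (i + 2) \<longrightarrow> i = k)"
      then obtain k where k: "k < n" "\<not> \<rho> (k + 2)" "\<And>i. i < n \<Longrightarrow> \<not> \<rho> (i + 2) \<Longrightarrow> i = k" by blast
      have "meval majority \<rho> (cube_term n e) \<longleftrightarrow> \<not> e k" for e
        unfolding meval_cube_term(3)[of \<rho>, OF 3]
        using k by (metis less_trans nat_neq_iff)
      then show ?thesis using k(1) by (auto simp: cube_median_apply majority_def)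
    qed (auto simp: meval_cube_term(3)[of \<rho>, OF 3] majority_def)
  qed
qed

lemma cube_term_coordinate:
  assumes "k < n" "\<not> \<rho> 0" "\<rho> 1" "\<And>i. i < n \<Longrightarrow> \<rho> (i + 2) \<longleftrightarrow> i = k"
  shows "meval majority \<rho> (cube_term n e) = e k"
  unfolding meval_cube_term(2)[of \<rho>, OF assms(2,3)]
  using assms(1,4) by (metis less_trans nat_neq_iff)

context median_algebra begin

lemma meval_in_carrier: "(\<And>i. \<rho> i \<in> X) \<Longrightarrow> meval m \<rho> t \<in> X"
  by (rule meval_closed) (auto intro: closed)

lemma bool_hom_meval:
  "\<lbrakk>bool_hom X m h; \<And>i. \<rho> i \<in> X\<rbrakk> \<Longrightarrow> h (meval m \<rho> t) = meval majority (\<lambda>i. h (\<rho> i)) t"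
  by (rule meval_hom[of X]) (auto simp: bool_hom_def intro: closed)

text \<open>An identity between medians can be checked after composing with homomorphisms to the two-point algebra,
  since these separate points in finite rank.\<close>

lemma cube_term_hom:
  assumes nc: "\<not> embeds_cube X m N" and \<rho>: "\<And>i. \<rho> i \<in> X"
  shows "meval m \<rho> (cube_term n (cube_median n a b c)) =
    m (meval m \<rho> (cube_term n a)) (meval m \<rho> (cube_term n b)) (meval m \<rho> (cube_term n c))"
    (is "?l = ?r")
proof (rule ccontr)
  assume "?l \<noteq> ?r"
  moreover have X: "?l \<in> X" "?r \<in> X" using \<rho> meval_in_carrier closed by auto
  ultimately obtain h where h: "bool_hom X m h" "h ?l \<noteq> h ?r"
    using separating_hom[OF nc] by blast
  have "h ?r = majority (h (meval m \<rho> (cube_term n a))) (h (meval m \<rho> (cube_term n b)))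
      (h (meval m \<rho> (cube_term n c)))"
    using h(1) \<rho> meval_in_carrier unfolding bool_hom_def by blast
  then show False using h(2) cube_term_bool_hom by (simp add: bool_hom_meval[OF h(1) \<rho>])
qed

lemma embeds_cube_of_term:
  assumes nc: "\<not> embeds_cube X m N" and \<rho>: "\<And>i. \<rho> i \<in> X"
    and inj: "inj_on (\<lambda>e. meval m \<rho> (cube_term n e)) (cube n)"
  shows "embeds_cube X m n"
  unfolding embeds_cube_def median_embedding_def
  by (rule exI[of _ "\<lambda>e. meval m \<rho> (cube_term n e)"])
    (simp add: inj cube_term_hom[OF nc \<rho>] meval_in_carrier[OF \<rho>])

text \<open>Homomorphisms \<open>\<phi> k\<close> to the two-point algebra for which the points \<open>a\<close>,
  \<open>c\<close>, \<open>b i\<close> look like bottom, top and atoms of a cube: then the image of the vertex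
  \<open>e\<close> under the cube term has \<open>k\<close>-th coordinate \<open>e k\<close>, so that distinct
  vertices have distinct images.\<close>

lemma embeds_cube_of_crossing:
  assumes nc: "\<not> embeds_cube X m N"
    and \<phi>: "\<And>k. k < n \<Longrightarrow> bool_hom X m (\<phi> k)"
    and a: "a \<in> X" "\<And>k. k < n \<Longrightarrow> \<not> \<phi> k a" and c: "c \<in> X" "\<And>k. k < n \<Longrightarrow> \<phi> k c"
    and b: "\<And>i. i < n \<Longrightarrow> b i \<in> X" "\<And>i k. \<lbrakk>i < n; k < n\<rbrakk> \<Longrightarrow> \<phi> k (b i) \<longleftrightarrow> i = k"
  shows "embeds_cube X m n"
proof -
  define \<rho> where "\<rho> i = (if i = 0 then a else if i = 1 then c else if i < n + 2 then b (i - 2) else a)" for i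
  have \<rho>: "\<rho> i \<in> X" for i using a c b by (auto simp: \<rho>_def)
  have "\<phi> k (meval m \<rho> (cube_term n e)) = e k" if k: "k < n" for e k
    unfolding bool_hom_meval[OF \<phi>[OF k] \<rho>]
    by (rule cube_term_coordinate) (use k a c b in \<open>auto simp: \<rho>_def\<close>)
  then have "inj_on (\<lambda>e. meval m \<rho> (cube_term n e)) (cube n)"
    by (intro inj_onI, rule_tac cube_eqI[of _ n]) (blast, blast, metis)
  then show ?thesis by (intro embeds_cube_of_term[OF nc, of \<rho>] \<rho>)
qed

end

section \<open>Completion of a covering uniformity\<close>

lemma cover_star_refines: "cover_refines E C \<Longrightarrow> cover_star E S \<subseteq> cover_star C S"
proof
  fix y assume EC: "cover_refines E C" and "y \<in> cover_star E S"
  then obtain A where A: "A \<in> E" "A \<inter> S \<noteq> {}" "y \<in> A" by (auto simp: cover_star_def)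
  then obtain B where "B \<in> C" "A \<subseteq> B" using EC unfolding cover_refines_def by blast
  then show "y \<in> cover_star C S" using A unfolding cover_star_def by blast
qed

lemma cover_refines_trans: "\<lbrakk>cover_refines C D; cover_refines D E\<rbrakk> \<Longrightarrow> cover_refines C E"
  unfolding cover_refines_def by (meson order_trans)

lemma cover_refines_refl: "cover_refines C C"
  unfolding cover_refines_def by blast

lemma mem_cover_star: "y \<in> cover_star C {x} \<longleftrightarrow> (\<exists>A\<in>C. x \<in> A \<and> y \<in> A)"
  by (auto simp: cover_star_def)

context covering_uniformity begin

abbreviation "T \<equiv> uniform_topology X U"

lemma member_subset: "\<lbrakk>C \<in> U; A \<in> C\<rbrakk> \<Longrightarrow> A \<subseteq> X"
  using covers by (auto simp: is_cover_def)

lemma member_containing: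
  assumes "C \<in> U" "x \<in> X" obtains A where "A \<in> C" "x \<in> A"
  using covers[OF assms(1)] assms(2) by (auto simp: is_cover_def)

lemma mem_own_star: "\<lbrakk>C \<in> U; x \<in> X\<rbrakk> \<Longrightarrow> x \<in> cover_star C {x}"
  unfolding mem_cover_star by (meson member_containing)

lemma star_refinement_point:
  assumes "C \<in> U"
  obtains E where "E \<in> U" "\<And>A. A \<in> E \<Longrightarrow> \<exists>B\<in>C. cover_star E A \<subseteq> B"
    "\<And>x y. y \<in> cover_star E {x} \<Longrightarrow> cover_star E {y} \<subseteq> cover_star C {x}"
proof -
  obtain E where E: "E \<in> U" "\<And>A. A \<in> E \<Longrightarrow> \<exists>B\<in>C. cover_star E A \<subseteq> B"
    using star_refinement[OF assms] by blast
  have star: "cover_star E {y} \<subseteq> cover_star C {x}" if "y \<in> cover_star E {x}" for x y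
  proof -
    from that obtain A where A: "A \<in> E" "x \<in> A" "y \<in> A" unfolding mem_cover_star by blast
    obtain B where B: "B \<in> C" "cover_star E A \<subseteq> B" using E(2) A by blast
    have "x \<in> B" "cover_star E {y} \<subseteq> B" using A B by (auto simp: cover_star_def)
    moreover have "B \<subseteq> cover_star C {x}" using B(1) \<open>x \<in> B\<close> unfolding cover_star_def by blast
    ultimately show ?thesis by blast
  qed
  show ?thesis by (rule that[OF E star])
qed

text \<open>The star of a point is not open in general; the set of points having some star inside it is.\<close>

lemma star_is_neighbourhood:
  assumes C: "C \<in> U" and x: "x \<in> X"
  obtains G where "openin T G" "x \<in> G" "G \<subseteq> cover_star C {x}"
proof
  let ?G = "{z \<in> X. \<exists>E\<in>U. cover_star E {z} \<subseteq> cover_star C {x}}"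
  show "openin T ?G" unfolding openin_uniform_topology
  proof (intro conjI ballI)
    fix z assume "z \<in> ?G"
    then obtain E where E: "E \<in> U" "cover_star E {z} \<subseteq> cover_star C {x}" by blast
    obtain E' where E': "E' \<in> U" "\<And>x y. y \<in> cover_star E' {x} \<Longrightarrow> cover_star E' {y} \<subseteq> cover_star E {x}"
      using star_refinement_point[OF E(1)] by metis
    have "cover_star E' {z} \<subseteq> ?G"
    proof
      fix y assume y: "y \<in> cover_star E' {z}"
      then have "y \<in> X" using member_subset E'(1) by (auto simp: mem_cover_star)
      then show "y \<in> ?G" using E'(2)[OF y] E(2) E'(1) by blast
    qed
    then show "\<exists>C\<in>U. cover_star C {z} \<subseteq> ?G" using E'(1) by blast
  qed auto
  show "x \<in> ?G" using C x by blast
  show "?G \<subseteq> cover_star C {x}" using mem_own_star by blast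
qed

lemma hausdorffI:
  assumes sep: "\<And>x y. \<lbrakk>x \<in> X; y \<in> X; x \<noteq> y\<rbrakk> \<Longrightarrow> \<exists>C\<in>U. y \<notin> cover_star C {x}"
  shows "Hausdorff_space T"
  unfolding Hausdorff_space_def topspace_uniform_topology
proof (intro allI impI)
  fix x y assume xy: "x \<in> X \<and> y \<in> X \<and> x \<noteq> y"
  then obtain C where C: "C \<in> U" "y \<notin> cover_star C {x}" using sep by blast
  obtain E where E: "E \<in> U" "\<And>x y. y \<in> cover_star E {x} \<Longrightarrow> cover_star E {y} \<subseteq> cover_star C {x}"
    using star_refinement_point[OF C(1)] by metis
  obtain G where G: "openin T G" "x \<in> G" "G \<subseteq> cover_star E {x}"
    using star_is_neighbourhood[OF E(1)] xy by blast
  obtain H where H: "openin T H" "y \<in> H" "H \<subseteq> cover_star E {y}"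
    using star_is_neighbourhood[OF E(1)] xy by blast
  have "disjnt G H" unfolding disjnt_iff
  proof (intro allI notI)
    fix z assume "z \<in> G \<and> z \<in> H"
    then have "z \<in> cover_star E {x}" "z \<in> cover_star E {y}" using G(3) H(3) by blast+
    then have "z \<in> cover_star E {x}" "y \<in> cover_star E {z}" unfolding mem_cover_star by blast+
    then show False using E(2) C(2) by blast
  qed
  then show "\<exists>G H. openin T G \<and> openin T H \<and> x \<in> G \<and> y \<in> H \<and> disjnt G H" using G H by blast
qed

abbreviation ev :: "'a filter \<Rightarrow> 'a set \<Rightarrow> bool" where "ev F A \<equiv> eventually (\<lambda>x. x \<in> A) F"

definition cauchy :: "'a filter \<Rightarrow> bool" where
  "cauchy F \<longleftrightarrow> F \<noteq> bot \<and> (\<forall>C\<in>U. \<exists>A\<in>C. ev F A)"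

text \<open>The coarsest Cauchy filter that agrees with a given Cauchy filter up to arbitrarily fine covers. The
  Cauchy filters that are their own rounding are the minimal ones, so that they form a set of representatives of the
  points of the completion.\<close>

definition rounding :: "'a filter \<Rightarrow> 'a filter" where
  "rounding F = Abs_filter (\<lambda>P. \<exists>C\<in>U. eventually (\<lambda>x. cover_star C {x} \<subseteq> Collect P) F)"

lemma eventually_rounding:
  "eventually P (rounding F) \<longleftrightarrow> (\<exists>C\<in>U. eventually (\<lambda>x. cover_star C {x} \<subseteq> Collect P) F)"
  unfolding rounding_def
proof (rule eventually_Abs_filter, standard)
  show "\<exists>C\<in>U. eventually (\<lambda>x. cover_star C {x} \<subseteq> Collect (\<lambda>_. True)) F" using nonempty by auto
next
  fix P Q
  assume "\<exists>C\<in>U. eventually (\<lambda>x. cover_star C {x} \<subseteq> Collect P) F"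
    and "\<exists>C\<in>U. eventually (\<lambda>x. cover_star C {x} \<subseteq> Collect Q) F"
  then obtain C D where C: "C \<in> U" "eventually (\<lambda>x. cover_star C {x} \<subseteq> Collect P) F"
    and D: "D \<in> U" "eventually (\<lambda>x. cover_star D {x} \<subseteq> Collect Q) F" by blast
  obtain E where E: "E \<in> U" "cover_refines E C" "cover_refines E D" using common C D by blast
  have "eventually (\<lambda>x. cover_star E {x} \<subseteq> Collect (\<lambda>x. P x \<and> Q x)) F"
    using C(2) D(2)
  proof eventually_elim
    case (elim x)
    then show ?case using cover_star_refines[OF E(2), of "{x}"] cover_star_refines[OF E(3), of "{x}"] by blast
  qed
  then show "\<exists>C\<in>U. eventually (\<lambda>x. cover_star C {x} \<subseteq> Collect (\<lambda>x. P x \<and> Q x)) F" using E by blast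
next
  fix P Q :: "'a \<Rightarrow> bool" assume "\<forall>x. P x \<longrightarrow> Q x"
    and "\<exists>C\<in>U. eventually (\<lambda>x. cover_star C {x} \<subseteq> Collect P) F"
  then obtain C where C: "C \<in> U" "eventually (\<lambda>x. cover_star C {x} \<subseteq> Collect P) F" by blast
  have "eventually (\<lambda>x. cover_star C {x} \<subseteq> Collect Q) F"
    using C(2) by (rule eventually_mono) (use \<open>\<forall>x. P x \<longrightarrow> Q x\<close> in blast)
  then show "\<exists>C\<in>U. eventually (\<lambda>x. cover_star C {x} \<subseteq> Collect Q) F" using C(1) by blast
qed

definition is_round :: "'a filter \<Rightarrow> bool" where
  "is_round F \<longleftrightarrow> (\<forall>P. eventually P F \<longrightarrow> eventually P (rounding F))"

definition completion :: "'a filter set" where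
  "completion = {F. cauchy F \<and> is_round F}"

definition lift :: "'a set \<Rightarrow> 'a filter set" where
  "lift A = {F \<in> completion. ev F A}"

definition completion_uniformity :: "'a filter set set set" where
  "completion_uniformity = {D. is_cover completion D \<and> (\<exists>C\<in>U. cover_refines (lift ` C) D)}"

definition embed :: "'a \<Rightarrow> 'a filter" where
  "embed x = rounding (principal {x})"

lemma cauchy_in_X: "cauchy F \<Longrightarrow> ev F X"
proof -
  assume F: "cauchy F"
  obtain C where C: "C \<in> U" using nonempty by blast
  then obtain A where A: "A \<in> C" "ev F A" using F unfolding cauchy_def by blast
  show ?thesis using A(2) by (rule eventually_mono) (use member_subset[OF C A(1)] in blast)
qed

lemma ev_meet: "\<lbrakk>cauchy F; ev F A; ev F B\<rbrakk> \<Longrightarrow> \<exists>x\<in>X. x \<in> A \<and> x \<in> B"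
proof -
  assume F: "cauchy F" "ev F A" "ev F B"
  have "eventually (\<lambda>x. x \<in> X \<and> x \<in> A \<and> x \<in> B) F"
    using F cauchy_in_X by (auto intro: eventually_conj)
  then show ?thesis using F(1) unfolding cauchy_def by (auto dest: eventually_happens)
qed

lemma rounding_of_member:
  assumes "E \<in> U" "ev F A" "cover_star E A \<subseteq> B"
  shows "ev (rounding F) B"
  unfolding eventually_rounding
proof (intro bexI[of _ E] eventually_mono[OF assms(2)])
  fix x assume "x \<in> A"
  then show "cover_star E {x} \<subseteq> {x. x \<in> B}" using assms(3) by (auto simp: cover_star_def)
qed (rule assms(1))

lemma rounding_in_completion:
  assumes F: "cauchy F"
  shows "rounding F \<in> completion"
proof -
  have "rounding F \<noteq> bot"
  proof
    assume "rounding F = bot"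
    then have "eventually (\<lambda>_. False) (rounding F)" by simp
    then obtain C where "C \<in> U" "eventually (\<lambda>x. cover_star C {x} \<subseteq> {}) F"
      unfolding eventually_rounding by auto
    then have "eventually (\<lambda>x. x \<in> X \<and> cover_star C {x} \<subseteq> {}) F"
      using cauchy_in_X[OF F] by (auto intro: eventually_conj)
    then show False using F \<open>C \<in> U\<close> mem_own_star unfolding cauchy_def
      by (auto dest!: eventually_happens)
  qed
  moreover have "\<exists>B\<in>C. ev (rounding F) B" if C: "C \<in> U" for C
  proof -
    obtain E where E: "E \<in> U" "\<And>A. A \<in> E \<Longrightarrow> \<exists>B\<in>C. cover_star E A \<subseteq> B"
      using star_refinement[OF C] by blast
    obtain A where "A \<in> E" "ev F A" using F E(1) unfolding cauchy_def by blast
    obtain B where B: "B \<in> C" "cover_star E A \<subseteq> B" using E(2)[OF \<open>A \<in> E\<close>] by blast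
    show ?thesis using rounding_of_member[OF E(1) \<open>ev F A\<close> B(2)] B(1) by blast
  qed
  moreover have "is_round (rounding F)" unfolding is_round_def
  proof (intro allI impI)
    fix P assume "eventually P (rounding F)"
    then obtain C where C: "C \<in> U" "eventually (\<lambda>x. cover_star C {x} \<subseteq> Collect P) F"
      unfolding eventually_rounding by blast
    obtain E where E: "E \<in> U" "\<And>x y. y \<in> cover_star E {x} \<Longrightarrow> cover_star E {y} \<subseteq> cover_star C {x}"
      using star_refinement_point[OF C(1)] by metis
    have "eventually (\<lambda>x. cover_star E {x} \<subseteq> Collect (\<lambda>y. cover_star E {y} \<subseteq> Collect P)) F"
      using C(2) by (rule eventually_mono) (use E(2) in blast)
    then have "eventually (\<lambda>y. cover_star E {y} \<subseteq> Collect P) (rounding F)"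
      unfolding eventually_rounding using E(1) by blast
    then show "eventually P (rounding (rounding F))" using E(1) eventually_rounding[of P "rounding F"] by blast
  qed
  ultimately show ?thesis by (simp add: completion_def cauchy_def)
qed

lemma completion_cauchy: "F \<in> completion \<Longrightarrow> cauchy F"
  by (simp add: completion_def)

text \<open>If \<open>P\<close> belongs to a round filter, then for some cover \<open>C\<close> the points whose
  \<open>C\<close>-star lies in \<open>P\<close> form a set of the filter as well. A member of \<open>C\<close> that
  belongs to the filter contains such a point, hence is a subset of \<open>P\<close>; so \<open>P\<close> belongs to
  each filter that shares this member of \<open>C\<close>.\<close>

lemma completion_eqI:
  assumes F: "F \<in> completion" and G: "G \<in> completion"
    and near: "\<And>C. C \<in> U \<Longrightarrow> \<exists>A\<in>C. ev F A \<and> ev G A"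
  shows "F = G"
proof -
  have "eventually P H" if H: "eventually P K" and K: "K \<in> completion"
    and near: "\<And>C. C \<in> U \<Longrightarrow> \<exists>A\<in>C. ev K A \<and> ev H A" for P H K
  proof -
    obtain C where C: "C \<in> U" "eventually (\<lambda>x. cover_star C {x} \<subseteq> Collect P) K"
      using H K unfolding completion_def is_round_def eventually_rounding by blast
    obtain A where A: "A \<in> C" "ev K A" "ev H A" using near[OF C(1)] by blast
    have "ev K {x. cover_star C {x} \<subseteq> Collect P}" using C(2) by simp
    then obtain x where "x \<in> A" "cover_star C {x} \<subseteq> Collect P"
      using ev_meet[OF completion_cauchy[OF K] A(2)] by blast
    then have "A \<subseteq> Collect P" using A(1) by (auto simp: cover_star_def)
    then show ?thesis using A(3) by (auto elim: eventually_mono)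
  qed
  note transfer = this
  have near': "\<And>C. C \<in> U \<Longrightarrow> \<exists>A\<in>C. ev G A \<and> ev F A" using near by blast
  show ?thesis unfolding filter_eq_iff
    using transfer[OF _ F near] transfer[OF _ G near'] by blast
qed

lemma lift_mono: "A \<subseteq> B \<Longrightarrow> lift A \<subseteq> lift B"
  by (auto simp: lift_def elim: eventually_mono)

lemma lift_cover:
  assumes C: "C \<in> U"
  shows "lift ` C \<in> completion_uniformity"
proof -
  have "\<exists>A\<in>C. F \<in> lift A" if "F \<in> completion" for F
    using that C unfolding lift_def completion_def cauchy_def by simp
  then have "is_cover completion (lift ` C)" unfolding is_cover_def lift_def by auto
  then show ?thesis unfolding completion_uniformity_def using C cover_refines_refl by blast
qed

text \<open>Lifts that meet come from sets that meet, since Cauchy filters are proper.\<close>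

lemma lift_star:
  assumes "cover_star E A \<subseteq> B"
  shows "cover_star (lift ` E) (lift A) \<subseteq> lift B"
proof
  fix F assume "F \<in> cover_star (lift ` E) (lift A)"
  then obtain A' G where A': "A' \<in> E" "F \<in> lift A'" "G \<in> lift A'" "G \<in> lift A"
    by (auto simp: cover_star_def)
  then obtain x where "x \<in> A'" "x \<in> A" using ev_meet completion_cauchy unfolding lift_def by blast
  then have "A' \<subseteq> B" using A'(1) assms by (auto simp: cover_star_def)
  from lift_mono[OF this] show "F \<in> lift B" using A'(2) by blast
qed

lemma covering_uniformity_completion: "covering_uniformity completion completion_uniformity"
proof
  show "completion_uniformity \<noteq> {}" using nonempty lift_cover by blast
  fix C assume C: "C \<in> completion_uniformity"
  show "is_cover completion C" using C by (simp add: completion_uniformity_def)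
  obtain C0 where C0: "C0 \<in> U" "cover_refines (lift ` C0) C"
    using C by (auto simp: completion_uniformity_def)
  show "D \<in> completion_uniformity" if "is_cover completion D" "cover_refines C D" for D
    using that C0 cover_refines_trans unfolding completion_uniformity_def by blast
  show "\<exists>E\<in>completion_uniformity. cover_refines E C \<and> cover_refines E D"
    if D: "D \<in> completion_uniformity" for D
  proof -
    obtain D0 where D0: "D0 \<in> U" "cover_refines (lift ` D0) D"
      using D by (auto simp: completion_uniformity_def)
    obtain E where E: "E \<in> U" "cover_refines E C0" "cover_refines E D0" using common C0 D0 by blast
    have lift_refines: "cover_refines (lift ` E) (lift ` K)" if EK: "cover_refines E K" for K
      unfolding cover_refines_def
    proof
      fix A' assume "A' \<in> lift ` E"
      then obtain A where A: "A \<in> E" "A' = lift A" by blast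
      then obtain B where B: "B \<in> K" "A \<subseteq> B" using EK unfolding cover_refines_def by blast
      show "\<exists>B'\<in>lift ` K. A' \<subseteq> B'" using lift_mono[OF B(2)] B(1) A(2) by blast
    qed
    have "cover_refines (lift ` E) C" "cover_refines (lift ` E) D"
      using cover_refines_trans[OF lift_refines] E(2,3) C0(2) D0(2) by blast+
    then show ?thesis using lift_cover[OF E(1)] by blast
  qed
  obtain E where E: "E \<in> U" "\<And>A. A \<in> E \<Longrightarrow> \<exists>B\<in>C0. cover_star E A \<subseteq> B"
    using star_refinement[OF C0(1)] by blast
  have "\<exists>B\<in>C. cover_star (lift ` E) (lift A) \<subseteq> B" if "A \<in> E" for A
  proof -
    from E(2)[OF that] obtain B where "B \<in> C0" "cover_star E A \<subseteq> B" by blast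
    moreover obtain D where "D \<in> C" "lift B \<subseteq> D"
      using C0(2) \<open>B \<in> C0\<close> unfolding cover_refines_def by blast
    ultimately show ?thesis using lift_star[of E A B] by blast
  qed
  then show "\<exists>E\<in>completion_uniformity. \<forall>A\<in>E. \<exists>B\<in>C. cover_star E A \<subseteq> B"
    using lift_cover[OF E(1)] by blast
qed

text \<open>If \<open>A\<close> belongs to the round filter \<open>F\<close>, then for some cover \<open>C\<close>
  every set of \<open>F\<close> contains a point whose \<open>C\<close>-star lies in \<open>A\<close>. So the members
  of \<open>C\<close> that belong to \<open>F\<close> are subsets of \<open>A\<close>.\<close>

lemma openin_lift: "openin (uniform_topology completion completion_uniformity) (lift A)"
proof -
  interpret Y: covering_uniformity completion completion_uniformity
    by (rule covering_uniformity_completion)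
  show ?thesis unfolding Y.openin_uniform_topology
  proof (intro conjI ballI)
    show "lift A \<subseteq> completion" by (auto simp: lift_def)
    fix F assume F: "F \<in> lift A"
    then obtain C where C: "C \<in> U" "ev F {x. cover_star C {x} \<subseteq> A}"
      unfolding lift_def completion_def is_round_def eventually_rounding by auto
    have "cover_star (lift ` C) {F} \<subseteq> lift A"
    proof
      fix G assume "G \<in> cover_star (lift ` C) {F}"
      then obtain B where B: "B \<in> C" "F \<in> lift B" "G \<in> lift B" by (auto simp: mem_cover_star)
      then obtain x where "x \<in> B" "cover_star C {x} \<subseteq> A"
        using ev_meet[of F B] C(2) completion_cauchy unfolding lift_def by blast
      then have "B \<subseteq> A" using B(1) by (auto simp: cover_star_def)
      from lift_mono[OF this] show "G \<in> lift A" using B(3) by blast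
    qed
    then show "\<exists>C\<in>completion_uniformity. cover_star C {F} \<subseteq> lift A" using lift_cover C(1) by blast
  qed
qed

lemma completion_neighbourhood:
  assumes "openin (uniform_topology completion completion_uniformity) G" "F \<in> G"
  obtains C where "C \<in> U" "\<And>A. \<lbrakk>A \<in> C; ev F A\<rbrakk> \<Longrightarrow> lift A \<subseteq> G"
proof -
  interpret Y: covering_uniformity completion completion_uniformity
    by (rule covering_uniformity_completion)
  have "F \<in> completion" using assms openin_subset Y.topspace_uniform_topology by blast
  obtain D where D: "D \<in> completion_uniformity" "cover_star D {F} \<subseteq> G"
    using assms Y.openin_uniform_topology by blast
  then obtain C where C: "C \<in> U" "cover_refines (lift ` C) D"
    by (auto simp: completion_uniformity_def)
  have "lift A \<subseteq> G" if "A \<in> C" "ev F A" for A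
  proof -
    have "F \<in> lift A" using that \<open>F \<in> completion\<close> by (simp add: lift_def)
    then have "lift A \<subseteq> cover_star (lift ` C) {F}" using that by (auto simp: mem_cover_star)
    then show ?thesis using cover_star_refines[OF C(2), of "{F}"] D(2) by blast
  qed
  then show ?thesis using that C(1) by blast
qed

lemma cauchy_principal: "x \<in> X \<Longrightarrow> cauchy (principal {x})"
  unfolding cauchy_def
  by (auto simp: eventually_principal principal_eq_bot_iff) (meson member_containing)

lemma embed_in_completion: "x \<in> X \<Longrightarrow> embed x \<in> completion"
  using cauchy_principal rounding_in_completion embed_def by simp

lemma ev_embed: "ev (embed x) A \<longleftrightarrow> (\<exists>C\<in>U. cover_star C {x} \<subseteq> A)"
  by (simp add: embed_def eventually_rounding eventually_principal)

lemma ev_embed_mem: "\<lbrakk>ev (embed x) A; x \<in> X\<rbrakk> \<Longrightarrow> x \<in> A"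
  using ev_embed mem_own_star by blast

text \<open>A Cauchy filter \<open>\<Phi>\<close> of filters determines the filter of those sets that belong to
  \<open>\<Phi>\<close>-almost every filter; its rounding is the limit.\<close>

lemma completion_complete: "uniformly_complete completion completion_uniformity"
  unfolding uniformly_complete_def
proof (intro allI impI, elim conjE)
  interpret Y: covering_uniformity completion completion_uniformity
    by (rule covering_uniformity_completion)
  fix \<Phi> :: "'a filter filter"
  assume ne: "\<Phi> \<noteq> bot" and onY: "eventually (\<lambda>F. F \<in> completion) \<Phi>"
    and cau: "\<forall>C\<in>completion_uniformity. \<exists>A\<in>C. eventually (\<lambda>F. F \<in> A) \<Phi>"
  \<comment> \<open>The Kowalsky sum of \<open>\<Phi>\<close>.\<close>
  define K where "K = Abs_filter (\<lambda>P. eventually (\<lambda>F. eventually P F) \<Phi>)"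
  have evK: "eventually P K \<longleftrightarrow> eventually (\<lambda>F. eventually P F) \<Phi>" for P
    unfolding K_def
  proof (rule eventually_Abs_filter, standard)
    show "eventually (\<lambda>F. eventually (\<lambda>_. True) F) \<Phi>" by (rule always_eventually) simp
  next
    fix P Q :: "'a \<Rightarrow> bool"
    assume "eventually (\<lambda>F. eventually P F) \<Phi>" "eventually (\<lambda>F. eventually Q F) \<Phi>"
    then show "eventually (\<lambda>F. eventually (\<lambda>x. P x \<and> Q x) F) \<Phi>"
      by eventually_elim (rule eventually_conj)
  next
    fix P Q :: "'a \<Rightarrow> bool" assume "\<forall>x. P x \<longrightarrow> Q x" "eventually (\<lambda>F. eventually P F) \<Phi>"
    then show "eventually (\<lambda>F. eventually Q F) \<Phi>"
      by (auto elim!: eventually_mono)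
  qed
  have member: "\<exists>A\<in>C. eventually (\<lambda>F. F \<in> lift A) \<Phi>" if "C \<in> U" for C
    using cau lift_cover[OF that] by blast
  have lift_ev: "ev K A" if "eventually (\<lambda>F. F \<in> lift A) \<Phi>" for A
    unfolding evK using that by (rule eventually_mono) (simp add: lift_def)
  have "cauchy K" unfolding cauchy_def
  proof (intro conjI ballI)
    show "K \<noteq> bot"
    proof
      assume "K = bot"
      then have "eventually (\<lambda>F. F = bot) \<Phi>" using evK[of "\<lambda>_. False"] by (simp add: eventually_False)
      then have "eventually (\<lambda>F. F \<in> completion \<and> F = bot) \<Phi>" using onY by (rule eventually_conj[rotated])
      then show False using ne completion_cauchy cauchy_def by (auto dest!: eventually_happens)
    qed
    fix C assume "C \<in> U"
    then show "\<exists>A\<in>C. ev K A" using member lift_ev by blast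
  qed
  then have KY: "rounding K \<in> completion" by (rule rounding_in_completion)
  have "limitin Y.T (\<lambda>x. x) (rounding K) \<Phi>"
    unfolding limitin_def Y.topspace_uniform_topology
  proof (intro conjI KY allI impI)
    fix G assume "openin Y.T G \<and> rounding K \<in> G"
    then obtain C where C: "C \<in> U" "\<And>A. \<lbrakk>A \<in> C; ev (rounding K) A\<rbrakk> \<Longrightarrow> lift A \<subseteq> G"
      using completion_neighbourhood by metis
    obtain E where E: "E \<in> U" "\<And>A. A \<in> E \<Longrightarrow> \<exists>B\<in>C. cover_star E A \<subseteq> B"
      using star_refinement[OF C(1)] by blast
    obtain A where A: "A \<in> E" "eventually (\<lambda>F. F \<in> lift A) \<Phi>" using member[OF E(1)] by blast
    obtain B where B: "B \<in> C" "cover_star E A \<subseteq> B" using E(2)[OF A(1)] by blast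
    have "lift B \<subseteq> G" using C(2)[OF B(1)] rounding_of_member[OF E(1) lift_ev[OF A(2)] B(2)] by blast
    moreover have "A \<subseteq> B" using B(2) A(1) by (auto simp: cover_star_def)
    ultimately have AG: "lift A \<subseteq> G" using lift_mono[of A B] by blast
    show "eventually (\<lambda>x. x \<in> G) \<Phi>" using A(2) by (rule eventually_mono) (use AG in blast)
  qed
  then show "\<exists>y. limitin Y.T (\<lambda>x. x) y \<Phi>" by blast
qed

lemma completion_hausdorff: "Hausdorff_space (uniform_topology completion completion_uniformity)"
proof -
  interpret Y: covering_uniformity completion completion_uniformity
    by (rule covering_uniformity_completion)
  show ?thesis
  proof (rule Y.hausdorffI)
    fix F G assume FG: "F \<in> completion" "G \<in> completion" "F \<noteq> G"
    then obtain C where C: "C \<in> U" "\<And>A. A \<in> C \<Longrightarrow> \<not> (ev F A \<and> ev G A)"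
      using completion_eqI[of F G] by meson
    then have "G \<notin> cover_star (lift ` C) {F}" by (auto simp: mem_cover_star lift_def)
    then show "\<exists>C\<in>completion_uniformity. G \<notin> cover_star C {F}" using lift_cover C(1) by blast
  qed
qed

lemma embed_dense: "uniform_topology completion completion_uniformity closure_of (embed ` X) = completion"
proof -
  interpret Y: covering_uniformity completion completion_uniformity
    by (rule covering_uniformity_completion)
  have "\<exists>y\<in>embed ` X. y \<in> G" if G: "openin Y.T G" "F \<in> G" for F G
  proof -
    have F: "F \<in> completion" using G openin_subset Y.topspace_uniform_topology by blast
    obtain C where C: "C \<in> U" "\<And>A. \<lbrakk>A \<in> C; ev F A\<rbrakk> \<Longrightarrow> lift A \<subseteq> G"
      using completion_neighbourhood[OF G] by metis
    obtain A where A: "A \<in> C" "ev F A" using F C(1) unfolding completion_def cauchy_def by blast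
    obtain E where E: "E \<in> U" "ev F {x. cover_star E {x} \<subseteq> A}"
      using A(2) F unfolding completion_def is_round_def eventually_rounding by auto
    obtain x where x: "x \<in> X" "cover_star E {x} \<subseteq> A"
      using ev_meet[OF completion_cauchy[OF F] A(2) E(2)] by blast
    then have "embed x \<in> lift A" using ev_embed E(1) embed_in_completion by (auto simp: lift_def)
    then show ?thesis using C(2)[OF A] x(1) by blast
  qed
  then show ?thesis
    unfolding closure_of_def Y.topspace_uniform_topology by blast
qed

lemma hausdorff_completion_completion:
  "hausdorff_completion X U completion completion_uniformity embed"
  unfolding hausdorff_completion_def
proof (intro conjI allI)
  show "embed \<in> X \<rightarrow> completion" using embed_in_completion by blast
  fix C
  show "C \<in> U \<longleftrightarrow> is_cover X C \<and>
      (\<exists>D\<in>completion_uniformity. cover_refines {X \<inter> embed -` B | B. B \<in> D} C)"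
  proof
    assume C: "C \<in> U"
    have "X \<inter> embed -` lift A \<subseteq> A" for A using ev_embed_mem by (auto simp: lift_def)
    then have "cover_refines {X \<inter> embed -` B | B. B \<in> lift ` C} C" unfolding cover_refines_def by blast
    then show "is_cover X C \<and> (\<exists>D\<in>completion_uniformity. cover_refines {X \<inter> embed -` B | B. B \<in> D} C)"
      using covers[OF C] lift_cover[OF C] by blast
  next
    assume "is_cover X C \<and> (\<exists>D\<in>completion_uniformity. cover_refines {X \<inter> embed -` B | B. B \<in> D} C)"
    then obtain D where D: "is_cover X C" "D \<in> completion_uniformity"
      "cover_refines {X \<inter> embed -` B | B. B \<in> D} C" by blast
    obtain K where K: "K \<in> U" "cover_refines (lift ` K) D"
      using D(2) by (auto simp: completion_uniformity_def)
    obtain E where E: "E \<in> U" "\<And>A. A \<in> E \<Longrightarrow> \<exists>B\<in>K. cover_star E A \<subseteq> B"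
      using star_refinement[OF K(1)] by blast
    have "\<exists>B\<in>C. A \<subseteq> B" if A: "A \<in> E" for A
    proof -
      obtain B where B: "B \<in> K" "cover_star E A \<subseteq> B" using E(2)[OF A] by blast
      obtain D' where D': "D' \<in> D" "lift B \<subseteq> D'" using K(2) B(1) unfolding cover_refines_def by blast
      obtain C' where C': "C' \<in> C" "X \<inter> embed -` D' \<subseteq> C'" using D(3) D'(1) unfolding cover_refines_def by blast
      have "x \<in> X \<inter> embed -` lift B" if x: "x \<in> A" for x
      proof -
        have "cover_star E {x} \<subseteq> B" using x B(2) by (auto simp: cover_star_def)
        then show ?thesis using ev_embed E(1) embed_in_completion member_subset[OF E(1) A] x
          by (auto simp: lift_def)
      qed
      then have "A \<subseteq> C'" using C'(2) D'(2) by blast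
      then show ?thesis using C'(1) by blast
    qed
    then show "C \<in> U" using coarser[OF E(1) D(1)] unfolding cover_refines_def by blast
  qed
qed (rule covering_uniformity_completion completion_hausdorff completion_complete embed_dense)+

end

section \<open>Extension of the median to the completion\<close>

text \<open>A median algebra whose uniformity has a base of covers such that each triple of members is carried into
  some member by the median. This is a strong form of uniform continuity.\<close>

locale uniform_median_algebra = covering_uniformity X U + median_algebra X m
  for X :: "'a set" and U :: "'a set set set" and m :: "'a \<Rightarrow> 'a \<Rightarrow> 'a \<Rightarrow> 'a" +
  assumes median_base: "C \<in> U \<Longrightarrow> \<exists>E\<in>U. cover_refines E C \<and>
    (\<forall>A\<in>E. \<forall>B\<in>E. \<forall>D\<in>E. \<exists>M\<in>E. \<forall>a\<in>A. \<forall>b\<in>B. \<forall>d\<in>D. m a b d \<in> M)"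
begin

abbreviation "TY \<equiv> uniform_topology completion completion_uniformity"

definition image_filter :: "'a filter \<Rightarrow> 'a filter \<Rightarrow> 'a filter \<Rightarrow> 'a filter" where
  "image_filter F G H = filtermap (\<lambda>(a, b, c). m a b c) (F \<times>\<^sub>F (G \<times>\<^sub>F H))"

definition extended_median :: "'a filter \<Rightarrow> 'a filter \<Rightarrow> 'a filter \<Rightarrow> 'a filter" where
  "extended_median F G H = rounding (image_filter F G H)"

lemma ev_image_filter:
  assumes "ev F A" "ev G B" "ev H D" "\<forall>a\<in>A. \<forall>b\<in>B. \<forall>d\<in>D. m a b d \<in> M"
  shows "ev (image_filter F G H) M"
  unfolding image_filter_def eventually_filtermap
proof -
  have "eventually (\<lambda>p. fst p \<in> A \<and> fst (snd p) \<in> B \<and> snd (snd p) \<in> D) (F \<times>\<^sub>F (G \<times>\<^sub>F H))"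
    unfolding eventually_prod_filter
    using assms(1-3)
    by (intro exI[of _ "\<lambda>x. x \<in> A"] exI[of _ "\<lambda>p. fst p \<in> B \<and> snd p \<in> D"]
        exI[of _ "\<lambda>x. x \<in> B"] exI[of _ "\<lambda>x. x \<in> D"] conjI) auto
  then show "eventually (\<lambda>p. (case p of (a, b, c) \<Rightarrow> m a b c) \<in> M) (F \<times>\<^sub>F (G \<times>\<^sub>F H))"
    by (rule eventually_mono) (use assms(4) in auto)
qed

lemma cauchy_member: "\<lbrakk>cauchy F; C \<in> U\<rbrakk> \<Longrightarrow> \<exists>A\<in>C. ev F A"
  by (simp add: cauchy_def)

lemma cauchy_image_filter:
  assumes F: "cauchy F" and G: "cauchy G" and H: "cauchy H"
  shows "cauchy (image_filter F G H)"
  unfolding cauchy_def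
proof (intro conjI ballI)
  show "image_filter F G H \<noteq> bot"
    using F G H by (simp add: cauchy_def image_filter_def filtermap_bot_iff prod_filter_eq_bot)
  fix C assume C: "C \<in> U"
  obtain E where E: "E \<in> U" "cover_refines E C"
    "\<forall>A\<in>E. \<forall>B\<in>E. \<forall>D\<in>E. \<exists>M\<in>E. \<forall>a\<in>A. \<forall>b\<in>B. \<forall>d\<in>D. m a b d \<in> M"
    using median_base[OF C] by (elim bexE conjE)
  obtain A B D where ABD: "A \<in> E" "B \<in> E" "D \<in> E" and ev: "ev F A" "ev G B" "ev H D"
    using cauchy_member[OF F E(1)] cauchy_member[OF G E(1)] cauchy_member[OF H E(1)] by (elim bexE)
  obtain M where "M \<in> E" and M: "\<forall>a\<in>A. \<forall>b\<in>B. \<forall>d\<in>D. m a b d \<in> M"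
    using E(3)[rule_format, OF ABD] by (elim bexE)
  obtain N where N: "N \<in> C" "M \<subseteq> N" using E(2) \<open>M \<in> E\<close> unfolding cover_refines_def by blast
  have "ev (image_filter F G H) M" by (rule ev_image_filter[OF ev M])
  then have "ev (image_filter F G H) N" by (rule eventually_mono) (use N(2) in blast)
  then show "\<exists>A\<in>C. ev (image_filter F G H) A" using N(1) by blast
qed

lemma extended_median_closed:
  "\<lbrakk>F \<in> completion; G \<in> completion; H \<in> completion\<rbrakk> \<Longrightarrow> extended_median F G H \<in> completion"
  unfolding extended_median_def
  by (intro rounding_in_completion cauchy_image_filter completion_cauchy)

text \<open>The shared cover member \<open>N\<close> controls the extended median on whole neighbourhoods, and the
  given median on points. The first gives continuity, and both together show that the extended median extends the
  given one.\<close>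

lemma extended_median_uniform:
  assumes C: "C \<in> U"
  obtains E where "E \<in> U" "\<And>A B D. \<lbrakk>A \<in> E; B \<in> E; D \<in> E\<rbrakk> \<Longrightarrow> \<exists>N\<in>C.
    (\<forall>F G H. ev F A \<longrightarrow> ev G B \<longrightarrow> ev H D \<longrightarrow> ev (extended_median F G H) N) \<and>
    (\<forall>a\<in>A. \<forall>b\<in>B. \<forall>d\<in>D. ev (embed (m a b d)) N)"
proof -
  obtain K where K: "K \<in> U" "\<And>A. A \<in> K \<Longrightarrow> \<exists>B\<in>C. cover_star K A \<subseteq> B"
    using star_refinement[OF C] by blast
  obtain E where E: "E \<in> U" "cover_refines E K"
    "\<forall>A\<in>E. \<forall>B\<in>E. \<forall>D\<in>E. \<exists>M\<in>E. \<forall>a\<in>A. \<forall>b\<in>B. \<forall>d\<in>D. m a b d \<in> M"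
    using median_base[OF K(1)] by (elim bexE conjE)
  have "\<exists>N\<in>C. (\<forall>F G H. ev F A \<longrightarrow> ev G B \<longrightarrow> ev H D \<longrightarrow> ev (extended_median F G H) N) \<and>
    (\<forall>a\<in>A. \<forall>b\<in>B. \<forall>d\<in>D. ev (embed (m a b d)) N)"
    if ABD: "A \<in> E" "B \<in> E" "D \<in> E" for A B D
  proof -
    obtain M where "M \<in> E" and M: "\<forall>a\<in>A. \<forall>b\<in>B. \<forall>d\<in>D. m a b d \<in> M"
      using E(3)[rule_format, OF ABD] by (elim bexE)
    obtain M' where "M' \<in> K" "M \<subseteq> M'" using E(2) \<open>M \<in> E\<close> unfolding cover_refines_def by blast
    then have M': "M' \<in> K" "\<forall>a\<in>A. \<forall>b\<in>B. \<forall>d\<in>D. m a b d \<in> M'" using M by blast+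
    obtain N where N: "N \<in> C" "cover_star K M' \<subseteq> N" using K(2)[OF M'(1)] by blast
    have "ev (extended_median F G H) N" if "ev F A" "ev G B" "ev H D" for F G H
      unfolding extended_median_def
      by (rule rounding_of_member[OF K(1) ev_image_filter[OF that M'(2)] N(2)])
    moreover have "ev (embed (m a b d)) N" if "a \<in> A" "b \<in> B" "d \<in> D" for a b d
    proof -
      have "cover_star K {m a b d} \<subseteq> cover_star K M'" using M'(2) that unfolding cover_star_def by blast
      then show ?thesis unfolding ev_embed using K(1) N(2) by blast
    qed
    ultimately show ?thesis using N(1) by blast
  qed
  then show ?thesis by (rule that[OF E(1)])
qed

lemma extended_median_embed:
  assumes X: "a \<in> X" "b \<in> X" "c \<in> X"
  shows "extended_median (embed a) (embed b) (embed c) = embed (m a b c)"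
proof (rule completion_eqI)
  show "extended_median (embed a) (embed b) (embed c) \<in> completion"
    by (intro extended_median_closed embed_in_completion X)
  show "embed (m a b c) \<in> completion" by (intro embed_in_completion closed X)
  fix C assume C: "C \<in> U"
  obtain E where E: "E \<in> U" "\<And>A B D. \<lbrakk>A \<in> E; B \<in> E; D \<in> E\<rbrakk> \<Longrightarrow> \<exists>N\<in>C.
    (\<forall>F G H. ev F A \<longrightarrow> ev G B \<longrightarrow> ev H D \<longrightarrow> ev (extended_median F G H) N) \<and>
    (\<forall>a\<in>A. \<forall>b\<in>B. \<forall>d\<in>D. ev (embed (m a b d)) N)"
    by (rule extended_median_uniform[OF C]) blast
  have near: "\<exists>A\<in>E. ev (embed x) A" if "x \<in> X" for x
    by (rule cauchy_member[OF completion_cauchy[OF embed_in_completion[OF that]] E(1)])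
  obtain A B D where *: "A \<in> E" "B \<in> E" "D \<in> E" "ev (embed a) A" "ev (embed b) B" "ev (embed c) D"
    using near[OF X(1)] near[OF X(2)] near[OF X(3)] by (elim bexE)
  have "a \<in> A" "b \<in> B" "c \<in> D" by (rule ev_embed_mem[OF *(4) X(1)] ev_embed_mem[OF *(5) X(2)] ev_embed_mem[OF *(6) X(3)])+
  then show "\<exists>A\<in>C. ev (extended_median (embed a) (embed b) (embed c)) A \<and> ev (embed (m a b c)) A"
    using E(2)[OF *(1-3)] *(4-6) by blast
qed

lemma topspace_TY: "topspace TY = completion"
  by (rule covering_uniformity.topspace_uniform_topology[OF covering_uniformity_completion])

lemma extended_median_continuous:
  "continuous_map (prod_topology TY (prod_topology TY TY)) TY (\<lambda>(F, G, H). extended_median F G H)"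
  unfolding continuous_map_def
proof (intro conjI allI impI)
  let ?P = "prod_topology TY (prod_topology TY TY)"
  show "(\<lambda>(F, G, H). extended_median F G H) \<in> topspace ?P \<rightarrow> topspace TY"
    using extended_median_closed by (auto simp: topspace_TY)
  fix O' assume O': "openin TY O'"
  show "openin ?P {p \<in> topspace ?P. (case p of (F, G, H) \<Rightarrow> extended_median F G H) \<in> O'}"
    (is "openin ?P ?S")
  proof (subst openin_subopen, intro ballI)
    fix p assume "p \<in> ?S"
    then obtain F G H where p: "p = (F, G, H)" and FGH: "F \<in> completion" "G \<in> completion" "H \<in> completion"
      and O: "extended_median F G H \<in> O'" by (auto simp: topspace_TY)
    obtain C where C: "C \<in> U" "\<And>N. \<lbrakk>N \<in> C; ev (extended_median F G H) N\<rbrakk> \<Longrightarrow> lift N \<subseteq> O'"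
      by (rule completion_neighbourhood[OF O' O]) blast
    obtain E where E: "E \<in> U" "\<And>A B D. \<lbrakk>A \<in> E; B \<in> E; D \<in> E\<rbrakk> \<Longrightarrow> \<exists>N\<in>C.
      (\<forall>F G H. ev F A \<longrightarrow> ev G B \<longrightarrow> ev H D \<longrightarrow> ev (extended_median F G H) N) \<and>
      (\<forall>a\<in>A. \<forall>b\<in>B. \<forall>d\<in>D. ev (embed (m a b d)) N)"
      by (rule extended_median_uniform[OF C(1)]) blast
    obtain A B D where ABD: "A \<in> E" "B \<in> E" "D \<in> E" and ev: "ev F A" "ev G B" "ev H D"
      using FGH[THEN completion_cauchy, THEN cauchy_member, OF E(1)] by (elim bexE)
    obtain N where N: "N \<in> C" "\<And>F G H. \<lbrakk>ev F A; ev G B; ev H D\<rbrakk> \<Longrightarrow> ev (extended_median F G H) N"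
      using E(2)[OF ABD] by blast
    have "lift N \<subseteq> O'" using C(2)[OF N(1)] N(2)[OF ev] by blast
    moreover have "extended_median F' G' H' \<in> lift N"
      if "F' \<in> lift A" "G' \<in> lift B" "H' \<in> lift D" for F' G' H'
      using that N(2) extended_median_closed unfolding lift_def by simp
    ultimately have "lift A \<times> lift B \<times> lift D \<subseteq> ?S"
      by (auto simp: topspace_TY lift_def)
    moreover have "openin ?P (lift A \<times> lift B \<times> lift D)"
      by (simp add: openin_prod_Times_iff openin_lift)
    moreover have "p \<in> lift A \<times> lift B \<times> lift D" using p ev FGH by (simp add: lift_def)
    ultimately show "\<exists>V. openin ?P V \<and> p \<in> V \<and> V \<subseteq> ?S" by blast
  qed
qed

lemma continuous_map_extended_median:
  assumes "continuous_map Z TY f" "continuous_map Z TY g" "continuous_map Z TY h"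
  shows "continuous_map Z TY (\<lambda>z. extended_median (f z) (g z) (h z))"
proof -
  have "continuous_map Z (prod_topology TY (prod_topology TY TY)) (\<lambda>z. (f z, g z, h z))"
    using assms by (intro continuous_map_pairedI)
  from continuous_map_compose[OF this extended_median_continuous] show ?thesis
    by (simp add: comp_def)
qed

lemma completion_identity:
  assumes "continuous_map TY TY f" "continuous_map TY TY g"
    and "\<And>x. x \<in> X \<Longrightarrow> f (embed x) = g (embed x)" and "y \<in> completion"
  shows "f y = g y"
  by (rule forall_in_closure_of_eq[OF _ completion_hausdorff assms(1,2)])
    (use assms(3,4) embed_dense in auto)

text \<open>Identities pass from a dense subset to a Hausdorff space, here one variable after the other.\<close>

lemma median_algebra_completion: "median_algebra completion extended_median"
proof
  note cont = continuous_map_extended_median continuous_map_const[THEN iffD2] continuous_map_id[unfolded id_def]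
  note emb = embed_in_completion
  let ?m = extended_median and ?e = embed
  show "?m a b c \<in> completion" if "a \<in> completion" "b \<in> completion" "c \<in> completion" for a b c
    using that by (rule extended_median_closed)
  have 1: "?m (?e a) (?e b) c = ?m (?e b) (?e a) c" if "a \<in> X" "b \<in> X" "c \<in> completion" for a b c
    by (rule completion_identity[OF _ _ _ that(3)])
      (use that in \<open>auto intro!: cont simp: topspace_TY emb extended_median_embed swap_left\<close>)
  have 2: "?m (?e a) b c = ?m b (?e a) c" if "a \<in> X" "b \<in> completion" "c \<in> completion" for a b c
    by (rule completion_identity[OF _ _ _ that(2)])
      (use that in \<open>auto intro!: cont simp: topspace_TY emb 1\<close>)
  show "?m a b c = ?m b a c" if "a \<in> completion" "b \<in> completion" "c \<in> completion" for a b c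
    by (rule completion_identity[OF _ _ _ that(1)])
      (use that in \<open>auto intro!: cont simp: topspace_TY emb 2\<close>)
  have 1: "?m (?e a) (?e b) c = ?m (?e a) c (?e b)" if "a \<in> X" "b \<in> X" "c \<in> completion" for a b c
    by (rule completion_identity[OF _ _ _ that(3)])
      (use that in \<open>auto intro!: cont simp: topspace_TY emb extended_median_embed swap_right\<close>)
  have 2: "?m (?e a) b c = ?m (?e a) c b" if "a \<in> X" "b \<in> completion" "c \<in> completion" for a b c
    by (rule completion_identity[OF _ _ _ that(2)])
      (use that in \<open>auto intro!: cont simp: topspace_TY emb 1\<close>)
  show "?m a b c = ?m a c b" if "a \<in> completion" "b \<in> completion" "c \<in> completion" for a b c
    by (rule completion_identity[OF _ _ _ that(1)])
      (use that in \<open>auto intro!: cont simp: topspace_TY emb 2\<close>)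
  have 1: "?m (?e a) b b = b" if "a \<in> X" "b \<in> completion" for a b
    by (rule completion_identity[OF _ _ _ that(2)])
      (use that in \<open>auto intro!: cont simp: topspace_TY emb extended_median_embed absorb\<close>)
  show "?m a b b = b" if "a \<in> completion" "b \<in> completion" for a b
    by (rule completion_identity[OF _ _ _ that(1)])
      (use that in \<open>auto intro!: cont simp: topspace_TY emb 1\<close>)
  have 1: "?m (?m (?e a) (?e x) (?e b)) (?e x) c = ?m (?e a) (?e x) (?m (?e b) (?e x) c)"
    if "a \<in> X" "x \<in> X" "b \<in> X" "c \<in> completion" for a b c x
    by (rule completion_identity[OF _ _ _ that(4)])
      (use that in \<open>auto intro!: cont simp: topspace_TY emb extended_median_embed extended_median_closed closed assoc\<close>)
  have 2: "?m (?m (?e a) (?e x) b) (?e x) c = ?m (?e a) (?e x) (?m b (?e x) c)"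
    if "a \<in> X" "x \<in> X" "b \<in> completion" "c \<in> completion" for a b c x
    by (rule completion_identity[OF _ _ _ that(3)])
      (use that in \<open>auto intro!: cont simp: topspace_TY emb extended_median_closed 1\<close>)
  have 3: "?m (?m a (?e x) b) (?e x) c = ?m a (?e x) (?m b (?e x) c)"
    if "a \<in> completion" "x \<in> X" "b \<in> completion" "c \<in> completion" for a b c x
    by (rule completion_identity[OF _ _ _ that(1)])
      (use that in \<open>auto intro!: cont simp: topspace_TY emb extended_median_closed 2\<close>)
  show "?m (?m a x b) x c = ?m a x (?m b x c)"
    if "a \<in> completion" "b \<in> completion" "c \<in> completion" "x \<in> completion" for a b c x
    by (rule completion_identity[OF _ _ _ that(4)])
      (use that in \<open>auto intro!: cont simp: topspace_TY emb extended_median_closed 3\<close>)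
qed

lemma topological_median_algebra_completion: "topological_median_algebra TY extended_median"
  unfolding topological_median_algebra_def topspace_TY
  using median_algebra_completion extended_median_continuous by blast

end

section \<open>The median uniformity\<close>

lemma common_refinement_subset: "A \<in> common_refinement X S \<Longrightarrow> A \<subseteq> X"
  by (auto simp: common_refinement_def)

lemma common_refinement_refines: "C \<in> S \<Longrightarrow> cover_refines (common_refinement X S) C"
  by (auto simp: common_refinement_def cover_refines_def)

lemma in_common_refinementI:
  assumes "A \<subseteq> X" "\<And>C. C \<in> S \<Longrightarrow> \<exists>B\<in>C. A \<subseteq> B"
  shows "\<exists>N\<in>common_refinement X S. A \<subseteq> N"
proof -
  obtain f where f: "\<And>C. C \<in> S \<Longrightarrow> f C \<in> C \<and> A \<subseteq> f C" using assms(2) by metis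
  have "X \<inter> (\<Inter>C\<in>S. f C) \<in> common_refinement X S" using f by (auto simp: common_refinement_def)
  moreover have "A \<subseteq> X \<inter> (\<Inter>C\<in>S. f C)" using assms(1) f by blast
  ultimately show ?thesis by blast
qed

lemma common_refinement_mono:
  assumes "S \<subseteq> S'"
  shows "cover_refines (common_refinement X S') (common_refinement X S)"
  unfolding cover_refines_def
proof
  fix A assume A: "A \<in> common_refinement X S'"
  have "\<exists>B\<in>C. A \<subseteq> B" if "C \<in> S" for C
    using common_refinement_refines[of C S'] that assms A unfolding cover_refines_def by blast
  then show "\<exists>N\<in>common_refinement X S. A \<subseteq> N"
    by (intro in_common_refinementI common_refinement_subset[OF A])
qed

lemma is_cover_common_refinement:
  assumes "\<And>C. C \<in> S \<Longrightarrow> X \<subseteq> \<Union>C"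
  shows "is_cover X (common_refinement X S)"
  unfolding is_cover_def
proof
  show "common_refinement X S \<subseteq> Pow X" using common_refinement_subset by blast
  have "x \<in> \<Union>(common_refinement X S)" if x: "x \<in> X" for x
    using in_common_refinementI[of "{x}" X S] assms x by blast
  then show "\<Union>(common_refinement X S) = X" using common_refinement_subset by blast
qed

lemma finite_common_refinement:
  assumes "finite S" "\<And>C. C \<in> S \<Longrightarrow> finite C"
  shows "finite (common_refinement X S)"
proof -
  have "common_refinement X S \<subseteq> (\<lambda>f. X \<inter> (\<Inter>C\<in>S. f C)) ` (PiE S id)"
  proof
    fix A assume "A \<in> common_refinement X S"
    then obtain f where f: "A = X \<inter> (\<Inter>C\<in>S. f C)" "\<forall>C\<in>S. f C \<in> C"
      by (auto simp: common_refinement_def)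
    then have "A = X \<inter> (\<Inter>C\<in>S. restrict f S C)" "restrict f S \<in> PiE S id" by auto
    then show "A \<in> (\<lambda>f. X \<inter> (\<Inter>C\<in>S. f C)) ` (PiE S id)" by blast
  qed
  moreover have "finite (PiE S id)" using assms by (intro finite_PiE) auto
  ultimately show ?thesis using finite_surj by blast
qed

lemma common_refinement_in_generated:
  assumes "S \<subseteq> \<S>" "finite S" "\<And>C. C \<in> \<S> \<Longrightarrow> X \<subseteq> \<Union>C"
  shows "common_refinement X S \<in> generated_uniformity X \<S>"
proof -
  have "is_cover X (common_refinement X S)" using assms by (intro is_cover_common_refinement) blast
  then show ?thesis unfolding generated_uniformity_def using assms(1,2) cover_refines_refl by blast
qed

text \<open>For the axiom of star refinement it is enough that every cover in the subbase has a refinement whose stars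
  of points are contained in members (a barycentric refinement): two barycentric refinements in succession give a star
  refinement.\<close>

lemma covering_uniformity_generated:
  assumes cov: "\<And>C. C \<in> \<S> \<Longrightarrow> X \<subseteq> \<Union>C" and ne: "{} \<notin> \<S>"
    and bary: "\<And>C. C \<in> \<S> \<Longrightarrow> \<exists>S\<subseteq>\<S>. finite S \<and>
      (\<forall>x\<in>X. \<exists>B\<in>C. cover_star (common_refinement X S) {x} \<subseteq> B)"
  shows "covering_uniformity X (generated_uniformity X \<S>)"
proof
  let ?U = "generated_uniformity X \<S>"
  note in_U = common_refinement_in_generated[OF _ _ cov]
  show "?U \<noteq> {}" using in_U[of "{}"] by blast
  fix C assume C: "C \<in> ?U"
  then obtain S where cC: "is_cover X C" and S: "S \<subseteq> \<S>" "finite S" "cover_refines (common_refinement X S) C"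
    by (auto simp: generated_uniformity_def)
  show "is_cover X C" by (rule cC)
  show "D \<in> ?U" if "is_cover X D" "cover_refines C D" for D
    using that S cover_refines_trans[OF S(3) that(2)] by (auto simp: generated_uniformity_def)
  show "\<exists>E\<in>?U. cover_refines E C \<and> cover_refines E D" if "D \<in> ?U" for D
  proof -
    from that obtain S' where S': "S' \<subseteq> \<S>" "finite S'" "cover_refines (common_refinement X S') D"
      by (auto simp: generated_uniformity_def)
    have "common_refinement X (S \<union> S') \<in> ?U" using S S' by (intro in_U) auto
    moreover have "cover_refines (common_refinement X (S \<union> S')) C"
      by (rule cover_refines_trans[OF common_refinement_mono S(3)]) simp
    moreover have "cover_refines (common_refinement X (S \<union> S')) D"
      by (rule cover_refines_trans[OF common_refinement_mono S'(3)]) simp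
    ultimately show ?thesis by blast
  qed
  have bary_fin: "\<exists>S'\<subseteq>\<S>. finite S' \<and>
      (\<forall>x\<in>X. \<exists>N\<in>common_refinement X S. cover_star (common_refinement X S') {x} \<subseteq> N)"
    if S: "S \<subseteq> \<S>" "finite S" for S
  proof -
    have "\<forall>C\<in>S. \<exists>T. T \<subseteq> \<S> \<and> finite T \<and> (\<forall>x\<in>X. \<exists>B\<in>C. cover_star (common_refinement X T) {x} \<subseteq> B)"
      using bary S(1) by blast
    then obtain b where b: "\<And>C. C \<in> S \<Longrightarrow> b C \<subseteq> \<S> \<and> finite (b C) \<and>
        (\<forall>x\<in>X. \<exists>B\<in>C. cover_star (common_refinement X (b C)) {x} \<subseteq> B)"
      using bchoice[of S] by metis
    let ?S' = "\<Union>(b ` S)"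
    have "\<exists>N\<in>common_refinement X S. cover_star (common_refinement X ?S') {x} \<subseteq> N" if x: "x \<in> X" for x
    proof (rule in_common_refinementI)
      show "cover_star (common_refinement X ?S') {x} \<subseteq> X"
        using common_refinement_subset by (fastforce simp: cover_star_def)
      fix C assume C: "C \<in> S"
      have "cover_refines (common_refinement X ?S') (common_refinement X (b C))"
        by (rule common_refinement_mono) (use C in blast)
      from cover_star_refines[OF this] show "\<exists>B\<in>C. cover_star (common_refinement X ?S') {x} \<subseteq> B"
        using b[OF C] x by (meson order_trans)
    qed
    moreover have "?S' \<subseteq> \<S>" "finite ?S'" using b S(2) by blast+
    ultimately show ?thesis by blast
  qed
  \<comment> \<open>\<open>S1\<close> and \<open>S2\<close> are two barycentric refinements in succession.\<close>
  obtain S1 where S1: "S1 \<subseteq> \<S>" "finite S1"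
    "\<And>x. x \<in> X \<Longrightarrow> \<exists>N\<in>common_refinement X S. cover_star (common_refinement X S1) {x} \<subseteq> N"
    using bary_fin[OF S(1,2)] by metis
  obtain S2 where S2: "S2 \<subseteq> \<S>" "finite S2"
    "\<And>x. x \<in> X \<Longrightarrow> \<exists>N\<in>common_refinement X S1. cover_star (common_refinement X S2) {x} \<subseteq> N"
    using bary_fin[OF S1(1,2)] by metis
  let ?E = "common_refinement X S2"
  have "\<exists>B\<in>C. cover_star ?E A \<subseteq> B" if A: "A \<in> ?E" for A
  proof (cases "A = {}")
    case True
    have "D \<noteq> {}" if "D \<in> S" for D using that S(1) ne by blast
    then have "\<exists>N\<in>common_refinement X S. {} \<subseteq> N"
      by (intro in_common_refinementI) auto
    then have "C \<noteq> {}" using S(3) unfolding cover_refines_def by blast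
    then show ?thesis using True by (auto simp: cover_star_def)
  next
    case False
    then obtain a where a: "a \<in> A" "a \<in> X" using common_refinement_subset[OF A] by blast
    have "cover_star ?E A \<subseteq> cover_star (common_refinement X S1) {a}"
    proof
      fix y assume "y \<in> cover_star ?E A"
      then obtain A' b where A': "A' \<in> ?E" "y \<in> A'" "b \<in> A'" "b \<in> A" by (auto simp: cover_star_def)
      then have "b \<in> X" using common_refinement_subset by blast
      then obtain N where N: "N \<in> common_refinement X S1" "cover_star ?E {b} \<subseteq> N" using S2(3) by blast
      have "a \<in> cover_star ?E {b}" "y \<in> cover_star ?E {b}"
        unfolding mem_cover_star
        by (rule bexI[of _ A], simp add: A' a(1), rule A) (rule bexI[of _ A'], simp add: A', rule A'(1))
      then have "a \<in> N" "y \<in> N" using N(2) by blast+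
      then show "y \<in> cover_star (common_refinement X S1) {a}"
        unfolding mem_cover_star by (intro bexI[of _ N] conjI N(1))
    qed
    moreover obtain N where N: "N \<in> common_refinement X S" "cover_star (common_refinement X S1) {a} \<subseteq> N"
      using S1(3)[OF a(2)] by blast
    moreover obtain B where "B \<in> C" "N \<subseteq> B" using S(3) N(1) unfolding cover_refines_def by blast
    ultimately show ?thesis by blast
  qed
  moreover have "?E \<in> ?U" by (rule in_U[OF S2(1,2)])
  ultimately show "\<exists>E\<in>?U. \<forall>A\<in>E. \<exists>B\<in>C. cover_star E A \<subseteq> B" by blast
qed

definition chain_covers :: "'a set \<Rightarrow> ('a \<Rightarrow> 'a \<Rightarrow> 'a \<Rightarrow> 'a) \<Rightarrow> 'a set set set" where
  "chain_covers X m = {{branch X m u v, branch X m v u} | u v. chain_interval X m u v}"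

lemma median_uniformity_eq: "median_uniformity X m = generated_uniformity X (chain_covers X m)"
  unfolding median_uniformity_def chain_covers_def chain_interval_def by simp

context median_algebra begin

lemma chain_coversI: "chain u v \<Longrightarrow> {Br u v, Br v u} \<in> chain_covers X m"
  by (auto simp: chain_covers_def)

lemma chain_coversE:
  assumes "C \<in> chain_covers X m" obtains u v where "chain u v" "C = {Br u v, Br v u}"
  using assms by (auto simp: chain_covers_def)

lemma chain_cover_covers:
  assumes "C \<in> chain_covers X m" shows "X \<subseteq> \<Union>C"
proof -
  obtain u v where uv: "chain u v" "C = {Br u v, Br v u}" using assms by (rule chain_coversE)
  show ?thesis using branch_cover[OF chainD[OF uv(1)]] uv(2) by simp
qed

text \<open>If \<open>w\<close> lies strictly inside the chain, the covers of \<open>[u, w]\<close> and \<open>[w,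
  v]\<close> do: a point strictly below \<open>w\<close> is excluded from \<open>B\<^sup>v\<^sub>w\<close>, so its
  star stays below \<open>v\<close>, and the star of any other point stays above \<open>u\<close>. If there is no such
  \<open>w\<close>, the cover of \<open>[u, v]\<close> is a partition.\<close>

lemma chain_cover_barycentric:
  assumes ch: "chain u v"
  shows "\<exists>S\<subseteq>chain_covers X m. finite S \<and>
    (\<forall>x\<in>X. \<exists>A\<in>{Br u v, Br v u}. cover_star (common_refinement X S) {x} \<subseteq> A)"
proof -
  have uv: "u \<in> X" "v \<in> X" "u \<noteq> v" using chainD ch by auto
  have star: "cover_star (common_refinement X S) {x} \<subseteq> A"
    if "{A, A'} \<in> S" "x \<notin> A'" for S x A A'
  proof -
    have "cover_star (common_refinement X S) {x} \<subseteq> cover_star {A, A'} {x}"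
      by (rule cover_star_refines[OF common_refinement_refines[OF that(1)]])
    also have "\<dots> \<subseteq> A" using that(2) by (auto simp: cover_star_def)
    finally show ?thesis .
  qed
  show ?thesis
  proof (cases "\<exists>w\<in>X. m u w v = w \<and> w \<noteq> u \<and> w \<noteq> v")
    case True
    then obtain w where w: "w \<in> X" "m u w v = w" "w \<noteq> u" "w \<noteq> v" by blast
    have wv: "m v w u = w" using median_flip uv w by metis
    let ?S = "{{Br u w, Br w u}, {Br w v, Br v w}}"
    have "chain u w" "chain w v" using chain_sub[OF ch] w uv absorb absorb' by auto
    then have "?S \<subseteq> chain_covers X m" using chain_coversI by blast
    moreover have "\<exists>A\<in>{Br u v, Br v u}. cover_star (common_refinement X ?S) {x} \<subseteq> A" for x
    proof (cases "x \<in> Br u w")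
      case True
      then have "x \<notin> Br v w" using branch_disjoint_at[OF ch w(1,2)] by blast
      then have "cover_star (common_refinement X ?S) {x} \<subseteq> Br w v"
        using star[of "Br w v" "Br v w" ?S x] by simp
      moreover have "Br w v \<subseteq> Br u v" by (rule branch_mono_left[OF uv(1,2) w(1,2)])
      ultimately show ?thesis by blast
    next
      case False
      have "{Br w u, Br u w} \<in> ?S" by (simp add: insert_commute)
      from star[OF this False] have "cover_star (common_refinement X ?S) {x} \<subseteq> Br w u" .
      moreover have "Br w u \<subseteq> Br v u" by (rule branch_mono_left[OF uv(2,1) w(1) wv])
      ultimately show ?thesis by blast
    qed
    ultimately show ?thesis by blast
  next
    case False
    then have disj: "Br u v \<inter> Br v u = {}" using branch_disjoint_jump[OF uv(1,2)] by blast
    have "\<exists>A\<in>{Br u v, Br v u}. cover_star (common_refinement X {{Br u v, Br v u}}) {x} \<subseteq> A" for x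
      using disj star[of "Br u v" "Br v u" _ x] star[of "Br v u" "Br u v" _ x] by (auto simp: insert_commute)
    then show ?thesis using chain_coversI[OF ch] by (intro exI[of _ "{{Br u v, Br v u}}"]) blast
  qed
qed

lemma covering_uniformity_median: "covering_uniformity X (median_uniformity X m)"
  unfolding median_uniformity_eq
proof (rule covering_uniformity_generated)
  show "{} \<notin> chain_covers X m" by (auto simp: chain_covers_def)
  show "\<exists>S\<subseteq>chain_covers X m. finite S \<and>
      (\<forall>x\<in>X. \<exists>B\<in>C. cover_star (common_refinement X S) {x} \<subseteq> B)" if "C \<in> chain_covers X m" for C
    using that by (rule chain_coversE) (simp only: chain_cover_barycentric)
qed (rule chain_cover_covers)

lemma chain_refinement_in_uniformity:
  "\<lbrakk>S \<subseteq> chain_covers X m; finite S\<rbrakk> \<Longrightarrow> common_refinement X S \<in> median_uniformity X m"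
  unfolding median_uniformity_eq by (rule common_refinement_in_generated[OF _ _ chain_cover_covers])

lemma median_uniformityE:
  assumes "C \<in> median_uniformity X m"
  obtains S where "S \<subseteq> chain_covers X m" "finite S" "cover_refines (common_refinement X S) C"
  using assms unfolding median_uniformity_eq generated_uniformity_def
  by (elim CollectE conjE exE) (rule that)

lemma chain_cover_in_uniformity:
  assumes "chain u v" shows "{Br u v, Br v u} \<in> median_uniformity X m"
proof -
  interpret covering_uniformity X "median_uniformity X m" by (rule covering_uniformity_median)
  have "is_cover X {Br u v, Br v u}"
    using branch_cover branch_subset chainD[OF assms] by (auto simp: is_cover_def)
  then show ?thesis
    using coarser[OF chain_refinement_in_uniformity[of "{{Br u v, Br v u}}"]]
      common_refinement_refines[of "{Br u v, Br v u}"] chain_coversI[OF assms] by simp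
qed

text \<open>Among three members of a two-element cover two coincide, and a branch contains each median of which it
  contains two arguments.\<close>

lemma chain_cover_median:
  assumes C: "C \<in> chain_covers X m" and P: "P \<in> C" "Q \<in> C" "R \<in> C"
  shows "\<exists>K\<in>C. \<forall>a\<in>P. \<forall>b\<in>Q. \<forall>c\<in>R. m a b c \<in> K"
proof -
  obtain u v where uv: "chain u v" "C = {Br u v, Br v u}" using C by (rule chain_coversE)
  have two: "m a b c \<in> K" if K: "K \<in> C" and X: "a \<in> X" "b \<in> X" "c \<in> X"
    and "a \<in> K \<and> b \<in> K \<or> b \<in> K \<and> c \<in> K \<or> c \<in> K \<and> a \<in> K" for K a b c
  proof -
    have "K = Br u v \<or> K = Br v u" using K uv(2) by simp
    then have "bool_hom X m (\<lambda>x. x \<in> K)"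
      using branch_hom[OF uv(1)] branch_hom[OF chain_sym[OF uv(1)]] by (elim disjE) simp_all
    then have "m a b c \<in> K \<longleftrightarrow> majority (a \<in> K) (b \<in> K) (c \<in> K)"
      using X unfolding bool_hom_def by blast
    then show ?thesis using that(5) by (simp add: majority_def)
  qed
  have sub: "K \<subseteq> X" if "K \<in> C" for K
    using that branch_subset[of u v] branch_subset[of v u] unfolding uv(2) by auto
  have "P = Q \<or> Q = R \<or> R = P" using P unfolding uv(2) by auto
  then obtain K where K: "K \<in> C" "P = K \<and> Q = K \<or> Q = K \<and> R = K \<or> R = K \<and> P = K" using P by metis
  have "m a b c \<in> K" if abc: "a \<in> P" "b \<in> Q" "c \<in> R" for a b c
  proof (rule two[OF K(1)])
    show "a \<in> X" "b \<in> X" "c \<in> X" using sub[OF P(1)] sub[OF P(2)] sub[OF P(3)] abc by auto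
    show "a \<in> K \<and> b \<in> K \<or> b \<in> K \<and> c \<in> K \<or> c \<in> K \<and> a \<in> K" using K(2) abc by metis
  qed
  then show ?thesis using K(1) by blast
qed

lemma uniform_median_algebra_median: "uniform_median_algebra X (median_uniformity X m) m"
proof -
  interpret covering_uniformity X "median_uniformity X m" by (rule covering_uniformity_median)
  show ?thesis
  proof
    fix C assume "C \<in> median_uniformity X m"
    then obtain S where S: "S \<subseteq> chain_covers X m" "finite S" "cover_refines (common_refinement X S) C"
      by (rule median_uniformityE)
    let ?E = "common_refinement X S"
    have "\<exists>M\<in>?E. \<forall>a\<in>P. \<forall>b\<in>Q. \<forall>d\<in>R. m a b d \<in> M" if PQR: "P \<in> ?E" "Q \<in> ?E" "R \<in> ?E" for P Q R
    proof -
      let ?V = "{m a b d | a b d. a \<in> P \<and> b \<in> Q \<and> d \<in> R}"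
      have "\<exists>M\<in>?E. ?V \<subseteq> M"
      proof (rule in_common_refinementI)
        show "?V \<subseteq> X" using PQR[THEN common_refinement_subset] closed by blast
        fix D assume D: "D \<in> S"
        note ref = common_refinement_refines[OF D, of X, unfolded cover_refines_def, rule_format]
        obtain P' Q' R' where *: "P' \<in> D" "Q' \<in> D" "R' \<in> D" "P \<subseteq> P'" "Q \<subseteq> Q'" "R \<subseteq> R'"
          using PQR[THEN ref] by (elim bexE)
        have "D \<in> chain_covers X m" using D S(1) by blast
        from chain_cover_median[OF this *(1-3)]
        obtain K where K: "K \<in> D" "\<And>a b c. \<lbrakk>a \<in> P'; b \<in> Q'; c \<in> R'\<rbrakk> \<Longrightarrow> m a b c \<in> K" by metis
        have "?V \<subseteq> K" using K(2) subsetD[OF *(4)] subsetD[OF *(5)] subsetD[OF *(6)] by auto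
        then show "\<exists>K\<in>D. ?V \<subseteq> K" using K(1) by (intro bexI)
      qed
      then obtain M where "M \<in> ?E" "?V \<subseteq> M" by (elim bexE)
      then show ?thesis by (intro bexI[of _ M]) auto
    qed
    then show "\<exists>E\<in>median_uniformity X m. cover_refines E C \<and>
        (\<forall>A\<in>E. \<forall>B\<in>E. \<forall>D\<in>E. \<exists>M\<in>E. \<forall>a\<in>A. \<forall>b\<in>B. \<forall>d\<in>D. m a b d \<in> M)"
      by (intro bexI[of _ ?E] conjI ballI chain_refinement_in_uniformity[OF S(1,2)] S(3))
  qed
qed

lemma median_uniformity_separates:
  assumes "\<not> embeds_cube X m n" "x \<in> X" "y \<in> X" "x \<noteq> y"
  shows "\<exists>C\<in>median_uniformity X m. y \<notin> cover_star C {x}"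
proof -
  obtain u v where uv: "chain u v" "x \<in> Br u v" "x \<notin> Br v u" "y \<notin> Br u v" "y \<in> Br v u"
    by (rule separating_chain[OF assms])
  then have "y \<notin> cover_star {Br u v, Br v u} {x}" by (auto simp: mem_cover_star)
  then show ?thesis using chain_cover_in_uniformity[OF uv(1)] by blast
qed

lemma median_uniformity_hausdorff:
  assumes "\<not> embeds_cube X m n"
  shows "Hausdorff_space (uniform_topology X (median_uniformity X m))"
  by (rule covering_uniformity.hausdorffI[OF covering_uniformity_median])
    (rule median_uniformity_separates[OF assms])

lemma mmc_exists: "\<exists>(Y :: 'a filter set) V m' j. is_mmc X m Y V m' j"
proof -
  interpret uniform_median_algebra X "median_uniformity X m" m by (rule uniform_median_algebra_median)
  have "is_mmc X m completion completion_uniformity extended_median embed"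
    unfolding is_mmc_def
    using hausdorff_completion_completion topological_median_algebra_completion extended_median_embed
    by simp
  then show ?thesis by blast
qed

lemma median_uniformity_precompact:
  assumes "C \<in> median_uniformity X m"
  shows "\<exists>D\<subseteq>C. finite D \<and> X \<subseteq> \<Union>D"
proof -
  obtain S where S: "S \<subseteq> chain_covers X m" "finite S" "cover_refines (common_refinement X S) C"
    using assms by (rule median_uniformityE)
  have "finite (common_refinement X S)"
  proof (rule finite_common_refinement[OF S(2)])
    fix D assume "D \<in> S"
    then have "D \<in> chain_covers X m" using S(1) by blast
    then show "finite D" by (rule chain_coversE) simp
  qed
  moreover obtain g where g: "\<And>A. A \<in> common_refinement X S \<Longrightarrow> g A \<in> C \<and> A \<subseteq> g A"
    using S(3) unfolding cover_refines_def by metis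
  moreover have "\<Union>(common_refinement X S) = X"
    using is_cover_common_refinement[of S X] S(1) chain_cover_covers unfolding is_cover_def by blast
  ultimately have "g ` common_refinement X S \<subseteq> C" "finite (g ` common_refinement X S)"
    "X \<subseteq> \<Union>(g ` common_refinement X S)" by blast+
  then show ?thesis by blast
qed

end

section \<open>Uniform covers of low order\<close>

text \<open>A minimal element among the proper filters below \<open>F\<close>, found with Zorn's lemma.\<close>

lemma ultrafilter_below:
  fixes F :: "'a filter"
  assumes "F \<noteq> bot"
  obtains G where "G \<le> F" "G \<noteq> bot" "\<And>P. eventually P G \<or> eventually (\<lambda>x. \<not> P x) G"
proof -
  let ?A = "{G. G \<noteq> bot \<and> G \<le> F}"
  have "\<exists>G\<in>?A. \<forall>H\<in>?A. G \<ge> H \<longrightarrow> H = G"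
  proof (rule predicate_Zorn)
    show "partial_order_on ?A (relation_of (\<ge>) ?A)"
      by (rule partial_order_on_relation_ofI) auto
    fix C assume C: "C \<in> Chains (relation_of (\<ge>) ?A)"
    have CA: "C \<subseteq> ?A" using C by (auto simp: Chains_def relation_of_def)
    have lin: "G \<le> H \<or> H \<le> G" if "G \<in> C" "H \<in> C" for G H
      using C that by (auto simp: Chains_def relation_of_def)
    show "\<exists>u\<in>?A. \<forall>a\<in>C. a \<ge> u"
    proof (cases "C = {}")
      case True
      then show ?thesis using assms by auto
    next
      case False
      have "eventually (\<lambda>_. False) (Inf C) \<longleftrightarrow> (\<exists>b\<in>C. eventually (\<lambda>_. False) b)"
      proof (rule eventually_Inf_base[OF False])
        fix G H assume GH: "G \<in> C" "H \<in> C"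
        show "\<exists>x\<in>C. x \<le> inf G H"
          using lin[OF GH] GH by (elim disjE) (auto intro: bexI[of _ G] bexI[of _ H])
      qed
      then have "Inf C \<noteq> bot" using CA by (auto simp: eventually_False)
      moreover have "Inf C \<le> F" using False CA by (auto intro: Inf_lower2)
      moreover have "\<forall>a\<in>C. a \<ge> Inf C" by (auto intro: Inf_lower)
      ultimately show ?thesis by blast
    qed
  qed
  then obtain G where G: "G \<noteq> bot" "G \<le> F" "\<And>H. \<lbrakk>H \<noteq> bot; H \<le> F; H \<le> G\<rbrakk> \<Longrightarrow> H = G" by blast
  have "eventually P G" if nP: "\<not> eventually (\<lambda>x. \<not> P x) G" for P
  proof -
    let ?H = "inf G (principal {x. P x})"
    have "?H \<noteq> bot" using nP by (simp add: trivial_limit_def eventually_inf_principal)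
    moreover have "?H \<le> G" by simp
    ultimately have "?H = G" using G(2,3) order_trans by blast
    then have "eventually P ?H \<longleftrightarrow> eventually P G" by simp
    then show ?thesis by (simp add: eventually_inf_principal)
  qed
  then show ?thesis using that G by blast
qed

text \<open>The points whose \<open>D\<close>-star fits into no member of the open cover form a filter base as
  \<open>D\<close> runs over the uniform covers. If it were proper, an ultrafilter containing it would be Cauchy by
  precompactness and converge by completeness; but near its limit all sufficiently fine stars fit into one member of
  the open cover.\<close>

lemma (in covering_uniformity) lebesgue_number:
  assumes complete: "uniformly_complete X U"
    and precompact: "\<And>C. C \<in> U \<Longrightarrow> \<exists>D\<subseteq>C. finite D \<and> X \<subseteq> \<Union>D"
    and op: "\<And>A. A \<in> \<O> \<Longrightarrow> openin T A" and cov: "X \<subseteq> \<Union>\<O>"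
  shows "\<exists>D\<in>U. \<forall>x\<in>X. \<exists>A\<in>\<O>. cover_star D {x} \<subseteq> A"
proof (rule ccontr)
  assume none: "\<not> ?thesis"
  define bad where "bad D = {x \<in> X. \<forall>A\<in>\<O>. \<not> cover_star D {x} \<subseteq> A}" for D
  have bad_ne: "bad D \<noteq> {}" if "D \<in> U" for D using none that by (auto simp: bad_def)
  have bad_mono: "bad E \<subseteq> bad D" if "cover_refines E D" for D E
    using cover_star_refines[OF that] unfolding bad_def by blast
  define F where "F = (INF D\<in>U. principal (bad D))"
  have evF: "eventually P F \<longleftrightarrow> (\<exists>D\<in>U. \<forall>x\<in>bad D. P x)" for P
    unfolding F_def
  proof (subst eventually_INF_base)
    fix C D assume "C \<in> U" "D \<in> U"
    then obtain E where "E \<in> U" "cover_refines E C" "cover_refines E D" using common by blast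
    then show "\<exists>x\<in>U. principal (bad x) \<le> inf (principal (bad C)) (principal (bad D))"
      using bad_mono by (intro bexI[of _ E]) auto
  qed (auto simp: eventually_principal nonempty)
  have "F \<noteq> bot" unfolding trivial_limit_def evF using bad_ne by blast
  then obtain G where G: "G \<le> F" "G \<noteq> bot" "\<And>P. eventually P G \<or> eventually (\<lambda>x. \<not> P x) G"
    by (rule ultrafilter_below) blast
  have ev_bad: "eventually (\<lambda>x. x \<in> bad D) G" if "D \<in> U" for D
    by (rule filter_leD[OF G(1)]) (use evF that in blast)
  have evX: "eventually (\<lambda>x. x \<in> X) G"
  proof -
    obtain D where "D \<in> U" using nonempty by blast
    from ev_bad[OF this] show ?thesis by (rule eventually_mono) (simp add: bad_def)
  qed
  have "\<exists>A\<in>C. eventually (\<lambda>x. x \<in> A) G" if C: "C \<in> U" for C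
  proof (rule ccontr)
    assume "\<not> ?thesis"
    then have out: "eventually (\<lambda>x. x \<notin> A) G" if "A \<in> C" for A using G(3)[of "\<lambda>x. x \<in> A"] that by blast
    obtain D where D: "D \<subseteq> C" "finite D" "X \<subseteq> \<Union>D" using precompact[OF C] by blast
    have "eventually (\<lambda>x. \<forall>A\<in>D. x \<notin> A) G"
      by (rule eventually_ball_finite[OF D(2)]) (use out D(1) in blast)
    then have "eventually (\<lambda>x. False) G" using evX by eventually_elim (use D(3) in blast)
    then show False using G(2) by (simp add: eventually_False)
  qed
  then obtain y where y: "limitin T (\<lambda>x. x) y G"
    using complete G(2) evX unfolding uniformly_complete_def by blast
  then have "y \<in> X" by (simp add: limitin_def topspace_uniform_topology)
  then obtain A where A: "A \<in> \<O>" "y \<in> A" using cov by blast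
  obtain D where D: "D \<in> U" "cover_star D {y} \<subseteq> A" using op[OF A(1)] A(2) openin_uniform_topology by blast
  obtain E where E: "E \<in> U" "\<And>x y. y \<in> cover_star E {x} \<Longrightarrow> cover_star E {y} \<subseteq> cover_star D {x}"
    by (rule star_refinement_point[OF D(1)]) blast
  obtain W where W: "openin T W" "y \<in> W" "W \<subseteq> cover_star E {y}"
    by (rule star_is_neighbourhood[OF E(1) \<open>y \<in> X\<close>])
  have "eventually (\<lambda>x. x \<in> W) G" using y W(1,2) by (simp add: limitin_def)
  then have "eventually (\<lambda>x. False) G" using ev_bad[OF E(1)]
  proof eventually_elim
    case (elim x)
    then have "cover_star E {x} \<subseteq> A" using W(3) E(2) D(2) by blast
    then show ?case using elim(2) A(1) by (auto simp: bad_def)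
  qed
  then show False using G(2) by (simp add: eventually_False)
qed

context median_algebra begin

text \<open>The points that project to neither end point of \<open>[u, v]\<close>.\<close>

definition gap :: "'a \<Rightarrow> 'a \<Rightarrow> 'a set" where
  "gap u v = Br u v \<inter> Br v u"

text \<open>For the cover of \<open>[u, v]\<close> by two branches, the replacement by \<open>[p, q]\<close> is a
  refinement. This formulation is transitive at once, and no order on the end points has to be carried along.\<close>

definition narrows :: "'a \<Rightarrow> 'a \<Rightarrow> 'a \<Rightarrow> 'a \<Rightarrow> bool" where
  "narrows u v p q \<longleftrightarrow> chain p q \<and> Br p q \<subseteq> Br u v \<and> Br q p \<subseteq> Br v u"

lemma narrows_refl: "chain u v \<Longrightarrow> narrows u v u v"
  by (simp add: narrows_def)

lemma narrows_trans: "\<lbrakk>narrows u v p q; narrows p q r s\<rbrakk> \<Longrightarrow> narrows u v r s"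
  by (auto simp: narrows_def)

lemma gap_narrows: "narrows u v p q \<Longrightarrow> gap p q \<subseteq> gap u v"
  by (auto simp: narrows_def gap_def)

lemma narrows_interval:
  assumes ch: "chain u v" and X: "p \<in> X" "q \<in> X" "p \<noteq> q" and pq: "m u p q = p" "m u q v = q"
  shows "narrows u v p q"
proof -
  have uv: "u \<in> X" "v \<in> X" using chainD ch by auto
  have "m u p v = p" using between_trans(1)[of u p q v] uv X pq by simp
  then have "chain p q" using chain_sub[OF ch] X pq by simp
  then show ?thesis using branch_mono[of u v p q] uv X pq by (simp add: narrows_def)
qed

text \<open>Suppose that all choices leave a common interior point. Take a point \<open>x\<close> that is interior to
  the given intervals, and cut each interval at the projection of \<open>x\<close>. Every choice of upper and lower
  halves again has a common interior point. So the cuts separate points in all possible combinations, which gives a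
  cube of dimension \<open>card T\<close>.\<close>

lemma narrow_common_gap:
  assumes fin: "finite T" and ch: "\<And>t. t \<in> T \<Longrightarrow> chain (u t) (v t)"
    and nc: "\<not> embeds_cube X m (card T)"
  shows "\<exists>u' v'. (\<forall>t\<in>T. narrows (u t) (v t) (u' t) (v' t)) \<and>
    \<not> (\<exists>x\<in>X. \<forall>t\<in>T. x \<in> gap (u' t) (v' t))"
proof (rule ccontr)
  assume "\<not> ?thesis"
  then have all: "\<exists>x\<in>X. \<forall>t\<in>T. x \<in> gap (u' t) (v' t)"
    if "\<And>t. t \<in> T \<Longrightarrow> narrows (u t) (v t) (u' t) (v' t)" for u' v'
    using that by blast
  obtain x where x: "x \<in> X" "\<And>t. t \<in> T \<Longrightarrow> x \<in> gap (u t) (v t)"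
    using all[of u v] narrows_refl ch by blast
  define w where "w t = m (u t) x (v t)" for t
  have uv: "u t \<in> X" "v t \<in> X" if "t \<in> T" for t using chainD ch[OF that] by auto
  have w: "w t \<in> X" "m (u t) (w t) (v t) = w t" "w t \<noteq> u t" "w t \<noteq> v t" if "t \<in> T" for t
    using x(2)[OF that] uv[OF that] x(1) closed median_between median_flip[of "u t" "v t" x]
    by (auto simp: w_def gap_def branch_def)
  \<comment> \<open>Keep the upper half of the interval for \<open>t \<in> S\<close> and the lower half otherwise.\<close>
  have side: "\<exists>y\<in>X. \<forall>t\<in>T. y \<in> Br (v t) (w t) \<longleftrightarrow> t \<in> S" for S
  proof -
    have "\<exists>y\<in>X. \<forall>t\<in>T. y \<in> gap (if t \<in> S then w t else u t) (if t \<in> S then v t else w t)"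
    proof (rule all)
      fix t assume t: "t \<in> T"
      have "narrows (u t) (v t) (w t) (v t)" "narrows (u t) (v t) (u t) (w t)"
        using narrows_interval[OF ch[OF t]] w[OF t] uv[OF t] absorb absorb' by auto
      then show "narrows (u t) (v t) (if t \<in> S then w t else u t) (if t \<in> S then v t else w t)"
        by simp
    qed
    then obtain y where y: "y \<in> X"
      "\<And>t. t \<in> T \<Longrightarrow> y \<in> gap (if t \<in> S then w t else u t) (if t \<in> S then v t else w t)" by blast
    have "y \<in> Br (v t) (w t) \<longleftrightarrow> t \<in> S" if t: "t \<in> T" for t
      using y(2)[OF t] branch_disjoint_at[OF ch[OF t] w(1,2)[OF t]] by (auto simp: gap_def split: if_splits)
    then show ?thesis using y(1) by blast
  qed
  then obtain y where y: "\<And>S. y S \<in> X" "\<And>S t. t \<in> T \<Longrightarrow> y S \<in> Br (v t) (w t) \<longleftrightarrow> t \<in> S" by metis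
  obtain e where e: "bij_betw e {0..<card T} T" using ex_bij_betw_nat_finite[OF fin] by blast
  have eT: "e k \<in> T" if "k < card T" for k using e that by (auto simp: bij_betw_def)
  have einj: "e i = e k \<longleftrightarrow> i = k" if "i < card T" "k < card T" for i k
    using e that by (auto simp: bij_betw_def inj_on_def)
  have "embeds_cube X m (card T)"
  proof (rule embeds_cube_of_crossing[OF nc])
    show "bool_hom X m (\<lambda>z. z \<in> Br (v (e k)) (w (e k)))" if "k < card T" for k
    proof (rule branch_hom)
      have "m (u (e k)) (v (e k)) (v (e k)) = v (e k)" using absorb uv eT[OF that] by blast
      then show "chain (v (e k)) (w (e k))"
        using chain_sub[OF ch[OF eT[OF that]]] uv[OF eT[OF that]] w[OF eT[OF that]] by metis
    qed
    show "y {} \<notin> Br (v (e k)) (w (e k))" if "k < card T" for k using y(2)[OF eT[OF that]] by simp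
    show "y T \<in> Br (v (e k)) (w (e k))" if "k < card T" for k using y(2) eT[OF that] by simp
    show "y {e i} \<in> Br (v (e k)) (w (e k)) \<longleftrightarrow> i = k" if "i < card T" "k < card T" for i k
      using y(2)[OF eT[OF that(2)], of "{e i}"] einj[OF that] by (simp add: eq_commute[of "e k"])
  qed (rule y(1))+
  then show False using nc by blast
qed

text \<open>Treat the sets of \<open>n\<close> intervals one after the other. Narrowing an interval further cannot
  create new interior points.\<close>

lemma narrow_family:
  assumes fin: "finite K" and ch: "\<And>k. k \<in> K \<Longrightarrow> chain (u k) (v k)" and nc: "\<not> embeds_cube X m n"
  shows "\<exists>u' v'. (\<forall>k\<in>K. narrows (u k) (v k) (u' k) (v' k)) \<and>
    (\<forall>T\<subseteq>K. card T = n \<longrightarrow> \<not> (\<exists>x\<in>X. \<forall>t\<in>T. x \<in> gap (u' t) (v' t)))"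
proof -
  have "\<exists>u' v'. (\<forall>k\<in>K. narrows (u k) (v k) (u' k) (v' k)) \<and>
    (\<forall>T\<in>\<T>. \<not> (\<exists>x\<in>X. \<forall>t\<in>T. x \<in> gap (u' t) (v' t)))"
    if "finite \<T>" "\<T> \<subseteq> {T. T \<subseteq> K \<and> card T = n}" for \<T>
    using that
  proof (induction \<T> rule: finite_induct)
    case empty
    show ?case using narrows_refl ch by (intro exI[of _ u] exI[of _ v]) simp
  next
    case (insert T \<T>)
    have "\<T> \<subseteq> {T. T \<subseteq> K \<and> card T = n}" using insert.prems by simp
    from insert.IH[OF this] obtain u1 v1 where 1: "\<forall>k\<in>K. narrows (u k) (v k) (u1 k) (v1 k)"
      "\<forall>T\<in>\<T>. \<not> (\<exists>x\<in>X. \<forall>t\<in>T. x \<in> gap (u1 t) (v1 t))" by (elim exE conjE)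
    have T: "T \<subseteq> K" "card T = n" using insert by auto
    have ch1: "chain (u1 k) (v1 k)" if "k \<in> K" for k using bspec[OF 1(1) that] by (simp add: narrows_def)
    have "\<exists>u' v'. (\<forall>t\<in>T. narrows (u1 t) (v1 t) (u' t) (v' t)) \<and>
        \<not> (\<exists>x\<in>X. \<forall>t\<in>T. x \<in> gap (u' t) (v' t))"
      by (rule narrow_common_gap) (use finite_subset[OF T(1) fin] ch1 T nc in auto)
    then obtain u2 v2 where 2: "\<forall>t\<in>T. narrows (u1 t) (v1 t) (u2 t) (v2 t)"
      "\<not> (\<exists>x\<in>X. \<forall>t\<in>T. x \<in> gap (u2 t) (v2 t))" by (elim exE conjE)
    define u3 v3 where "u3 t = (if t \<in> T then u2 t else u1 t)" and "v3 t = (if t \<in> T then v2 t else v1 t)" for t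
    have 3: "narrows (u1 k) (v1 k) (u3 k) (v3 k)" if "k \<in> K" for k
      using 2(1) narrows_refl ch1[OF that] by (simp add: u3_def v3_def)
    have nar: "narrows (u k) (v k) (u3 k) (v3 k)" if "k \<in> K" for k
      by (rule narrows_trans[OF bspec[OF 1(1) that] 3[OF that]])
    have few: "\<not> (\<exists>x\<in>X. \<forall>t\<in>S. x \<in> gap (u3 t) (v3 t))" if S: "S \<in> insert T \<T>" for S
    proof (cases "S = T")
      case True
      then show ?thesis using 2(2) by (simp add: u3_def v3_def)
    next
      case False
      then have S': "S \<in> \<T>" "S \<subseteq> K" using S insert.prems by auto
      have "gap (u3 t) (v3 t) \<subseteq> gap (u1 t) (v1 t)" if "t \<in> S" for t
        using gap_narrows[OF 3] S'(2) that by blast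
      then show ?thesis using bspec[OF 1(2) S'(1)] by blast
    qed
    show ?case
      by (intro exI[of _ u3] exI[of _ v3] conjI ballI) (rule nar few, assumption)+
  qed
  from this[of "{T. T \<subseteq> K \<and> card T = n}"] fin
  obtain u' v' where "\<forall>k\<in>K. narrows (u k) (v k) (u' k) (v' k)"
    "\<forall>T\<in>{T. T \<subseteq> K \<and> card T = n}. \<not> (\<exists>x\<in>X. \<forall>t\<in>T. x \<in> gap (u' t) (v' t))"
    by auto
  then show ?thesis by (intro exI[of _ u'] exI[of _ v']) simp
qed

text \<open>A family of levels \<open>i\<close> in the chain \<open>[u, v]\<close>: the sets \<open>L i\<close> and
  \<open>H i\<close> are the points below and above the \<open>i\<close>-th level. Call a set near a level if it is
  contained in neither of them. A set that is small with respect to the covers in \<open>S\<close> is near at most one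
  of the levels up to \<open>n\<close>, and if it is near a level, it lies in the interior of the chain.\<close>

definition cuts :: "nat \<Rightarrow> 'a \<Rightarrow> 'a \<Rightarrow> (nat \<Rightarrow> 'a set) \<Rightarrow> (nat \<Rightarrow> 'a set) \<Rightarrow> 'a set set set \<Rightarrow> bool" where
  "cuts n u v L H S \<longleftrightarrow> S \<subseteq> chain_covers X m \<and> finite S \<and>
    (\<forall>i. L i \<inter> H i = {} \<and> L i \<subseteq> Br u v \<and> H i \<subseteq> Br v u) \<and>
    (\<forall>A. (\<forall>C\<in>S. \<exists>P\<in>C. A \<subseteq> P) \<longrightarrow> (\<forall>i\<le>n. A \<subseteq> L i \<or> A \<subseteq> H i \<or>
      A \<subseteq> gap u v \<and> (\<forall>k\<le>n. k \<noteq> i \<longrightarrow> A \<subseteq> L k \<or> A \<subseteq> H k)))"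

text \<open>If the chain has a jump, all levels can be put there, and no set is near a level.\<close>

lemma cuts_at_jump:
  assumes ch: "chain u v" and w: "w \<in> X" "m u w v = w" "w \<noteq> v"
    and jump: "\<And>z. \<lbrakk>z \<in> X; m w z v = z\<rbrakk> \<Longrightarrow> z = w \<or> z = v"
  shows "cuts n u v (\<lambda>_. Br w v) (\<lambda>_. Br v w) {{Br w v, Br v w}}"
proof -
  have uv: "u \<in> X" "v \<in> X" using chainD ch by auto
  have "narrows u v w v" using narrows_interval[OF ch w(1) uv(2) w(3) w(2)] absorb uv by simp
  then show ?thesis
    using branch_disjoint_jump[OF w(1) uv(2) jump] chain_coversI by (auto simp: cuts_def narrows_def)
qed

text \<open>If the chain has no jump towards \<open>v\<close>, there is an infinite increasing sequence \<open>u = p 0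
  < p 1 < \<dots>\<close> below \<open>v\<close>, and \<open>p (i + 1)\<close> serves as \<open>i\<close>-th level.
  The covers of the intervals \<open>[p k, p (k + 1)]\<close> confine a set that is near \<open>p (i + 1)\<close>
  strictly between \<open>p i\<close> and \<open>p (i + 2)\<close>.\<close>

lemma cuts_in_dense:
  assumes ch: "chain u v"
    and dense: "\<And>w. \<lbrakk>w \<in> X; m u w v = w; w \<noteq> v\<rbrakk> \<Longrightarrow>
      \<exists>z\<in>X. m u z v = z \<and> m u w z = w \<and> z \<noteq> w \<and> z \<noteq> v"
  shows "\<exists>L H S. cuts n u v L H S"
proof -
  have uv: "u \<in> X" "v \<in> X" "u \<noteq> v" using chainD ch by auto
  let ?ok = "\<lambda>w. w \<in> X \<and> m u w v = w \<and> w \<noteq> v"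
  have "\<exists>p. p 0 = u \<and> (\<forall>k. ?ok (p k) \<and> m u (p k) (p (Suc k)) = p k \<and> p (Suc k) \<noteq> p k)"
  proof -
    obtain g where g: "\<And>w. ?ok w \<Longrightarrow> ?ok (g w) \<and> m u w (g w) = w \<and> g w \<noteq> w" using dense by metis
    have ok: "?ok ((g ^^ k) u)" for k
      by (induction k) (use uv absorb' g in auto)
    show ?thesis using ok g by (intro exI[of _ "\<lambda>k. (g ^^ k) u"]) simp
  qed
  then obtain p where p0: "p 0 = u" and pX: "\<And>k. p k \<in> X" and puv: "\<And>k. m u (p k) v = p k"
    and pv: "\<And>k. p k \<noteq> v" and step: "\<And>k. m u (p k) (p (Suc k)) = p k" "\<And>k. p (Suc k) \<noteq> p k"
    by blast
  have mono: "m u (p i) (p k) = p i" if "i \<le> k" for i k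
    using that
  proof (induction k rule: dec_induct)
    case base
    show ?case using absorb pX uv by simp
  next
    case (step k)
    then show ?case using between_trans(1)[of u "p i" "p k" "p (Suc k)"] \<open>\<And>k. m u (p k) (p (Suc k)) = p k\<close>
        pX uv by simp
  qed
  have monov: "m v (p k) (p i) = p k" if "i \<le> k" for i k
  proof -
    have "m (p i) (p k) v = p k" using between_trans(2)[of u "p i" "p k" v] mono[OF that] puv pX uv by simp
    then show ?thesis using sym3 pX uv by metis
  qed
  have notu: "p (Suc k) \<noteq> u" for k
  proof
    assume "p (Suc k) = u"
    then have "p k = u" "p (Suc k) = u" using step(1)[of k] absorb' uv pX by auto
    then show False using step(2)[of k] by simp
  qed
  define lo hi where "lo k = Br u (p k)" and "hi k = Br v (p k)" for k
  have lo_mono: "lo i \<subseteq> lo k" and hi_mono: "hi k \<subseteq> hi i" if "i \<le> k" for i k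
    unfolding lo_def hi_def using branch_mono_right mono[OF that] monov[OF that] pX uv by blast+
  have lo_hi: "lo k \<inter> hi k = {}" for k
    unfolding lo_def hi_def by (rule branch_disjoint_at[OF ch pX puv])
  have lo_uv: "lo k \<subseteq> Br u v" and hi_vu: "hi k \<subseteq> Br v u" for k
    unfolding lo_def hi_def using branch_mono_right[of u v "p k"] branch_mono_right[of v u "p k"]
      puv pX uv median_flip by metis+
  have cover: "{lo (Suc k), hi k} \<in> chain_covers X m" for k
  proof -
    have "chain u (p (Suc k))" "chain v (p k)" "chain (p k) (p (Suc k))"
      using chain_sub[OF ch] uv pX puv pv notu step(2) absorb absorb' by metis+
    moreover have "Br (p k) (p (Suc k)) = lo (Suc k)" unfolding lo_def
      by (rule branch_left_eq[OF calculation(1) pX step(1)]) (use step(2)[of k] in metis)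
    moreover have "Br (p (Suc k)) (p k) = hi k" unfolding hi_def
      by (rule branch_left_eq[OF calculation(2) pX monov]) (use step(2)[of k] in auto)
    ultimately show ?thesis using chain_coversI by metis
  qed
  let ?S = "(\<lambda>k. {lo (Suc k), hi k}) ` {..Suc n}"
  have "A \<subseteq> lo (Suc i) \<or> A \<subseteq> hi (Suc i) \<or>
      A \<subseteq> gap u v \<and> (\<forall>k\<le>n. k \<noteq> i \<longrightarrow> A \<subseteq> lo (Suc k) \<or> A \<subseteq> hi (Suc k))"
    if A: "\<forall>C\<in>?S. \<exists>P\<in>C. A \<subseteq> P" and i: "i \<le> n" for A i
  proof (cases "A \<subseteq> lo (Suc i) \<or> A \<subseteq> hi (Suc i)")
    case False
    have alt: "A \<subseteq> lo (Suc k) \<or> A \<subseteq> hi k" if "k \<le> Suc n" for k using A that by auto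
    have A': "A \<subseteq> hi i" "A \<subseteq> lo (Suc (Suc i))" using alt[of i] alt[of "Suc i"] i False by auto
    then have "A \<subseteq> gap u v" using lo_uv hi_vu unfolding gap_def by blast
    moreover have "A \<subseteq> lo (Suc k) \<or> A \<subseteq> hi (Suc k)" if "k \<noteq> i" for k
      using A' lo_mono[of "Suc (Suc i)" "Suc k"] hi_mono[of "Suc k" i] that
      by (cases "k < i") auto
    ultimately show ?thesis by blast
  qed blast
  moreover have "?S \<subseteq> chain_covers X m" using cover by auto
  ultimately have "cuts n u v (\<lambda>k. lo (Suc k)) (\<lambda>k. hi (Suc k)) ?S"
    unfolding cuts_def using lo_hi lo_uv hi_vu by simp
  then show ?thesis by blast
qed

lemma cuts_exist:
  assumes ch: "chain u v"
  shows "\<exists>L H S. cuts n u v L H S"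
proof (cases "\<forall>w\<in>X. m u w v = w \<and> w \<noteq> v \<longrightarrow> (\<exists>z\<in>X. m u z v = z \<and> m u w z = w \<and> z \<noteq> w \<and> z \<noteq> v)")
  case True
  then show ?thesis using cuts_in_dense[OF ch] by blast
next
  case False
  have uv: "u \<in> X" "v \<in> X" using chainD ch by auto
  obtain w where w: "w \<in> X" "m u w v = w" "w \<noteq> v"
    and none: "\<And>z. \<lbrakk>z \<in> X; m u z v = z; m u w z = w\<rbrakk> \<Longrightarrow> z = w \<or> z = v" using False by blast
  have "z = w \<or> z = v" if z: "z \<in> X" "m w z v = z" for z
  proof (rule none[OF z(1)])
    have "m v z w = z" "m v w u = w" using z w uv median_flip by metis+
    then have "m v z u = z" "m z w u = w" using between_trans[of v z w u] z(1) w(1) uv by auto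
    then show "m u z v = z" "m u w z = w" using median_flip z(1) w(1) uv by metis+
  qed
  then show ?thesis using cuts_at_jump[OF ch w] by blast
qed

text \<open>The cover consists of the cells cut out by the \<open>i\<close>-th levels of all chains, for \<open>i
  \<le> n\<close>. A point belongs to at most one cell for each \<open>i\<close>. If a small set \<open>A\<close>
  fitted into no cell, it would for each \<open>i\<close> be near the \<open>i\<close>-th level of some chain; these
  \<open>n + 1\<close> chains are distinct, because \<open>A\<close> is near at most one level of a chain, and
  \<open>A\<close> is interior to all of them.\<close>

lemma low_order_refinement:
  assumes C0: "C0 \<in> median_uniformity X m" and nc: "\<not> embeds_cube X m (n + 1)"
  shows "\<exists>E\<in>median_uniformity X m. finite E \<and> cover_refines E C0 \<and>
    (\<forall>x\<in>X. card {A \<in> E. x \<in> A} \<le> n + 1)"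
proof -
  interpret covering_uniformity X "median_uniformity X m" by (rule covering_uniformity_median)
  obtain K where K: "K \<subseteq> chain_covers X m" "finite K" "cover_refines (common_refinement X K) C0"
    using C0 by (rule median_uniformityE)
  have "\<exists>u v. chain u v \<and> C = {Br u v, Br v u}" if "C \<in> K" for C
    by (rule chain_coversE[OF subsetD[OF K(1) that]]) blast
  then obtain u0 v0 where uv0: "\<And>C. C \<in> K \<Longrightarrow> chain (u0 C) (v0 C)"
    "\<And>C. C \<in> K \<Longrightarrow> C = {Br (u0 C) (v0 C), Br (v0 C) (u0 C)}" by metis
  obtain u v where nar: "\<And>C. C \<in> K \<Longrightarrow> narrows (u0 C) (v0 C) (u C) (v C)"
    and few: "\<And>T. \<lbrakk>T \<subseteq> K; card T = n + 1\<rbrakk> \<Longrightarrow> \<not> (\<exists>x\<in>X. \<forall>t\<in>T. x \<in> gap (u t) (v t))"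
    using narrow_family[OF K(2), of u0 v0, OF uv0(1) nc] by blast
  have "\<forall>C\<in>K. \<exists>L H S. cuts n (u C) (v C) L H S" using nar cuts_exist unfolding narrows_def by blast
  then obtain L H S where LHS: "\<And>C. C \<in> K \<Longrightarrow> cuts n (u C) (v C) (L C) (H C) (S C)" by metis
  have disj: "L C i \<inter> H C i = {}" and Luv: "L C i \<subseteq> Br (u C) (v C)" and Hvu: "H C i \<subseteq> Br (v C) (u C)"
    and Scc: "S C \<subseteq> chain_covers X m" and Sfin: "finite (S C)" if "C \<in> K" for C i
    using LHS[OF that] by (auto simp: cuts_def)
  define cell where "cell i \<Lambda> = {x \<in> X. \<forall>C\<in>K. if C \<in> \<Lambda> then x \<in> L C i else x \<in> H C i}" for i \<Lambda>
  define E where "E = (\<lambda>(i, \<Lambda>). cell i \<Lambda>) ` ({..n} \<times> Pow K)"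
  have cellE: "cell i \<Lambda> \<in> E" if "i \<le> n" "\<Lambda> \<subseteq> K" for i \<Lambda> using that by (auto simp: E_def)
  have EcellE: "\<exists>i \<Lambda>. i \<le> n \<and> \<Lambda> \<subseteq> K \<and> A = cell i \<Lambda>" if "A \<in> E" for A using that by (auto simp: E_def)
  have finE: "finite E" using K(2) by (simp add: E_def)
  have ref0: "cover_refines E C0"
  proof (rule cover_refines_trans[OF _ K(3)], unfold cover_refines_def, intro ballI)
    fix A assume "A \<in> E"
    then obtain i \<Lambda> where A: "A = cell i \<Lambda>" using EcellE by blast
    show "\<exists>N\<in>common_refinement X K. A \<subseteq> N"
    proof (rule in_common_refinementI)
      show "A \<subseteq> X" by (auto simp: A cell_def)
      fix C assume C: "C \<in> K"
      have sub: "Br (u C) (v C) \<subseteq> Br (u0 C) (v0 C)" "Br (v C) (u C) \<subseteq> Br (v0 C) (u0 C)"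
        using nar[OF C] by (auto simp: narrows_def)
      have AC: "A \<subseteq> (if C \<in> \<Lambda> then L C i else H C i)" using C by (auto simp: A cell_def)
      have "A \<subseteq> Br (u0 C) (v0 C) \<or> A \<subseteq> Br (v0 C) (u0 C)"
      proof (cases "C \<in> \<Lambda>")
        case True
        then show ?thesis using AC Luv[OF C, of i] sub(1) by auto
      next
        case False
        then show ?thesis using AC Hvu[OF C, of i] sub(2) by auto
      qed
      then show "\<exists>P\<in>C. A \<subseteq> P" by (subst uv0(2)[OF C]) auto
    qed
  qed
  let ?S = "\<Union>(S ` K)"
  have Sub: "?S \<subseteq> chain_covers X m" "finite ?S" using Scc Sfin K(2) by auto
  have refE: "\<exists>N\<in>E. A \<subseteq> N" if A: "A \<in> common_refinement X ?S" for A
  proof (cases "A = {}")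
    case True
    then show ?thesis using cellE[of 0 "{}"] by blast
  next
    case False
    then obtain x where x: "x \<in> A" "x \<in> X" using common_refinement_subset[OF A] by blast
    have split: "A \<subseteq> L C i \<or> A \<subseteq> H C i \<or> A \<subseteq> gap (u C) (v C) \<and>
        (\<forall>k\<le>n. k \<noteq> i \<longrightarrow> A \<subseteq> L C k \<or> A \<subseteq> H C k)" if C: "C \<in> K" and i: "i \<le> n" for C i
    proof -
      have "\<forall>D\<in>S C. \<exists>P\<in>D. A \<subseteq> P"
      proof
        fix D assume "D \<in> S C"
        then have "D \<in> ?S" using C by blast
        then show "\<exists>P\<in>D. A \<subseteq> P"
          using common_refinement_refines[of D ?S X] A unfolding cover_refines_def by blast
      qed
      then show ?thesis using LHS[OF C] i unfolding cuts_def by blast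
    qed
    have "\<exists>i\<le>n. \<forall>C\<in>K. A \<subseteq> L C i \<or> A \<subseteq> H C i"
    proof (rule ccontr)
      assume "\<not> ?thesis"
      then have "\<exists>C. i \<le> n \<longrightarrow> C \<in> K \<and> \<not> A \<subseteq> L C i \<and> \<not> A \<subseteq> H C i" for i by blast
      \<comment> \<open>\<open>c i\<close> is a chain for which \<open>A\<close> is near the \<open>i\<close>-th level.\<close>
      then obtain c where c: "\<And>i. i \<le> n \<Longrightarrow> c i \<in> K \<and> \<not> A \<subseteq> L (c i) i \<and> \<not> A \<subseteq> H (c i) i"
        by metis
      have "inj_on c {..n}"
      proof (rule inj_onI, rule ccontr)
        fix i k assume ik: "i \<in> {..n}" "k \<in> {..n}" "c i = c k" "i \<noteq> k"
        then have "i \<le> n" "k \<le> n" by auto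
        then show False using c[of i] c[of k] split[of "c i" i] ik(3,4) by metis
      qed
      then have "card (c ` {..n}) = n + 1" by (simp add: card_image)
      moreover have "c ` {..n} \<subseteq> K" using c by auto
      moreover have "x \<in> gap (u (c i)) (v (c i))" if "i \<le> n" for i
        using c[OF that] split[of "c i" i] that x(1) by blast
      then have "\<forall>t\<in>c ` {..n}. x \<in> gap (u t) (v t)" by simp
      ultimately show False using few[of "c ` {..n}"] x(2) by blast
    qed
    then obtain i where i: "i \<le> n" "\<And>C. C \<in> K \<Longrightarrow> A \<subseteq> L C i \<or> A \<subseteq> H C i" by blast
    have "A \<subseteq> cell i {C \<in> K. A \<subseteq> L C i}"
      using i(2) common_refinement_subset[OF A] by (auto simp: cell_def)
    then show ?thesis using cellE[OF i(1), of "{C \<in> K. A \<subseteq> L C i}"] by blast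
  qed
  have inU: "common_refinement X ?S \<in> median_uniformity X m"
    by (rule chain_refinement_in_uniformity[OF Sub])
  have "is_cover X E"
    unfolding is_cover_def
  proof
    show "E \<subseteq> Pow X" using EcellE by (fastforce simp: cell_def)
    have "X \<subseteq> \<Union>E"
    proof
      fix x assume "x \<in> X"
      then obtain A where "A \<in> common_refinement X ?S" "x \<in> A" using member_containing[OF inU] by blast
      then show "x \<in> \<Union>E" using refE by blast
    qed
    then show "\<Union>E = X" using \<open>E \<subseteq> Pow X\<close> by blast
  qed
  then have EU: "E \<in> median_uniformity X m"
    using coarser[OF inU] refE unfolding cover_refines_def by blast
  have "card {A \<in> E. x \<in> A} \<le> n + 1" if x: "x \<in> X" for x
  proof -
    let ?c = "\<lambda>i. cell i {C \<in> K. x \<in> L C i}"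
    have "{A \<in> E. x \<in> A} \<subseteq> ?c ` {..n}"
    proof
      fix A assume "A \<in> {A \<in> E. x \<in> A}"
      then obtain i \<Lambda> where i: "i \<le> n" "\<Lambda> \<subseteq> K" "A = cell i \<Lambda>" "x \<in> cell i \<Lambda>" using EcellE by blast
      have "x \<in> L C i \<longleftrightarrow> C \<in> \<Lambda>" if "C \<in> K" for C
        using i(4) disj[OF that, of i] that by (auto simp: cell_def)
      then have "\<Lambda> = {C \<in> K. x \<in> L C i}" using i(2) by blast
      then show "A \<in> ?c ` {..n}" using i(1,3) by blast
    qed
    then have "card {A \<in> E. x \<in> A} \<le> card (?c ` {..n})" by (intro card_mono) auto
    also have "\<dots> \<le> n + 1" using card_image_le[of "{..n}" ?c] by simp
    finally show ?thesis .
  qed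
  then show ?thesis using EU finE ref0 by blast
qed

end

section \<open>Rank of the compactification\<close>

text \<open>The number \<open>N\<close> is a strict upper bound for the rank of \<open>X\<close>.\<close>

locale median_compactification = median_algebra X m
  for X :: "'a set" and m :: "'a \<Rightarrow> 'a \<Rightarrow> 'a \<Rightarrow> 'a" +
  fixes Y :: "'b set" and V :: "'b set set set" and m' :: "'b \<Rightarrow> 'b \<Rightarrow> 'b \<Rightarrow> 'b" and j :: "'a \<Rightarrow> 'b"
    and N :: nat
  assumes mmc: "is_mmc X m Y V m' j" and no_cube: "\<not> embeds_cube X m N"
begin

abbreviation "U \<equiv> median_uniformity X m"
abbreviation "TY \<equiv> uniform_topology Y V"

lemma mmc_facts:
  shows Y_uniformity: "covering_uniformity Y V" and Y_hausdorff: "Hausdorff_space TY"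
    and Y_complete: "uniformly_complete Y V" and j_in: "x \<in> X \<Longrightarrow> j x \<in> Y"
    and j_dense: "TY closure_of (j ` X) = Y"
    and U_iff: "C \<in> U \<longleftrightarrow> is_cover X C \<and> (\<exists>D\<in>V. cover_refines {X \<inter> j -` B | B. B \<in> D} C)"
    and j_hom: "\<lbrakk>a \<in> X; b \<in> X; c \<in> X\<rbrakk> \<Longrightarrow> m' (j a) (j b) (j c) = j (m a b c)"
    and Y_topological: "topological_median_algebra TY m'"
  using mmc unfolding is_mmc_def hausdorff_completion_def by (blast | auto)+

sublocale Y: covering_uniformity Y V by (rule Y_uniformity)

lemma j_inj: "inj_on j X"
proof (rule inj_onI, rule ccontr)
  fix x y assume xy: "x \<in> X" "y \<in> X" "j x = j y" "x \<noteq> y"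
  obtain C where C: "C \<in> U" "y \<notin> cover_star C {x}"
    using median_uniformity_separates[OF no_cube xy(1,2,4)] by blast
  obtain D where D: "D \<in> V" "cover_refines {X \<inter> j -` B | B. B \<in> D} C"
    using C(1) unfolding U_iff by blast
  obtain B where B: "B \<in> D" "j x \<in> B" using Y.member_containing[OF D(1) j_in[OF xy(1)]] by blast
  obtain A where A: "A \<in> C" "X \<inter> j -` B \<subseteq> A" using D(2) B(1) unfolding cover_refines_def by blast
  have "x \<in> X \<inter> j -` B" "y \<in> X \<inter> j -` B" using B(2) xy(1-3) by simp_all
  then have "x \<in> A" "y \<in> A" using A(2) by blast+
  then have "y \<in> cover_star C {x}" unfolding mem_cover_star by (intro bexI[OF _ A(1)] conjI)
  then show False using C(2) by contradiction
qed

text \<open>The given uniformity is the initial one along \<open>j\<close>.\<close>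

lemma trace_in_U:
  assumes D: "D \<in> V"
  shows "{X \<inter> j -` B | B. B \<in> D} \<in> U" (is "?C \<in> U")
proof -
  have "is_cover X ?C" unfolding is_cover_def
  proof
    show "?C \<subseteq> Pow X" by blast
    have "X \<subseteq> \<Union>?C"
    proof
      fix x assume x: "x \<in> X"
      obtain B where B: "B \<in> D" "j x \<in> B" by (rule Y.member_containing[OF D j_in[OF x]])
      then have "X \<inter> j -` B \<in> ?C" "x \<in> X \<inter> j -` B" using x by auto
      then show "x \<in> \<Union>?C" by (rule UnionI)
    qed
    then show "\<Union>?C = X" by blast
  qed
  then show ?thesis unfolding U_iff by (intro conjI bexI[OF cover_refines_refl D])
qed

lemma dense_meets:
  assumes "openin TY G" "y \<in> G" obtains x where "x \<in> X" "j x \<in> G"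
proof -
  have "y \<in> TY closure_of (j ` X)"
    using assms openin_subset unfolding j_dense by (fastforce simp: Y.topspace_uniform_topology)
  then show ?thesis using assms that unfolding in_closure_of by blast
qed

lemma continuous_map_median:
  assumes "continuous_map Z TY f" "continuous_map Z TY g" "continuous_map Z TY h"
  shows "continuous_map Z TY (\<lambda>z. m' (f z) (g z) (h z))"
proof -
  have "continuous_map Z (prod_topology TY (prod_topology TY TY)) (\<lambda>z. (f z, g z, h z))"
    using assms by (intro continuous_map_pairedI)
  moreover have "continuous_map (prod_topology TY (prod_topology TY TY)) TY (\<lambda>(a, b, c). m' a b c)"
    using Y_topological by (simp add: topological_median_algebra_def)
  ultimately show ?thesis using continuous_map_compose by (fastforce simp: comp_def)
qed

lemma continuous_map_meval:
  assumes "\<And>i. continuous_map Z TY (\<lambda>z. \<rho> z i)"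
  shows "continuous_map Z TY (\<lambda>z. meval m' (\<rho> z) t)"
proof (induction t)
  case (Var i)
  then show ?case using assms[of i] by simp
next
  case (Med r s t)
  then show ?case using continuous_map_median by simp
qed

text \<open>Finitely many inequalities between continuous functions with values in a Hausdorff space define an open
  set.\<close>

lemma openin_injective_parameter:
  assumes "finite I" "\<And>e. e \<in> I \<Longrightarrow> continuous_map TY TY (f e)"
  shows "openin TY {y \<in> Y. inj_on (\<lambda>e. f e y) I}"
proof -
  let ?P = "{(e, e'). e \<in> I \<and> e' \<in> I \<and> e \<noteq> e'}"
  let ?K = "\<lambda>p. {y \<in> topspace TY. f (fst p) y = f (snd p) y}"
  have "finite ?P" by (rule finite_subset[of _ "I \<times> I"]) (use assms(1) in auto)
  moreover have "closedin TY (?K p)" if "p \<in> ?P" for p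
    by (intro closedin_continuous_maps_eq[OF Y_hausdorff] assms(2)) (use that in auto)
  ultimately have "closedin TY (\<Union>p\<in>?P. ?K p)" by (intro closedin_Union) auto
  then have "openin TY (topspace TY - (\<Union>p\<in>?P. ?K p))" by (intro openin_diff) auto
  moreover have "topspace TY - (\<Union>p\<in>?P. ?K p) = {y \<in> Y. inj_on (\<lambda>e. f e y) I}"
    unfolding Y.topspace_uniform_topology inj_on_def by auto
  ultimately show ?thesis by simp
qed

lemma finite_cube: "finite (cube n)"
  unfolding cube_def by (intro finite_PiE) auto

lemma embeds_cube_completion:
  assumes "embeds_cube X m n" shows "embeds_cube Y m' n"
proof -
  obtain f where f: "median_embedding (cube n) (cube_median n) X m f"
    using assms by (auto simp: embeds_cube_def)
  then have fX: "f e \<in> X" if "e \<in> cube n" for e using that by (auto simp: median_embedding_def)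
  have "inj_on (j \<circ> f) (cube n)"
    using f j_inj fX unfolding median_embedding_def by (intro comp_inj_on) (auto intro: inj_on_subset)
  then have "median_embedding (cube n) (cube_median n) Y m' (j \<circ> f)"
    using f fX j_in j_hom unfolding median_embedding_def by auto
  then show ?thesis by (auto simp: embeds_cube_def)
qed

text \<open>The function \<open>\<kappa>\<close> identifies all variables that do not occur in the cube term with
  variable 0, so that after \<open>n + 2\<close> replacements all values of the assignment lie in the dense
  subalgebra.\<close>

lemma embeds_cube_of_completion:
  assumes "embeds_cube Y m' n" shows "embeds_cube X m n"
proof -
  obtain g where g: "median_embedding (cube n) (cube_median n) Y m' g"
    using assms by (auto simp: embeds_cube_def)
  define \<kappa> :: "nat \<Rightarrow> nat" where "\<kappa> i = (if i < n + 2 then i else 0)" for i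
  \<comment> \<open>Bottom (\<open>i = 0\<close>), top (\<open>i = 1\<close>) and atoms (\<open>i = k + 2\<close>) of the cube.\<close>
  define vertex where "vertex i = restrict (\<lambda>k. i = 1 \<or> i = k + 2) {..<n}" for i
  define nondegenerate where "nondegenerate \<tau> \<longleftrightarrow> inj_on (\<lambda>e. meval m' (\<lambda>i. \<tau> (\<kappa> i)) (cube_term n e)) (cube n)"
    for \<tau> :: "nat \<Rightarrow> 'b"
  have vc: "vertex i \<in> cube n" for i unfolding vertex_def by (rule restrict_in_cube)
  have vertex_term: "meval (cube_median n) (\<lambda>i. vertex (\<kappa> i)) (cube_term n e) = e" if e: "e \<in> cube n" for e
  proof (rule cube_eqI[OF _ e])
    show "meval (cube_median n) (\<lambda>i. vertex (\<kappa> i)) (cube_term n e) \<in> cube n"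
      by (rule meval_closed) (auto intro: cube_median_in_cube vc)
    fix k assume k: "k < n"
    have "meval (cube_median n) (\<lambda>i. vertex (\<kappa> i)) (cube_term n e) k
        = meval majority (\<lambda>i. vertex (\<kappa> i) k) (cube_term n e)"
      by (rule meval_hom[of "cube n" _ "\<lambda>e. e k"])
        (auto intro: cube_median_in_cube vc simp: cube_median_apply k)
    also have "\<dots> = e k"
      by (rule cube_term_coordinate[OF k]) (use k in \<open>auto simp: vertex_def \<kappa>_def\<close>)
    finally show "meval (cube_median n) (\<lambda>i. vertex (\<kappa> i)) (cube_term n e) k = e k" .
  qed
  have g_term: "meval m' (\<lambda>i. g (vertex (\<kappa> i))) (cube_term n e) = g e" if e: "e \<in> cube n" for e
  proof -
    have "g (meval (cube_median n) (\<lambda>i. vertex (\<kappa> i)) (cube_term n e))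
        = meval m' (\<lambda>i. g (vertex (\<kappa> i))) (cube_term n e)"
      by (rule meval_hom[of "cube n"]) (use g vc in \<open>auto simp: median_embedding_def intro: cube_median_in_cube\<close>)
    then show ?thesis using vertex_term[OF e] by simp
  qed
  have "\<exists>\<tau>. (\<forall>i. \<tau> i \<in> Y) \<and> (\<forall>i<k. \<tau> i \<in> j ` X) \<and> nondegenerate \<tau>" for k
  proof (induction k)
    case 0
    have "nondegenerate (\<lambda>i. g (vertex i))"
      using g unfolding nondegenerate_def median_embedding_def inj_on_def by (simp add: g_term)
    moreover have "g (vertex i) \<in> Y" for i using g vc by (auto simp: median_embedding_def)
    ultimately show ?case by (intro exI[of _ "\<lambda>i. g (vertex i)"]) simp
  next
    case (Suc k)
    then obtain \<tau> where \<tau>: "\<And>i. \<tau> i \<in> Y" "\<And>i. i < k \<Longrightarrow> \<tau> i \<in> j ` X" "nondegenerate \<tau>" by blast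
    let ?f = "\<lambda>e y. meval m' (\<lambda>i. (\<tau>(k := y)) (\<kappa> i)) (cube_term n e)"
    have "continuous_map TY TY (\<lambda>y. (\<tau>(k := y)) i)" for i
      using \<tau>(1) by (cases "i = k") (auto simp: Y.topspace_uniform_topology)
    then have "continuous_map TY TY (?f e)" for e by (intro continuous_map_meval)
    then have "openin TY {y \<in> Y. inj_on (\<lambda>e. ?f e y) (cube n)}"
      by (intro openin_injective_parameter finite_cube)
    moreover have "\<tau> k \<in> {y \<in> Y. inj_on (\<lambda>e. ?f e y) (cube n)}" 
      using \<tau>(1,3) by (simp add: nondegenerate_def del: fun_upd_apply)
    ultimately obtain x where x: "x \<in> X" "j x \<in> {y \<in> Y. inj_on (\<lambda>e. ?f e y) (cube n)}"
      using dense_meets by blast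
    then have "nondegenerate (\<tau>(k := j x))" by (simp add: nondegenerate_def del: fun_upd_apply)
    moreover have "(\<tau>(k := j x)) i \<in> j ` X" if "i < Suc k" for i using that \<tau>(2) x(1) by (cases "i = k") auto
    moreover have "(\<tau>(k := j x)) i \<in> Y" for i using \<tau>(1) x by auto
    ultimately show ?case by (intro exI[of _ "\<tau>(k := j x)"]) blast
  qed
  from this[of "n + 2"] obtain \<tau> where \<tau>: "\<And>i. i < n + 2 \<Longrightarrow> \<tau> i \<in> j ` X" "nondegenerate \<tau>" by blast
  have "\<forall>i. \<exists>x\<in>X. \<tau> (\<kappa> i) = j x" using \<tau>(1) by (auto simp: \<kappa>_def)
  then obtain \<sigma> where \<sigma>: "\<And>i. \<sigma> i \<in> X" "\<And>i. \<tau> (\<kappa> i) = j (\<sigma> i)" by metis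
  have jt: "j (meval m \<sigma> t) = meval m' (\<lambda>i. j (\<sigma> i)) t" for t
    by (rule meval_hom[of X]) (auto intro: closed simp: j_hom \<sigma>)
  have "inj_on (\<lambda>e. meval m \<sigma> (cube_term n e)) (cube n)"
    using \<tau>(2) unfolding nondegenerate_def \<sigma>(2) jt[symmetric] inj_on_def by metis
  then show ?thesis by (intro embeds_cube_of_term[OF no_cube, of \<sigma>] \<sigma>(1))
qed

theorem rank_completion: "median_rank Y m' = median_rank X m"
proof -
  have "embeds_cube Y m' n \<longleftrightarrow> embeds_cube X m n" for n
    using embeds_cube_completion embeds_cube_of_completion by blast
  then show ?thesis unfolding median_rank_def embeds_cube_def by simp
qed

end

section \<open>Covering dimension of the compactification\<close>

context median_compactification begin

lemma Y_precompact:
  assumes D: "D \<in> V"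
  shows "\<exists>D0\<subseteq>D. finite D0 \<and> Y \<subseteq> \<Union>D0"
proof -
  obtain E where E: "E \<in> V" "\<And>A. A \<in> E \<Longrightarrow> \<exists>B\<in>D. cover_star E A \<subseteq> B"
    using Y.star_refinement[OF D] by blast
  let ?C = "{X \<inter> j -` B | B. B \<in> E}"
  have "?C \<in> U" by (rule trace_in_U[OF E(1)])
  then obtain C0 where C0: "C0 \<subseteq> ?C" "finite C0" "X \<subseteq> \<Union>C0"
    using median_uniformity_precompact by meson
  have "\<exists>B'\<in>D. \<exists>B\<in>E. c = X \<inter> j -` B \<and> cover_star E B \<subseteq> B'" if "c \<in> C0" for c
  proof -
    from that C0(1) obtain B where "B \<in> E" "c = X \<inter> j -` B" by blast
    then show ?thesis using E(2) by blast
  qed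
  then obtain g where g: "\<And>c. c \<in> C0 \<Longrightarrow> g c \<in> D"
    "\<And>c. c \<in> C0 \<Longrightarrow> \<exists>B\<in>E. c = X \<inter> j -` B \<and> cover_star E B \<subseteq> g c" by metis
  have "y \<in> \<Union>(g ` C0)" if y: "y \<in> Y" for y
  proof -
    obtain G where G: "openin TY G" "y \<in> G" "G \<subseteq> cover_star E {y}"
      by (rule Y.star_is_neighbourhood[OF E(1) y])
    obtain x where x: "x \<in> X" "j x \<in> G" by (rule dense_meets[OF G(1,2)])
    then obtain A where A: "A \<in> E" "y \<in> A" "j x \<in> A" using G(3) unfolding cover_star_def by blast
    obtain c where c: "c \<in> C0" "x \<in> c" using C0(3) x(1) by blast
    obtain B where B: "B \<in> E" "c = X \<inter> j -` B" "cover_star E B \<subseteq> g c" using g(2)[OF c(1)] by blast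
    have "j x \<in> B" using B(2) c(2) by simp
    then have "y \<in> cover_star E B" using A unfolding cover_star_def by blast
    then show ?thesis using B(3) c(1) by blast
  qed
  then have "Y \<subseteq> \<Union>(g ` C0)" by blast
  moreover have "g ` C0 \<subseteq> D" using g(1) by blast
  ultimately show ?thesis using C0(2) by (intro exI[of _ "g ` C0"]) simp
qed

text \<open>The largest open set of the compactification whose trace on the dense subalgebra is contained in
  \<open>A\<close>.\<close>

definition extension :: "'a set \<Rightarrow> 'b set" where
  "extension A = Y - TY closure_of (j ` (X - A))"

lemma openin_extension: "openin TY (extension A)"
  using openin_diff[OF openin_topspace[of TY] closedin_closure_of]
  by (simp add: extension_def Y.topspace_uniform_topology)

text \<open>If finitely many extensions have a common point, then the sets themselves have a common point, arbitrarily
  near to it. Thus extending a cover does not increase its order.\<close>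

lemma extension_dense: 
  assumes "openin TY G" "y \<in> G" "y \<in> Y" "\<And>A. A \<in> \<A> \<Longrightarrow> y \<in> extension A" "finite \<A>"
  obtains x where "x \<in> X" "j x \<in> G" "\<And>A. A \<in> \<A> \<Longrightarrow> x \<in> A"
proof -
  have "openin TY (G \<inter> (\<Inter>A\<in>\<A>. extension A))" if "\<A> \<noteq> {}"
    using that assms(1,5) openin_extension by (intro openin_Int openin_Inter) auto
  then have op: "openin TY (if \<A> = {} then G else G \<inter> (\<Inter>A\<in>\<A>. extension A))" using assms(1) by simp
  obtain x where x: "x \<in> X" "j x \<in> (if \<A> = {} then G else G \<inter> (\<Inter>A\<in>\<A>. extension A))"
    by (rule dense_meets[OF op, of y]) (use assms in auto)
  have "x \<in> A" if "A \<in> \<A>" for A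
  proof (rule ccontr)
    assume "x \<notin> A"
    then have "j x \<in> TY closure_of (j ` (X - A))"
      using x(1) j_in by (intro closure_of_subset[THEN subsetD]) (auto simp: Y.topspace_uniform_topology)
    moreover have "j x \<in> extension A" using x(2) that by (auto split: if_splits)
    ultimately show False by (simp add: extension_def)
  qed
  then show ?thesis using that x by (auto split: if_splits)
qed

lemma extension_covers:
  assumes E: "E \<in> U" and y: "y \<in> Y"
  shows "\<exists>A\<in>E. y \<in> extension A"
proof -
  obtain D where D: "D \<in> V" "cover_refines {X \<inter> j -` B | B. B \<in> D} E" using E unfolding U_iff by blast
  obtain D' where D': "D' \<in> V" "\<And>A. A \<in> D' \<Longrightarrow> \<exists>B\<in>D. cover_star D' A \<subseteq> B"
    using Y.star_refinement[OF D(1)] by blast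
  obtain B' where B': "B' \<in> D'" "y \<in> B'" by (rule Y.member_containing[OF D'(1) y])
  obtain B where B: "B \<in> D" "cover_star D' B' \<subseteq> B" using D'(2)[OF B'(1)] by blast
  obtain A where A: "A \<in> E" "X \<inter> j -` B \<subseteq> A" using D(2) B(1) unfolding cover_refines_def by blast
  obtain G where G: "openin TY G" "y \<in> G" "G \<subseteq> cover_star D' {y}"
    by (rule Y.star_is_neighbourhood[OF D'(1) y])
  have "cover_star D' {y} \<subseteq> cover_star D' B'" using B'(2) by (auto simp: cover_star_def)
  then have GB: "G \<subseteq> B" using G(3) B(2) by blast
  have "y \<notin> TY closure_of (j ` (X - A))"
  proof
    assume "y \<in> TY closure_of (j ` (X - A))"
    then obtain z where "z \<in> j ` (X - A)" "z \<in> G" using G(1,2) unfolding in_closure_of by blast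
    then show False using GB A(2) by auto
  qed
  then show ?thesis using A(1) y by (auto simp: extension_def)
qed

text \<open>Refine a given open cover by a uniform cover, and the trace of a star refinement of the latter by a
  uniform cover of low order. The extensions of its members are the required open cover.\<close>

theorem covering_dim_completion:
  assumes nc: "\<not> embeds_cube X m (n + 1)"
  shows "covering_dim_le TY n"
  unfolding covering_dim_le_def Y.topspace_uniform_topology
proof (intro allI impI, elim conjE)
  fix C assume C: "finite C" "\<forall>A\<in>C. openin TY A" "\<Union>C = Y"
  have "\<exists>D\<in>V. \<forall>y\<in>Y. \<exists>A\<in>C. cover_star D {y} \<subseteq> A"
    by (rule Y.lebesgue_number[OF Y_complete Y_precompact]) (use C in auto)
  then obtain D where D: "D \<in> V" "\<And>y. y \<in> Y \<Longrightarrow> \<exists>A\<in>C. cover_star D {y} \<subseteq> A" by blast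
  obtain D' where D': "D' \<in> V" "\<And>A. A \<in> D' \<Longrightarrow> \<exists>B\<in>D. cover_star D' A \<subseteq> B"
    using Y.star_refinement[OF D(1)] by blast
  let ?C0 = "{X \<inter> j -` B | B. B \<in> D'}"
  have "?C0 \<in> U" by (rule trace_in_U[OF D'(1)])
  then obtain E where E: "E \<in> U" "finite E" "cover_refines E ?C0"
    "\<And>x. x \<in> X \<Longrightarrow> card {A \<in> E. x \<in> A} \<le> n + 1"
    using low_order_refinement[OF _ nc] by meson
  let ?D = "{A \<in> extension ` E. A \<noteq> {}}"
  have "\<exists>N\<in>C. extension A \<subseteq> N" if A: "A \<in> E" and y0: "y0 \<in> extension A" for A y0
  proof -
    obtain B where B: "B \<in> D'" "A \<subseteq> X \<inter> j -` B" using E(3) A unfolding cover_refines_def by blast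
    obtain B' where B': "B' \<in> D" "cover_star D' B \<subseteq> B'" using D'(2)[OF B(1)] by blast
    have sub: "extension A \<subseteq> B'"
    proof
      fix y assume y: "y \<in> extension A"
      then have yY: "y \<in> Y" by (simp add: extension_def)
      obtain G where G: "openin TY G" "y \<in> G" "G \<subseteq> cover_star D' {y}"
        by (rule Y.star_is_neighbourhood[OF D'(1) yY])
      obtain x where x: "x \<in> X" "j x \<in> G" "x \<in> A"
        by (rule extension_dense[OF G(1,2) yY, of "{A}"]) (use y in auto)
      then obtain K where K: "K \<in> D'" "y \<in> K" "j x \<in> K" using G(3) unfolding cover_star_def by blast
      have "j x \<in> B" using B(2) x(3) by blast
      then have "y \<in> cover_star D' B" using K unfolding cover_star_def by blast
      then show "y \<in> B'" using B'(2) by blast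
    qed
    have "y0 \<in> Y" using y0 by (simp add: extension_def)
    then obtain N where N: "N \<in> C" "cover_star D {y0} \<subseteq> N" using D(2) by blast
    have "B' \<subseteq> cover_star D {y0}" using sub y0 B'(1) unfolding cover_star_def by blast
    then show ?thesis using sub N by blast
  qed
  then have refines: "cover_refines ?D C" unfolding cover_refines_def by blast
  have union: "\<Union>?D = Y"
  proof
    show "\<Union>?D \<subseteq> Y" by (auto simp: extension_def)
    show "Y \<subseteq> \<Union>?D"
    proof
      fix y assume "y \<in> Y"
      then obtain A where "A \<in> E" "y \<in> extension A" using extension_covers[OF E(1)] by blast
      then show "y \<in> \<Union>?D" by blast
    qed
  qed
  have order: "card {A \<in> ?D. y \<in> A} \<le> n + 1" if y: "y \<in> Y" for y
  proof -
    \<comment> \<open>All members of \<open>E\<close> whose extension contains \<open>y\<close> have a common point \<open>x\<close>.\<close>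
    let ?E = "{A \<in> E. y \<in> extension A}"
    obtain x where x: "x \<in> X" "\<And>A. A \<in> ?E \<Longrightarrow> x \<in> A"
      by (rule extension_dense[OF openin_topspace, of y ?E]) (use y E(2) in \<open>auto simp: Y.topspace_uniform_topology\<close>)
    have "{A \<in> ?D. y \<in> A} \<subseteq> extension ` ?E" by auto
    then have "card {A \<in> ?D. y \<in> A} \<le> card (extension ` ?E)" using E(2) by (intro card_mono) auto
    also have "\<dots> \<le> card ?E" using E(2) by (intro card_image_le) auto
    also have "\<dots> \<le> card {A \<in> E. x \<in> A}" using x(2) E(2) by (intro card_mono) auto
    also have "\<dots> \<le> n + 1" using E(4)[OF x(1)] .
    finally show ?thesis .
  qed
  have fin: "finite ?D" and op: "\<forall>A\<in>?D. openin TY A" using E(2) openin_extension by auto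
  show "\<exists>D. finite D \<and> (\<forall>A\<in>D. openin TY A) \<and> \<Union>D = Y \<and> cover_refines D C \<and>
      (\<forall>x\<in>Y. card {A \<in> D. x \<in> A} \<le> n + 1)"
    by (intro exI[of _ ?D] conjI ballI fin union refines order) (use op in blast)
qed

end

lemma finite_rank_no_cube:
  assumes "median_rank X m = enat n"
  shows "\<not> embeds_cube X m (n + 1)"
proof
  assume "embeds_cube X m (n + 1)"
  then have "enat (n + 1) \<le> median_rank X m"
    unfolding median_rank_def embeds_cube_def by (intro Sup_upper) blast
  then show False using assms by simp
qed

theorem theorem5p3:
  fixes X :: "'a set" and m :: "'a \<Rightarrow> 'a \<Rightarrow> 'a \<Rightarrow> 'a"
  assumes "median_algebra X m"
    and "median_rank X m < \<infinity>"
  shows "Hausdorff_space (uniform_topology X (median_uniformity X m)) \<and>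
    (\<exists>(Y :: 'a filter set) V m' j. is_mmc X m Y V m' j) \<and>
    (\<forall>(Y :: 'b set) V m' j. is_mmc X m Y V m' j \<longrightarrow>
      median_rank Y m' = median_rank X m \<and>
      covering_dim (uniform_topology Y V) \<le> median_rank X m)"
proof -
  interpret median_algebra X m by (rule assms(1))
  obtain n where n: "median_rank X m = enat n" using assms(2) by auto
  have nc: "\<not> embeds_cube X m (n + 1)" by (rule finite_rank_no_cube[OF n])
  have "median_rank Y m' = median_rank X m \<and> covering_dim (uniform_topology Y V) \<le> median_rank X m"
    if "is_mmc X m Y V m' j" for Y :: "'b set" and V m' j
  proof -
    interpret median_compactification X m Y V m' j "n + 1"
      by unfold_locales (rule that nc)+
    have "covering_dim TY \<le> enat n"
      unfolding covering_dim_def using covering_dim_completion[OF nc] by (intro Inf_lower) blast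
    then show ?thesis using rank_completion n by simp
  qed
  then show ?thesis using median_uniformity_hausdorff[OF nc] mmc_exists by blast
qed

end
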